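(* Let $\alpha\in(0,1)$, $b_1,b_2\in(0,\infty)$, $d>2(b_1+b_2)$, and $\gamma_1,\gamma_2\in\mathbb{R}\setminus\{0\}$ with $\gamma_1+\gamma_2\ne0$. Let $\varepsilon_0>0$ be small and let $\varepsilon\mapsto(\Omega(\varepsilon),Z(\varepsilon),f_1(\varepsilon),f_2(\varepsilon))$, $\varepsilon\in[-\varepsilon_0,\varepsilon_0]$, be the $C^1$ curve in $\mathbb{R}\times\mathbb{R}\times B_1$ of solutions of $F(\varepsilon,\Omega(\varepsilon),Z(\varepsilon),f_1(\varepsilon),f_2(\varepsilon))=0$ with $(\Omega(0),Z(0),f_1(0),f_2(0))=\big(\frac{\gamma_1+\gamma_2}{2d^2},\frac{d\gamma_2}{\gamma_1+\gamma_2},0,0\big)$, where $F$ is the functional defined in the context. Set $\delta_j=\frac{\gamma_{3-j}}{\gamma_j}$. Then, as $\varepsilon\to0$, the conformal parametrizations $\phi_j(\varepsilon,w)=w+\varepsilon b_jf_j(\varepsilon)(w)$ of the boundaries of the co-rotating domains $D_j^\varepsilon$ satisfy, for all $w\in\mathbb{T}$ and $j=1,2$, $$\phi_j(\varepsilon,w)=w+\delta_j\Big(\frac{\varepsilon b_j}{d}\Big)^2\overline w+\frac{\delta_j}{2}\Big(\frac{\varepsilon b_j}{d}\Big)^3\overline w^2+\frac{\delta_j}{3}\Big(\frac{\varepsilon b_j}{d}\Big)^4\big(\overline w^3+6(1+\delta_j)\overline w\big)+\frac{\delta_j}{4}\Big(\frac{\varepsilon b_j}{d}\Big)^5\big(\overline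 w^4+3(1+\delta_j)\overline w^2\big)+o(\varepsilon^5).$$ The angular velocity satisfies $$\Omega(\varepsilon)=\frac{\gamma_1+\gamma_2}{2d^2}+\frac{\varepsilon^4}{2d^6}\big(\gamma_1b_2^4+\gamma_2b_1^4\big)+o(\varepsilon^4),$$ and the center of rotation satisfies $$Z(\varepsilon)=\frac{\gamma_2d}{\gamma_1+\gamma_2}+\frac{\varepsilon^4}{d^3(\gamma_1+\gamma_2)^2}\Big(\frac{\gamma_2^3}{\gamma_1}b_1^4-\frac{\gamma_1^3}{\gamma_2}b_2^4\Big)+o(\varepsilon^4).$$
   Context: $\mathbb{T}$ is the unit circle and $\fint_{\mathbb{T}}h(\tau)\,d\tau=\frac{1}{2i\pi}\int_{\mathbb{T}}h(\tau)\,d\tau$ (complex line integral). $C^{1+\alpha}(\mathbb{T})$ is the usual Hölder space, with $\|f\|_{C^{1+\alpha}}=\|f\|_{L^\infty}+\|f'\|_{C^\alpha}$, where $f'=\frac{df}{dw}$. Let $$X=\Big\{f=(f_1,f_2)\in (C^{1+\alpha}(\mathbb{T}))^2:\ f(w)=\sum_{n\ge1}A_n\overline w^n,\ A_n\in\mathbb{R}^2\Big\},$$ and let $B_1$ be the open unit ball of $X$ (with the maximum of the $C^{1+\alpha}$ norms of the two components). For $\varepsilon$ real with $|\varepsilon|$ small enough that no denominator below vanishes (for $\tau\neq w$), $\Omega,Z\in\mathbb{R}$, $(f_1,f_2)\in B_1$, $w\in\mathbb{T}$ and $j\in\{1,2\}$, set $A=\tau-w$, $B_j=f_j(\tau)-f_j(w)$,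 $F=(F_1,F_2)$ and $$F_j(\varepsilon,\Omega,Z,f_1,f_2)(w)=\mathrm{Im}\Big\{2\Omega\big[\varepsilon b_j(\overline w+\varepsilon b_j\overline{f_j(w)})+(-1)^jZ-(j-1)d\big]w(1+\varepsilon b_jf_j'(w))-\gamma_jf_j'(w)$$ $$+\varepsilon b_j\gamma_jw(1+\varepsilon b_jf_j'(w))\fint_{\mathbb{T}}\frac{A\overline{B_j}-\overline AB_j}{A(A+\varepsilon b_jB_j)}\Big[f_j'(\tau)-\frac{B_j}{A}\Big]d\tau$$ $$-\gamma_{3-j}w(1+\varepsilon b_jf_j'(w))\fint_{\mathbb{T}}\frac{(\overline\tau+\varepsilon b_{3-j}\overline{f_{3-j}(\tau)})(1+\varepsilon b_{3-j}f_{3-j}'(\tau))}{\varepsilon(b_{3-j}\tau+b_jw)+\varepsilon^2(b_{3-j}^2f_{3-j}(\tau)+b_j^2f_j(w))-d}\,d\tau\Big\}.$$ (The equation $F=0$ expresses that the vorticity $\frac{\gamma_1}{\varepsilon^2b_1^2}\chi_{\varepsilon b_1D_1^\varepsilon}+\frac{\gamma_2}{\varepsilon^2b_2^2}\chi_{-\varepsilon b_2D_2^\varepsilon+d}$, with $\partial D_j^\varepsilon=\phi_j(\varepsilon,\mathbb{T})$, rotates rigidly for the 2D Euler equations with angular velocity $\Omega$ about the point $Z$.) For $\varepsilon_0$ small enough, the curve of solutions in the claim exists and is unique. *)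

theory Defs
  imports "HOL-Complex_Analysis.Complex_Analysis" "HOL-Library.Landau_Symbols"
begin

text \<open>
  Functions on the unit circle are total functions on the complex numbers of which only the
  values on the circle matter. A pair \<open>(f\<^sub>1, f\<^sub>2)\<close> is a function \<open>f\<close> on \<open>nat\<close> of which only
  \<open>f 1\<close> and \<open>f 2\<close> matter; likewise for the parameters \<open>b\<close> and \<open>\<gamma>\<close>.
\<close>

abbreviation unit_circle :: "complex set" where
  "unit_circle \<equiv> sphere 0 1"

text \<open>
  The derivative \<open>df/dw\<close> is the limit of the difference quotients of \<open>f\<close> along the circle;
  no extension of \<open>f\<close> off the circle is involved. In particular
  \<open>w \<mapsto> cnj w ^ n\<close> has the derivative \<open>- n * cnj w ^ (n + 1)\<close>.
\<close>

definition circle_deriv :: "(complex \<Rightarrow> complex) \<Rightarrow> complex \<Rightarrow> complex" where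
  "circle_deriv f w = (THE D. (f has_field_derivative D) (at w within unit_circle))"

definition holder_seminorm :: "real \<Rightarrow> (complex \<Rightarrow> complex) \<Rightarrow> real" where
  "holder_seminorm \<alpha> g =
     (SUP (x, y) \<in> {(x, y). x \<in> unit_circle \<and> y \<in> unit_circle \<and> x \<noteq> y}.
        cmod (g x - g y) / cmod (x - y) powr \<alpha>)"

definition holder_norm :: "real \<Rightarrow> (complex \<Rightarrow> complex) \<Rightarrow> real" where
  "holder_norm \<alpha> g = (SUP w \<in> unit_circle. cmod (g w)) + holder_seminorm \<alpha> g"

definition C1_holder :: "real \<Rightarrow> (complex \<Rightarrow> complex) set" where
  "C1_holder \<alpha> = {f.
     (\<forall>w\<in>unit_circle. \<exists>D. (f has_field_derivative D) (at w within unit_circle)) \<and>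
     (\<exists>C. \<forall>x\<in>unit_circle. \<forall>y\<in>unit_circle.
        cmod (circle_deriv f x - circle_deriv f y) \<le> C * cmod (x - y) powr \<alpha>)}"

text \<open>The suprema in the norm are those of bounded sets when \<open>f \<in> C1_holder \<alpha>\<close>.\<close>

definition C1_holder_norm :: "real \<Rightarrow> (complex \<Rightarrow> complex) \<Rightarrow> real" where
  "C1_holder_norm \<alpha> f =
     (SUP w \<in> unit_circle. cmod (f w)) + holder_norm \<alpha> (circle_deriv f)"

text \<open>
  The Fourier series of a function of class \<open>C\<^sup>1\<^sup>+\<^sup>\<alpha>\<close> converges absolutely, so that reading
  the series as an unconditionally convergent sum is no restriction.
\<close>

definition X_space :: "real \<Rightarrow> (nat \<Rightarrow> complex \<Rightarrow> complex) set" where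
  "X_space \<alpha> = {f. \<forall>j\<in>{1,2}. f j \<in> C1_holder \<alpha> \<and>
     (\<exists>A :: nat \<Rightarrow> real. \<forall>w\<in>unit_circle.
        ((\<lambda>n. complex_of_real (A n) * cnj w ^ n) has_sum f j w) {1..})}"

definition X_norm :: "real \<Rightarrow> (nat \<Rightarrow> complex \<Rightarrow> complex) \<Rightarrow> real" where
  "X_norm \<alpha> f = max (C1_holder_norm \<alpha> (f 1)) (C1_holder_norm \<alpha> (f 2))"

definition X_unit_ball :: "real \<Rightarrow> (nat \<Rightarrow> complex \<Rightarrow> complex) set" where
  "X_unit_ball \<alpha> = {f \<in> X_space \<alpha>. X_norm \<alpha> f < 1}"

text \<open>
  Curves of class \<open>C\<^sup>1\<close> on an interval \<open>I\<close>, with one-sided derivatives at end points that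
  belong to \<open>I\<close>: real-valued ones, and ones with values in the normed space
  \<open>X_space \<alpha>\<close>.
\<close>

definition C1_real_curve :: "real set \<Rightarrow> (real \<Rightarrow> real) \<Rightarrow> bool" where
  "C1_real_curve I u \<longleftrightarrow>
     (\<exists>u'. (\<forall>s\<in>I. (u has_real_derivative u' s) (at s within I)) \<and> continuous_on I u')"

definition C1_X_curve :: "real \<Rightarrow> real set \<Rightarrow> (real \<Rightarrow> nat \<Rightarrow> complex \<Rightarrow> complex) \<Rightarrow> bool" where
  "C1_X_curve \<alpha> I f \<longleftrightarrow>
     (\<forall>s\<in>I. f s \<in> X_space \<alpha>) \<and>
     (\<exists>f'. (\<forall>s\<in>I. f' s \<in> X_space \<alpha>) \<and>
        (\<forall>s\<in>I. ((\<lambda>t. X_norm \<alpha> (\<lambda>j w. (f t j w - f s j w) / complex_of_real (t - s) - f' s j w))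
                  \<longlongrightarrow> 0) (at s within I)) \<and>
        (\<forall>s\<in>I. ((\<lambda>t. X_norm \<alpha> (\<lambda>j w. f' t j w - f' s j w)) \<longlongrightarrow> 0) (at s within I)))"

definition mean_circle :: "(complex \<Rightarrow> complex) \<Rightarrow> complex" where
  "mean_circle h = contour_integral (circlepath 0 1) h / (2 * complex_of_real pi * \<i>)"

text \<open>
  In the first integral the integrand is undefined at \<open>\<tau> = w\<close> only, where division by zero
  gives it the value \<open>0\<close>; a single point does not affect the integral.
\<close>

definition F_pair ::
  "(nat \<Rightarrow> real) \<Rightarrow> (nat \<Rightarrow> real) \<Rightarrow> real \<Rightarrow> nat \<Rightarrow>
   real \<Rightarrow> real \<Rightarrow> real \<Rightarrow> (nat \<Rightarrow> complex \<Rightarrow> complex) \<Rightarrow> complex \<Rightarrow> real" where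
  "F_pair b \<gamma> d j \<epsilon> \<Omega> Z f w =
     (let e = complex_of_real \<epsilon>; i = 3 - j;
          bj = complex_of_real (b j); bi = complex_of_real (b i);
          gj = complex_of_real (\<gamma> j); gi = complex_of_real (\<gamma> i);
          fj = f j; fi = f i; fj' = circle_deriv (f j); fi' = circle_deriv (f i)
      in Im (2 * complex_of_real \<Omega>
               * (e * bj * (cnj w + e * bj * cnj (fj w))
                  + (-1) ^ j * complex_of_real Z - (of_nat j - 1) * complex_of_real d)
               * w * (1 + e * bj * fj' w)
             - gj * fj' w
             + e * bj * gj * w * (1 + e * bj * fj' w)
               * mean_circle (\<lambda>\<tau>. let A = \<tau> - w; B = fj \<tau> - fj w
                   in (A * cnj B - cnj A * B) / (A * (A + e * bj * B)) * (fj' \<tau> - B / A))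
             - gi * w * (1 + e * bj * fj' w)
               * mean_circle (\<lambda>\<tau>.
                   (cnj \<tau> + e * bi * cnj (fi \<tau>)) * (1 + e * bi * fi' \<tau>)
                   / (e * (bi * \<tau> + bj * w) + e\<^sup>2 * (bi\<^sup>2 * fi \<tau> + bj\<^sup>2 * fj w)
                      - complex_of_real d))))"

definition boundary_param ::
  "(nat \<Rightarrow> real) \<Rightarrow> (real \<Rightarrow> nat \<Rightarrow> complex \<Rightarrow> complex) \<Rightarrow> nat \<Rightarrow> real \<Rightarrow> complex \<Rightarrow> complex" where
  "boundary_param b f j \<epsilon> w = w + complex_of_real (\<epsilon> * b j) * f \<epsilon> j w"

end

theory Submission
  imports Defs
begin

text \<open>
  Put \<open>x = \<epsilon> b\<^sub>j\<close>. On the circle, \<open>w\<close> times the first integral is minus the mean of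
  \<open>(cnj q - q) (f' - q) / (1 + x q)\<close> over \<open>\<tau>\<close>, where \<open>q\<close> is the difference quotient of \<open>f\<^sub>j\<close>,
  and the second one is expanded in powers of \<open>1 / d\<close>. The equation then reads
  \<open>\<gamma>\<^sub>j Im f' = Im (W (1 + x f'))\<close> with \<open>W = K w + \<close> an explicit trigonometric polynomial \<open>+\<close> small
  terms, where \<open>K\<close> is real and depends on \<open>\<Omega>\<close> and \<open>Z\<close> only, up to explicit terms. Since
  \<open>f' = - \<Sum> n A\<^sub>n cnj w\<^sup>n\<^sup>+\<^sup>1\<close>, the mode \<open>1\<close> of the equation determines \<open>K\<close> and the higher modes
  determine the \<open>A\<^sub>n\<close>, and an error of order \<open>k\<close> in the equation gives an error of order \<open>k\<close> in \<open>K\<close>,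
  in \<open>f\<close> uniformly, but in \<open>f'\<close> only in the mean square sense.

  The curve being of class \<open>C\<^sup>1\<close>, \<open>f\<close> and \<open>f'\<close> are of order one. This yields the modes \<open>1\<close> and \<open>2\<close>
  of \<open>f\<close> up to an error \<open>r\<close> of order three. Inserting this into the equation once more gives
  everything up to order five: the mean square bound on \<open>r'\<close> suffices for \<open>x r' W\<close>, and in the
  singular integral it yields a Hoelder bound on \<open>r\<close>, which makes the difference quotient of \<open>r\<close>
  integrable. Finally \<open>\<Omega>\<close> and \<open>Z\<close> are found from \<open>K\<close> for \<open>j = 1, 2\<close>.
\<close>

section \<open>Means over the unit circle\<close>

text \<open>Recovering an exterior series from its imaginary part is a conjugation, which is not
  bounded in the supremum norm. This is the obstacle: after the first order nothing uniform is known
  about \<open>f'\<close>, while the equation contains \<open>f'\<close> in products and under a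
  singular integral. What helps is that the remainder \<open>r'\<close> always meets a trigonometric
  polynomial. The main part of \<open>W\<close> is one, and inside the integral the mean of
  \<open>r'\<close> against a polynomial in \<open>\<tau>\<close> is a finite combination of Fourier
  coefficients. The orders are as follows. In the first round \<open>x f' W\<close> has order 1 + 1
  + 1; in the second one the unknown part \<open>x r' W\<close> has order 1 + 3 + 1. Hence
  \<open>K\<close> is known up to order five, and the boundary, being \<open>w + x f\<close>, up to
  order six. The coefficients of the second round contain the angular velocity, which must be known
  up to order three beforehand. It is found by adding the two first-round equations for the mode 1,
  in which the center of rotation cancels. So both domains have to complete the first round before
  either can enter the second.\<close>

definition has_mean :: "(complex \<Rightarrow> complex) \<Rightarrow> complex \<Rightarrow> bool" where
  "has_mean h c \<longleftrightarrow> ((\<lambda>t. h (cis (2 * pi * t))) has_integral c) {0..1}"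

text \<open>\<open>integral\<close> is 0 for functions that are not integrable, so that this value
  is informative only together with a \<open>has_mean\<close> fact.\<close>

definition circle_mean :: "(complex \<Rightarrow> complex) \<Rightarrow> complex" where
  "circle_mean h = integral {0..1} (\<lambda>t. h (cis (2 * pi * t)))"

definition fourier :: "(complex \<Rightarrow> complex) \<Rightarrow> int \<Rightarrow> complex" where
  "fourier h k = circle_mean (\<lambda>w. h w * w powi (-k))"

lemma cis_in_circle [simp]: "cis t \<in> unit_circle"
  by simp

lemma circle_cnj: "w \<in> unit_circle \<Longrightarrow> cnj w = inverse w"
  using divide_conv_cnj[of w 1] by (simp add: inverse_eq_divide)

lemma circle_nonzero: "w \<in> unit_circle \<Longrightarrow> w \<noteq> 0"
  by auto

lemma circle_mult_cnj: "w \<in> unit_circle \<Longrightarrow> w * cnj w = 1"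
  using circle_cnj[of w] circle_nonzero[of w] by simp

lemma has_mean_unique: "has_mean h c \<Longrightarrow> circle_mean h = c"
  unfolding has_mean_def circle_mean_def by (rule integral_unique)

lemma has_mean_cong:
  assumes "has_mean h c" "\<And>w. w \<in> unit_circle \<Longrightarrow> h w = g w"
  shows "has_mean g c"
  using assms(1) unfolding has_mean_def
  by (rule has_integral_eq[rotated]) (rule assms(2)[OF cis_in_circle])

lemma circle_mean_cong:
  assumes "\<And>w. w \<in> unit_circle \<Longrightarrow> h w = g w"
  shows "circle_mean h = circle_mean g"
  unfolding circle_mean_def by (simp only: assms[OF cis_in_circle])

lemma fourier_cong:
  assumes "\<And>w. w \<in> unit_circle \<Longrightarrow> h w = g w"
  shows "fourier h k = fourier g k"
  unfolding fourier_def by (rule circle_mean_cong) (simp only: assms)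

lemma has_mean_add:
  "has_mean h c \<Longrightarrow> has_mean g e \<Longrightarrow> has_mean (\<lambda>w. h w + g w) (c + e)"
  unfolding has_mean_def by (rule has_integral_add)

lemma has_mean_diff:
  "has_mean h c \<Longrightarrow> has_mean g e \<Longrightarrow> has_mean (\<lambda>w. h w - g w) (c - e)"
  unfolding has_mean_def by (rule has_integral_diff)

lemma has_mean_neg:
  "has_mean h c \<Longrightarrow> has_mean (\<lambda>w. - h w) (- c)"
  unfolding has_mean_def by (rule has_integral_neg)

lemma has_mean_cmult:
  "has_mean h c \<Longrightarrow> has_mean (\<lambda>w. a * h w) (a * c)"
  unfolding has_mean_def by (rule has_integral_mult_right)

lemma has_mean_cnj:
  "has_mean h c \<Longrightarrow> has_mean (\<lambda>w. cnj (h w)) (cnj c)"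
  unfolding has_mean_def
  using has_integral_linear[OF _ bounded_linear_cnj, of "\<lambda>t. h (cis (2 * pi * t))"] by (simp add: o_def)

lemma has_mean_sum:
  "finite K \<Longrightarrow> (\<And>k. k \<in> K \<Longrightarrow> has_mean (h k) (c k)) \<Longrightarrow>
     has_mean (\<lambda>w. \<Sum>k\<in>K. h k w) (\<Sum>k\<in>K. c k)"
  unfolding has_mean_def by (rule has_integral_sum) auto

lemma has_mean_const: "has_mean (\<lambda>w. c) c"
  unfolding has_mean_def using has_integral_const_real[of c 0 1] by simp

lemma continuous_on_circle_param:
  assumes "continuous_on unit_circle h"
  shows "continuous_on S (\<lambda>t. h (cis (2 * pi * t)))"
  by (rule continuous_on_compose2[OF assms]) (auto intro!: continuous_intros)

lemma has_mean_continuous: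
  assumes "continuous_on unit_circle h"
  shows "has_mean h (circle_mean h)"
  unfolding has_mean_def circle_mean_def
  by (intro integrable_integral integrable_continuous_interval continuous_on_circle_param assms)

lemma circle_mean_eqI:
  "has_mean h c \<Longrightarrow> has_mean h e \<Longrightarrow> c = e"
  unfolding has_mean_def by (rule has_integral_unique)

lemma has_mean_norm_le:
  assumes "has_mean h c" "\<And>w. w \<in> unit_circle \<Longrightarrow> cmod (h w) \<le> M"
  shows "cmod c \<le> M"
proof -
  have "0 \<le> M" using order_trans[OF norm_ge_zero assms(2)[of 1]] by simp
  then show ?thesis
    using has_integral_bound_real[of M "{}" "\<lambda>t. h (cis (2 * pi * t))" c 0 1] assms(2) assms(1)
    unfolding has_mean_def by simp
qed

lemma circle_powi_cis: "cis (2 * pi * t) powi k = cis (2 * pi * k * t)"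
  by (simp add: cis_power_int algebra_simps)

lemma continuous_on_circle_powi [continuous_intros]:
  "continuous_on unit_circle (\<lambda>w. w powi k)"
  by (rule continuous_on_power_int) (auto intro: continuous_intros)

lemma has_mean_powi: "has_mean (\<lambda>w. w powi k) (if k = 0 then 1 else 0)"
proof (cases "k = 0")
  case True
  then show ?thesis using has_mean_const[of 1] by simp
next
  case False
  define F where "F = (\<lambda>t::real. cis (2 * pi * k * t) / (2 * pi * k * \<i>))"
  have "((\<lambda>t. cis (2 * pi * k * t)) has_integral F 1 - F 0) {0..1}"
  proof (rule fundamental_theorem_of_calculus)
    fix t :: real
    have "((\<lambda>t. exp ((2 * pi * k * \<i>) * complex_of_real t)) has_vector_derivative
        (2 * pi * k * \<i>) * exp ((2 * pi * k * \<i>) * complex_of_real t)) (at t within {0..1})"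
      by (auto intro!: derivative_eq_intros has_vector_derivative_real_field)
    then have "((\<lambda>t. cis (2 * pi * k * t)) has_vector_derivative (2 * pi * k * \<i>) * cis (2 * pi * k * t)) (at t within {0..1})"
      by (simp add: cis_conv_exp algebra_simps)
    from has_vector_derivative_mult_left[OF this, of "1 / (2 * pi * k * \<i>)"]
    show "(F has_vector_derivative cis (2 * pi * k * t)) (at t within {0..1})"
      using False unfolding F_def by (simp add: scaleR_conv_of_real field_simps)
  qed simp
  moreover have "F 1 = F 0"
    unfolding F_def using cis_multiple_2pi[of k] by (simp add: mult.commute mult.left_commute)
  ultimately show ?thesis
    using False unfolding has_mean_def circle_powi_cis by simp
qed

text \<open>The line element is \<open>2 * pi * \<i> * w\<close> times that of the parameter; the
  constant cancels against the normalisation and the factor \<open>w\<close> stays with the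
  integrand.\<close>

lemma mean_circle_eq:
  assumes "has_mean (\<lambda>w. h w * w) c"
  shows "mean_circle h = c"
proof -
  have "((\<lambda>t. (2 * pi * \<i>) * (h (cis (2 * pi * t)) * cis (2 * pi * t))) has_integral (2 * pi * \<i>) * c) {0..1}"
    using assms unfolding has_mean_def by (rule has_integral_mult_right)
  then have "(h has_contour_integral (2 * pi * \<i> * c)) (circlepath 0 1)"
    unfolding has_contour_integral_def
    by (rule has_integral_eq[rotated])
      (simp add: vector_derivative_circlepath01, simp add: circlepath cis_conv_exp algebra_simps)
  then show ?thesis
    unfolding mean_circle_def by (simp add: contour_integral_unique)
qed

text \<open>The point \<open>w\<close> is attained at finitely many parameters only. This takes care
  of the diagonal, where the integrand of the first integral is a value of division by zero.\<close>

lemma has_mean_spike: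
  assumes "has_mean h c" "\<And>\<tau>. \<tau> \<in> unit_circle \<Longrightarrow> \<tau> \<noteq> w \<Longrightarrow> g \<tau> = h \<tau>"
  shows "has_mean g c"
proof -
  let ?S = "{t \<in> {0..1}. cis (2 * pi * t) = w}"
  have "finite ?S"
  proof (cases "?S = {}")
    case True
    then show ?thesis by (simp only: finite.emptyI)
  next
    case False
    then obtain a where a: "a \<in> ?S" by blast
    \<comment> \<open>Parameters of the same point differ by an integer, which has absolute value at
      most 1 within \<open>{0..1}\<close>.\<close>
    have "?S \<subseteq> {a - 1, a, a + 1}"
    proof
      fix t assume t: "t \<in> ?S"
      then have "cis (2 * pi * t) = cis (2 * pi * a)" using a by auto
      then have "cis (2 * pi * (t - a)) = 1"
        by (simp add: right_diff_distrib flip: cis_divide)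
      then have "cos (2 * pi * (t - a)) = 1" by (metis cis.sel(1) one_complex.sel(1))
      then obtain n :: int where "2 * pi * (t - a) = real_of_int n * 2 * pi"
        unfolding cos_one_2pi_int by metis
      then have n: "t - a = n" by simp
      have "\<bar>t - a\<bar> \<le> 1" using a t by auto
      then have "\<bar>n\<bar> \<le> 1" unfolding n by linarith
      then have "n \<in> {-1, 0, 1}" by auto
      then show "t \<in> {a - 1, a, a + 1}" using n by auto
    qed
    then show ?thesis using finite_subset by blast
  qed
  then show ?thesis
    using assms unfolding has_mean_def
    by (elim has_integral_spike_finite) auto
qed

lemma powi_diff: "w \<noteq> 0 \<Longrightarrow> w powi (m - k) = w powi m * w powi (-k)" for w :: complex
  by (simp add: power_int_diff power_int_minus divide_inverse)

section \<open>Fourier coefficients and Bessel's inequality\<close>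

lemma fourier_eqI:
  "has_mean (\<lambda>w. h w * w powi (-k)) c \<Longrightarrow> fourier h k = c"
  unfolding fourier_def by (rule has_mean_unique)

lemma has_fourier:
  "continuous_on unit_circle h \<Longrightarrow> has_mean (\<lambda>w. h w * w powi (-k)) (fourier h k)"
  unfolding fourier_def by (intro has_mean_continuous continuous_intros)

lemma fourier_add:
  assumes "continuous_on unit_circle h" "continuous_on unit_circle g"
  shows "fourier (\<lambda>w. h w + g w) k = fourier h k + fourier g k"
  using has_mean_add[OF has_fourier[OF assms(1), of k] has_fourier[OF assms(2), of k]]
  by (intro fourier_eqI) (simp add: distrib_right)

lemma fourier_cmult:
  assumes "continuous_on unit_circle h"
  shows "fourier (\<lambda>w. a * h w) k = a * fourier h k"
  using has_mean_cmult[OF has_fourier[OF assms, of k], of a]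
  by (intro fourier_eqI) (simp add: mult.assoc)

lemma fourier_shift:
  assumes "continuous_on unit_circle h"
  shows "fourier (\<lambda>w. w powi m * h w) k = fourier h (k - m)"
proof (rule fourier_eqI, rule has_mean_cong)
  show "has_mean (\<lambda>w. h w * w powi (m - k)) (fourier h (k - m))"
    using has_fourier[OF assms, of "k - m"] by simp
  show "h w * w powi (m - k) = w powi m * h w * w powi (-k)" if "w \<in> unit_circle" for w
    using powi_diff[OF circle_nonzero[OF that], of m k] by (simp add: algebra_simps)
qed

lemma circle_cnj_powi: "w \<in> unit_circle \<Longrightarrow> cnj (w powi k) = w powi (-k)"
proof -
  assume w: "w \<in> unit_circle"
  have "cnj (w powi k) = cnj w powi k" by simp
  also have "\<dots> = inverse (w powi k)" unfolding circle_cnj[OF w] by (rule power_int_inverse)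
  also have "\<dots> = w powi (-k)" by (rule power_int_minus[symmetric])
  finally show ?thesis .
qed

lemma fourier_cnj:
  assumes "continuous_on unit_circle h"
  shows "fourier (\<lambda>w. cnj (h w)) k = cnj (fourier h (- k))"
proof (rule fourier_eqI, rule has_mean_cong)
  show "has_mean (\<lambda>w. cnj (h w * w powi (-(- k)))) (cnj (fourier h (- k)))"
    by (intro has_mean_cnj has_fourier assms)
  show "cnj (h w * w powi (-(- k))) = cnj (h w) * w powi (-k)" if "w \<in> unit_circle" for w
    using circle_cnj_powi[OF that] by simp
qed

lemma fourier_powi: "fourier (\<lambda>w. w powi m) k = (if k = m then 1 else 0)"
proof (rule fourier_eqI, rule has_mean_cong)
  show "has_mean (\<lambda>w. w powi (m - k)) (if k = m then 1 else 0)"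
    using has_mean_powi[of "m - k"] by auto
  show "w powi (m - k) = w powi m * w powi (-k)" if "w \<in> unit_circle" for w
    by (rule powi_diff[OF circle_nonzero[OF that]])
qed

text \<open>\<open>p\<close> is the orthogonal projection of \<open>h\<close> onto the modes in
  \<open>K\<close>. The means of \<open>h * cnj p\<close> and of \<open>p * cnj p\<close> are both
  \<open>S\<close>, so that the mean of \<open>(cmod (h - p))^2\<close>, which is nonnegative, is
  that of \<open>(cmod h)^2\<close> minus \<open>S\<close>.\<close>

lemma bessel:
  assumes h: "continuous_on unit_circle h" and M: "\<And>w. w \<in> unit_circle \<Longrightarrow> cmod (h w) \<le> M"
    and K: "finite K"
  shows "L2_set (\<lambda>k. cmod (fourier h k)) K \<le> M"
proof -
  define c where "c = fourier h"
  define p where "p = (\<lambda>w. \<Sum>k\<in>K. c k * w powi k)"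
  define S where "S = (\<Sum>k\<in>K. (cmod (c k))\<^sup>2)"
  have M0: "0 \<le> M" using order_trans[OF norm_ge_zero M[of 1]] by simp
  have p: "continuous_on unit_circle p"
    unfolding p_def by (intro continuous_intros)
  have S: "complex_of_real S = (\<Sum>k\<in>K. cnj (c k) * c k)"
    unfolding S_def by (simp add: complex_norm_square mult.commute del: of_real_power)
  have hp: "has_mean (\<lambda>w. h w * cnj (p w)) S" 
  proof (rule has_mean_cong)
    show "has_mean (\<lambda>w. \<Sum>k\<in>K. cnj (c k) * (h w * w powi (-k))) S"
      unfolding S by (intro has_mean_sum K has_mean_cmult) (simp add: c_def has_fourier h)
    show "(\<Sum>k\<in>K. cnj (c k) * (h w * w powi (-k))) = h w * cnj (p w)" if "w \<in> unit_circle" for w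
      unfolding p_def sum_distrib_left cnj_sum
      by (intro sum.cong) (use circle_cnj_powi[OF that] in auto)
  qed
  have pp: "has_mean (\<lambda>w. p w * cnj (p w)) S"
  proof (rule has_mean_cong)
    have "has_mean (\<lambda>w. p w * w powi (-k)) (c k)" if k: "k \<in> K" for k
    proof (rule has_mean_cong)
      have "has_mean (\<lambda>w. \<Sum>m\<in>K. c m * w powi (m - k)) (\<Sum>m\<in>K. c m * (if m - k = 0 then 1 else 0))"
        by (intro has_mean_sum K has_mean_cmult has_mean_powi)
      moreover have "(\<Sum>m\<in>K. c m * (if m - k = 0 then 1 else 0)) = (\<Sum>m\<in>K. if m = k then c m else 0)"
        by (intro sum.cong) auto
      ultimately show "has_mean (\<lambda>w. \<Sum>m\<in>K. c m * w powi (m - k)) (c k)"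
        using K k by (simp add: sum.delta)
      show "(\<Sum>m\<in>K. c m * w powi (m - k)) = p w * w powi (-k)" if "w \<in> unit_circle" for w
        unfolding p_def sum_distrib_right
        by (intro sum.cong) (simp_all only: powi_diff[OF circle_nonzero[OF that]] mult.assoc)
    qed
    then show "has_mean (\<lambda>w. \<Sum>k\<in>K. cnj (c k) * (p w * w powi (-k))) S"
      unfolding S by (intro has_mean_sum K has_mean_cmult)
    show "(\<Sum>k\<in>K. cnj (c k) * (p w * w powi (-k))) = p w * cnj (p w)" if "w \<in> unit_circle" for w
      unfolding p_def[of ] sum_distrib_left cnj_sum
      by (intro sum.cong) (use circle_cnj_powi[OF that] in auto)
  qed
  have hh: "has_mean (\<lambda>w. h w * cnj (h w)) (circle_mean (\<lambda>w. h w * cnj (h w)))" (is "has_mean _ ?H")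
    by (intro has_mean_continuous continuous_intros h)
  \<comment> \<open>The integrand is \<open>(h - p) * cnj (h - p)\<close> multiplied out, with
    \<open>p * cnj h\<close> written as the conjugate of \<open>h * cnj p\<close>.\<close>
  have "has_mean (\<lambda>w. (h w * cnj (h w) - h w * cnj (p w)) - (cnj (h w * cnj (p w)) - p w * cnj (p w)))
      ((?H - S) - (cnj (complex_of_real S) - S))"
    by (intro has_mean_diff has_mean_cnj hh hp pp)
  moreover have "(?H - S) - (cnj (complex_of_real S) - S) = ?H - S" by simp
  moreover have "complex_of_real ((cmod (h w - p w))\<^sup>2)
      = (h w * cnj (h w) - h w * cnj (p w)) - (cnj (h w * cnj (p w)) - p w * cnj (p w))" for w
    unfolding complex_norm_square complex_cnj_diff complex_cnj_mult complex_cnj_cnj by algebra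
  ultimately have "has_mean (\<lambda>w. complex_of_real ((cmod (h w - p w))\<^sup>2)) (?H - S)"
    by simp
  then have "((\<lambda>t. Re (complex_of_real ((cmod (h (cis (2*pi*t)) - p (cis (2*pi*t))))\<^sup>2))) has_integral Re (?H - S)) {0..1}"
    unfolding has_mean_def by (rule has_integral_Re)
  then have "0 \<le> Re (?H - S)"
    by (rule has_integral_nonneg) auto
  moreover have "cmod ?H \<le> M\<^sup>2"
    using hh by (rule has_mean_norm_le) (use M M0 in \<open>auto simp: norm_mult power2_eq_square intro!: mult_mono\<close>)
  then have "Re ?H \<le> M\<^sup>2" using complex_Re_le_cmod order_trans by blast
  ultimately have "S \<le> M\<^sup>2" by simp
  then show ?thesis
    unfolding L2_set_def S_def c_def using M0 by (simp add: real_le_lsqrt sum_nonneg)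
qed

section \<open>Exterior Fourier series\<close>

text \<open>Boundary values of functions that are holomorphic outside the unit disc and vanish at infinity.\<close>

definition exterior_series :: "(complex \<Rightarrow> complex) \<Rightarrow> (complex \<Rightarrow> complex) \<Rightarrow> (nat \<Rightarrow> real) \<Rightarrow> bool" where
  "exterior_series g g' A \<longleftrightarrow> continuous_on unit_circle g' \<and>
     (\<forall>w\<in>unit_circle. (g has_field_derivative g' w) (at w within unit_circle)) \<and>
     (\<forall>w\<in>unit_circle. ((\<lambda>n. complex_of_real (A n) * cnj w ^ n) has_sum g w) {1..})"

lemma exterior_seriesD:
  assumes "exterior_series g g' A"
  shows "continuous_on unit_circle g'"
    and "w \<in> unit_circle \<Longrightarrow> (g has_field_derivative g' w) (at w within unit_circle)"
    and "w \<in> unit_circle \<Longrightarrow> ((\<lambda>n. complex_of_real (A n) * cnj w ^ n) has_sum g w) {1..}"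
    and "continuous_on unit_circle g"
  using assms unfolding exterior_series_def
  by (auto intro: DERIV_continuous simp: continuous_on_eq_continuous_within)

lemma exterior_series_diff:
  assumes "exterior_series g g' A" "exterior_series h h' B"
  shows "exterior_series (\<lambda>w. g w - h w) (\<lambda>w. g' w - h' w) (\<lambda>n. A n - B n)"
  unfolding exterior_series_def
proof (intro conjI ballI)
  fix w :: complex assume w: "w \<in> unit_circle"
  show "((\<lambda>w. g w - h w) has_field_derivative g' w - h' w) (at w within unit_circle)"
    by (intro derivative_intros exterior_seriesD(2)[OF _ w, OF assms(1)] exterior_seriesD(2)[OF _ w, OF assms(2)])
  have "((\<lambda>n. complex_of_real (A n) * cnj w ^ n + - (complex_of_real (B n) * cnj w ^ n)) has_sum (g w + - h w)) {1..}"
    using exterior_seriesD(3)[OF assms(1) w] exterior_seriesD(3)[OF assms(2) w]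
    by (intro has_sum_add has_sum_uminusI)
  then show "((\<lambda>n. complex_of_real (A n - B n) * cnj w ^ n) has_sum (g w - h w)) {1..}"
    by (simp add: algebra_simps)
qed (intro continuous_intros assms[THEN exterior_seriesD(1)])

text \<open>\<open>cnj\<close> is nowhere complex differentiable in the plane, but on the circle it
  agrees with \<open>inverse\<close>, from which the derivative along the circle is taken.\<close>

lemma exterior_series_poly:
  "exterior_series (\<lambda>w. \<Sum>n=1..N. complex_of_real (c n) * cnj w ^ n)
     (\<lambda>w. \<Sum>n=1..N. - (of_nat n * complex_of_real (c n)) * cnj w ^ Suc n)
     (\<lambda>n. if n \<in> {1..N} then c n else 0)"
  unfolding exterior_series_def
proof (intro conjI ballI)
  fix w :: complex assume w: "w \<in> unit_circle"
  then have w0: "w \<noteq> 0" by auto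
  have "((\<lambda>w. inverse w ^ n) has_field_derivative - of_nat n * inverse w ^ Suc n) (at w within unit_circle)" for n
  proof (cases n)
    case (Suc m)
    show ?thesis
      by (rule DERIV_cong[OF DERIV_power[OF DERIV_inverse[OF w0]]]) (simp add: Suc algebra_simps)
  qed simp
  then have "((\<lambda>w. \<Sum>n=1..N. complex_of_real (c n) * inverse w ^ n) has_field_derivative
      (\<Sum>n=1..N. complex_of_real (c n) * (- of_nat n * inverse w ^ Suc n))) (at w within unit_circle)"
    by (intro DERIV_sum DERIV_cmult)
  then have "((\<lambda>w. \<Sum>n=1..N. complex_of_real (c n) * cnj w ^ n) has_field_derivative
      (\<Sum>n=1..N. complex_of_real (c n) * (- of_nat n * inverse w ^ Suc n))) (at w within unit_circle)"
    by (rule has_field_derivative_transform_within[where d=1]) (use w circle_cnj in auto)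
  then show "((\<lambda>w. \<Sum>n=1..N. complex_of_real (c n) * cnj w ^ n) has_field_derivative
      (\<Sum>n=1..N. - (of_nat n * complex_of_real (c n)) * cnj w ^ Suc n)) (at w within unit_circle)"
    unfolding circle_cnj[OF w] by (simp add: algebra_simps)
  show "((\<lambda>n. complex_of_real (if n \<in> {1..N} then c n else 0) * cnj w ^ n) has_sum
      (\<Sum>n=1..N. complex_of_real (c n) * cnj w ^ n)) {1..}"
    by (rule has_sum_finite_neutralI[where B = "{1..N}"]) auto
qed (intro continuous_intros)

text \<open>At \<open>w = 1\<close> the sum is that of the bare coefficients, and unconditional
  convergence of complex numbers is absolute. The series starts at 1, which leaves
  \<open>A 0\<close> arbitrary; it is replaced by 0.\<close>

lemma exterior_series_summable:
  assumes "exterior_series g g' A"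
  shows "summable (\<lambda>n. \<bar>if n = 0 then 0 else A n\<bar>)"
proof -
  have "((\<lambda>n. complex_of_real (A n)) has_sum g 1) {1..}"
    using exterior_seriesD(3)[OF assms, of 1] by simp
  then have "(\<lambda>n. complex_of_real (A n)) summable_on {1..}"
    by (auto simp: summable_on_def)
  then have "(\<lambda>n. cmod (complex_of_real (A n))) summable_on {1..}"
    by (simp only: summable_on_iff_abs_summable_on_complex)
  then have "(\<lambda>n. \<bar>if n = 0 then 0 else A n\<bar>) summable_on UNIV"
    by (subst summable_on_cong_neutral[where T = "{1..}" and g = "\<lambda>n. cmod (complex_of_real (A n))"]) auto
  then show ?thesis by (rule summable_on_imp_summable)
qed

lemma has_mean_uniform_limit:
  assumes u: "uniform_limit unit_circle u h sequentially"
    and c: "\<And>N. continuous_on unit_circle (u N)" "\<And>N. has_mean (u N) (c N)" "c \<longlonglongrightarrow> e"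
  shows "has_mean h e"
proof -
  have "uniform_limit {0..1::real} (\<lambda>N t. u N (cis (2 * pi * t))) (\<lambda>t. h (cis (2 * pi * t))) sequentially"
    unfolding uniform_limit_iff
  proof (intro allI impI)
    fix e :: real assume "0 < e"
    then have "\<forall>\<^sub>F n in sequentially. \<forall>x\<in>unit_circle. dist (u n x) (h x) < e"
      using u unfolding uniform_limit_iff by blast
    then show "\<forall>\<^sub>F n in sequentially. \<forall>x\<in>{0..1}. dist (u n (cis (2 * pi * x))) (h (cis (2 * pi * x))) < e"
      by (rule eventually_mono) simp
  qed
  then obtain I J where I: "\<And>N. ((\<lambda>t. u N (cis (2 * pi * t))) has_integral I N) {0..1}"
     "((\<lambda>t. h (cis (2 * pi * t))) has_integral J) {0..1}" "I \<longlonglongrightarrow> J"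
    by (rule uniform_limit_integral) (auto intro: continuous_on_circle_param c)
  have "I = c"
    using I(1) c(2) circle_mean_eqI unfolding has_mean_def by blast
  then show ?thesis
    using I c(3) LIMSEQ_unique unfolding has_mean_def by blast
qed

text \<open>The coefficients being absolutely summable, the series converges uniformly and can be
  integrated term by term.\<close>

lemma fourier_exterior_series:
  assumes "exterior_series g g' A"
  shows "fourier g k = (if k < 0 then A (nat (- k)) else 0)"
proof (rule fourier_eqI)
  define A' where "A' n = (if n = 0 then 0 else A n)" for n
  define c where "c N = (\<Sum>n<N. complex_of_real (A' n) * (if - int n - k = 0 then 1 else 0))" for N
  define T where "T n w = complex_of_real (A' n) * w powi (- int n - k)" for n w
  show "has_mean (\<lambda>w. g w * w powi (-k)) (if k < 0 then A (nat (- k)) else 0)"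
  proof (rule has_mean_uniform_limit)
    have "uniform_limit unit_circle (\<lambda>N w. \<Sum>n<N. T n w) (\<lambda>w. \<Sum>n. T n w) sequentially"
    proof (rule Weierstrass_m_test)
      show "summable (\<lambda>n. \<bar>A' n\<bar>)"
        using exterior_series_summable[OF assms] unfolding A'_def .
    qed (auto simp: T_def norm_mult norm_power_int)
    moreover have "(\<Sum>n. T n w) = g w * w powi (-k)" if w: "w \<in> unit_circle" for w
    proof -
      have "((\<lambda>n. complex_of_real (A n) * cnj w ^ n * w powi (-k)) has_sum g w * w powi (-k)) {1..}"
        by (intro has_sum_cmult_left exterior_seriesD(3)[OF assms w])
      have "((\<lambda>n. T n w) has_sum g w * w powi (-k)) UNIV"
      proof (subst has_sum_cong_neutral[where T = "{1..}" and g = "\<lambda>n. complex_of_real (A n) * cnj w ^ n * w powi (-k)"])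
        show "T n w = complex_of_real (A n) * cnj w ^ n * w powi (-k)" if "n \<in> UNIV \<inter> {1..}" for n
          using that powi_diff[OF circle_nonzero[OF w], of "- int n" k] circle_cnj[OF w]
          by (simp add: T_def A'_def power_int_minus power_inverse)
      qed (use \<open>(_ has_sum _) {1..}\<close> in \<open>auto simp: T_def A'_def\<close>)
      then show ?thesis using has_sum_imp_sums sums_unique by metis
    qed
    ultimately show "uniform_limit unit_circle (\<lambda>N w. \<Sum>n<N. T n w) (\<lambda>w. g w * w powi (-k)) sequentially"
      by (subst (asm) uniform_limit_cong'[where i = "\<lambda>w. g w * w powi (-k)"]) auto
    show "continuous_on unit_circle (\<lambda>w. \<Sum>n<N. T n w)" for N
      unfolding T_def by (intro continuous_intros)
    show "has_mean (\<lambda>w. \<Sum>n<N. T n w) (c N)" for N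
      unfolding T_def c_def
      by (intro has_mean_sum has_mean_cmult has_mean_powi) auto
    \<comment> \<open>At most the index \<open>nat (- k)\<close> contributes, so that the means of
      the partial sums are constant from there on.\<close>
    have c: "c N = (if k < 0 then A (nat (- k)) else 0)" if "N > nat (- k)" for N
    proof -
      have "c N = (\<Sum>n<N. if n = nat (-k) then complex_of_real (if k < 0 then A (nat (- k)) else 0) else 0)"
        unfolding c_def by (intro sum.cong) (auto simp: A'_def)
      then show ?thesis using that by simp
    qed
    show "c \<longlonglongrightarrow> (if k < 0 then A (nat (- k)) else 0)"
      using c by (intro tendsto_eventually eventually_sequentiallyI[of "Suc (nat (- k))"]) auto
  qed
qed

lemma circle_vector_derivative:
  assumes "(g has_field_derivative D) (at (cis (a * t)) within unit_circle)"
  shows "((\<lambda>t. g (cis (a * t))) has_vector_derivative (a * \<i> * cis (a * t)) * D) (at t within S)"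
proof -
  have "((\<lambda>t. exp ((a * \<i>) * complex_of_real t)) has_vector_derivative
        (a * \<i>) * exp ((a * \<i>) * complex_of_real t)) (at t within S)"
    by (auto intro!: derivative_eq_intros has_vector_derivative_real_field)
  then have 1: "((\<lambda>t. cis (a * t)) has_vector_derivative (a * \<i> * cis (a * t))) (at t within S)"
    by (simp add: cis_conv_exp algebra_simps)
  have "((g \<circ> (\<lambda>t. cis (a * t))) has_vector_derivative ((a * \<i> * cis (a * t)) * D)) (at t within S)"
    by (rule field_vector_diff_chain_within[OF 1], rule has_field_derivative_subset[OF assms]) auto
  then show ?thesis by (simp add: o_def)
qed

text \<open>Up to the factor \<open>2 * pi * \<i>\<close> the integrand is the derivative of
  \<open>H\<close> in the parameter, and the curve is closed.\<close>

lemma has_mean_derivative: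
  assumes "\<And>w. w \<in> unit_circle \<Longrightarrow> (H has_field_derivative H' w) (at w within unit_circle)"
  shows "has_mean (\<lambda>w. H' w * w) 0"
proof -
  have "((\<lambda>t. ((2 * pi) * \<i> * cis (2 * pi * t)) * H' (cis (2 * pi * t))) has_integral
      H (cis (2 * pi * 1)) - H (cis (2 * pi * 0))) {0..1}"
    by (rule fundamental_theorem_of_calculus)
       (use circle_vector_derivative[OF assms[OF cis_in_circle], of "2 * pi"] in auto)
  then have "((\<lambda>t. ((2 * pi) * \<i> * cis (2 * pi * t)) * H' (cis (2 * pi * t))) has_integral 0) {0..1}"
    by simp
  from has_integral_mult_right[OF this, of "1 / (2 * pi * \<i>)"]
  show ?thesis unfolding has_mean_def by (simp add: field_simps)
qed

text \<open>Integration by parts, that is, \<open>has_mean_derivative\<close> for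
  \<open>g w * w powi (- k - 1)\<close>. The series is not differentiated term by term, since
  \<open>exterior_series\<close> says nothing on the convergence of the result.\<close>

lemma fourier_derivative:
  assumes "exterior_series g g' A"
  shows "fourier g' k = of_int (k + 1) * fourier g (k + 1)"
proof -
  let ?m = "- k - 1"
  note g = exterior_seriesD[OF assms]
  have "has_mean (\<lambda>w. (g' w * w powi ?m + of_int ?m * w powi (?m - 1) * g w) * w) 0"
  proof (rule has_mean_derivative[where H = "\<lambda>w. g w * w powi ?m"])
    fix w :: complex assume w: "w \<in> unit_circle"
    have "((\<lambda>w. w powi ?m) has_field_derivative of_int ?m * w powi (?m - 1)) (at w within unit_circle)"
      using has_derivative_power_int'[OF circle_nonzero[OF w], of ?m unit_circle]
      unfolding has_field_derivative_def by (simp add: mult_commute_abs mult.commute)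
    from DERIV_mult[OF g(2)[OF w] this]
    show "((\<lambda>w. g w * w powi ?m) has_field_derivative g' w * w powi ?m + of_int ?m * w powi (?m - 1) * g w)
        (at w within unit_circle)" .
  qed
  moreover have "has_mean (\<lambda>w. g' w * w powi (-k) + of_int ?m * (g w * w powi (-(k+1))))
      (fourier g' k + of_int ?m * fourier g (k+1))"
    by (intro has_mean_add has_mean_cmult has_fourier g)
  then have "has_mean (\<lambda>w. (g' w * w powi ?m + of_int ?m * w powi (?m - 1) * g w) * w)
      (fourier g' k + of_int ?m * fourier g (k+1))"
  proof (rule has_mean_cong)
    fix w :: complex assume w: "w \<in> unit_circle"
    have ring_id: "P0 = P1 * v \<Longrightarrow> P1 = P2 * v \<Longrightarrow> G * P0 + m * (h * P1) = (G * P1 + m * P2 * h) * v"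
      for P0 P1 P2 G m h v :: complex by (simp add: algebra_simps)
    have "w powi (-k) = w powi ?m * w" "w powi ?m = w powi (?m - 1) * w"
      using power_int_add_1[of w ?m] power_int_add_1[of w "?m - 1"] circle_nonzero[OF w]
      by (simp_all only: diff_add_cancel) simp_all
    moreover have "-(k+1) = ?m" by simp
    ultimately show "g' w * w powi (-k) + of_int ?m * (g w * w powi (-(k+1)))
        = (g' w * w powi ?m + of_int ?m * w powi (?m - 1) * g w) * w"
      by (simp only: ring_id)
  qed
  ultimately have "fourier g' k + of_int ?m * fourier g (k+1) = 0"
    using circle_mean_eqI by blast
  then show ?thesis by (simp add: algebra_simps add_eq_0_iff)
qed

text \<open>Bounding the coefficients instead of the \<open>L\<^sup>2\<close> norm, one needs Bessel's inequality but not Parseval's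
  identity.\<close>

definition fourier_l2_le :: "(complex \<Rightarrow> complex) \<Rightarrow> real \<Rightarrow> bool" where
  "fourier_l2_le h S \<longleftrightarrow> (\<forall>K. finite K \<longrightarrow> L2_set (\<lambda>k. cmod (fourier h k)) K \<le> S)"

lemma fourier_l2_le_coeff: "fourier_l2_le h S \<Longrightarrow> cmod (fourier h k) \<le> S"
  unfolding fourier_l2_le_def using L2_set_insert[of "{}"] by (auto dest: spec[of _ "{k}"] simp: L2_set_def)

lemma fourier_l2_le_dominated:
  assumes "fourier_l2_le h S" "\<And>k. cmod (fourier g k) \<le> a * cmod (fourier h k)" "0 \<le> a"
  shows "fourier_l2_le g (a * S)"
  unfolding fourier_l2_le_def
proof (intro allI impI)
  fix K :: "int set" assume "finite K"
  have "L2_set (\<lambda>k. cmod (fourier g k)) K \<le> L2_set (\<lambda>k. a * cmod (fourier h k)) K"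
    by (rule L2_set_mono) (use assms in auto)
  also have "\<dots> = a * L2_set (\<lambda>k. cmod (fourier h k)) K"
    by (simp add: L2_set_right_distrib assms)
  also have "\<dots> \<le> a * S"
    using assms \<open>finite K\<close> by (auto simp: fourier_l2_le_def intro: mult_left_mono)
  finally show "L2_set (\<lambda>k. cmod (fourier g k)) K \<le> a * S" .
qed

lemma fourier_l2_le_add:
  assumes "continuous_on unit_circle h" "continuous_on unit_circle g"
    and "fourier_l2_le h S" "fourier_l2_le g T"
  shows "fourier_l2_le (\<lambda>w. h w + g w) (S + T)"
  unfolding fourier_l2_le_def
proof (intro allI impI)
  fix K :: "int set" assume "finite K"
  have "L2_set (\<lambda>k. cmod (fourier (\<lambda>w. h w + g w) k)) K
      \<le> L2_set (\<lambda>k. cmod (fourier h k) + cmod (fourier g k)) K"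
    by (rule L2_set_mono) (auto simp: fourier_add assms norm_triangle_ineq)
  also have "\<dots> \<le> L2_set (\<lambda>k. cmod (fourier h k)) K + L2_set (\<lambda>k. cmod (fourier g k)) K"
    by (rule L2_set_triangle_ineq)
  also have "\<dots> \<le> S + T"
    using assms(3,4) \<open>finite K\<close> unfolding fourier_l2_le_def by (intro add_mono) auto
  finally show "L2_set (\<lambda>k. cmod (fourier (\<lambda>w. h w + g w) k)) K \<le> S + T" .
qed

lemma fourier_l2_le_cmult:
  assumes "continuous_on unit_circle h" "fourier_l2_le h S"
  shows "fourier_l2_le (\<lambda>w. a * h w) (cmod a * S)"
  by (rule fourier_l2_le_dominated[OF assms(2)]) (auto simp: fourier_cmult assms norm_mult)

lemma fourier_l2_le_reindex:
  assumes "fourier_l2_le h S" "\<And>k. cmod (fourier g k) = cmod (fourier h (\<pi> k))" "inj \<pi>"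
  shows "fourier_l2_le g S"
  unfolding fourier_l2_le_def
proof (intro allI impI)
  fix K :: "int set" assume K: "finite K"
  have "L2_set (\<lambda>k. cmod (fourier g k)) K = L2_set (\<lambda>k. cmod (fourier h k)) (\<pi> ` K)"
    unfolding L2_set_def using assms by (subst sum.reindex) (auto intro: inj_on_subset)
  also have "\<dots> \<le> S" using assms(1) K unfolding fourier_l2_le_def by auto
  finally show "L2_set (\<lambda>k. cmod (fourier g k)) K \<le> S" .
qed

lemma fourier_l2_le_shift:
  assumes "continuous_on unit_circle h" "fourier_l2_le h S"
  shows "fourier_l2_le (\<lambda>w. w powi m * h w) S"
  by (rule fourier_l2_le_reindex[OF assms(2), where \<pi> = "\<lambda>k. k - m"])
     (auto simp: fourier_shift assms inj_def)

lemma fourier_l2_le_cnj: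
  assumes "continuous_on unit_circle h" "fourier_l2_le h S"
  shows "fourier_l2_le (\<lambda>w. cnj (h w)) S"
  by (rule fourier_l2_le_reindex[OF assms(2), where \<pi> = uminus])
     (auto simp: fourier_cnj assms inj_def)

lemma fourier_l2_le_sup:
  assumes "continuous_on unit_circle h" "\<And>w. w \<in> unit_circle \<Longrightarrow> cmod (h w) \<le> M"
  shows "fourier_l2_le h M"
  unfolding fourier_l2_le_def using bessel assms by blast

lemma fourier_l2_le_mono: "fourier_l2_le h S \<Longrightarrow> S \<le> T \<Longrightarrow> fourier_l2_le h T"
  unfolding fourier_l2_le_def by (meson order_trans)

lemma of_real_Im_eq: "complex_of_real (Im z) = (1 / (2 * \<i>)) * z + (- (1 / (2 * \<i>))) * cnj z"
  by (simp add: complex_eq_iff)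

lemma fourier_Im:
  assumes "continuous_on unit_circle h"
  shows "fourier (\<lambda>w. complex_of_real (Im (h w))) k = (fourier h k - cnj (fourier h (- k))) / (2 * \<i>)"
  unfolding of_real_Im_eq
  by (subst fourier_add, (intro continuous_intros assms)+, (subst fourier_cmult, (intro continuous_intros assms)+)+)
     (simp add: fourier_cnj assms diff_divide_distrib right_diff_distrib)

lemma fourier_l2_le_Im:
  assumes "continuous_on unit_circle h" "fourier_l2_le h S"
  shows "fourier_l2_le (\<lambda>w. complex_of_real (Im (h w))) S"
proof -
  have "fourier_l2_le (\<lambda>w. (1 / (2 * \<i>)) * h w + (- (1 / (2 * \<i>))) * cnj (h w))
      (cmod (1 / (2 * \<i>)) * S + cmod (- (1 / (2 * \<i>))) * S)"
    by (intro fourier_l2_le_add fourier_l2_le_cmult fourier_l2_le_cnj continuous_intros assms)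
  then show ?thesis unfolding of_real_Im_eq by (simp add: norm_divide norm_mult)
qed

text \<open>The derivative of an exterior series has no Fourier modes with index above \<open>-2\<close>, so that it is
  determined by its imaginary part, whereas \<open>Im w\<close> has the modes \<open>1\<close> and \<open>-1\<close> only.\<close>

lemma exterior_series_inversion:
  fixes a :: real
  assumes r: "exterior_series r r' B" and h: "continuous_on unit_circle h" "fourier_l2_le h S"
    and eq: "\<And>w. w \<in> unit_circle \<Longrightarrow> complex_of_real (Im (r' w)) = a * complex_of_real (Im w) + h w"
  shows "\<bar>a\<bar> \<le> 2 * S" "fourier_l2_le r' (2 * S)"
proof -
  note c = exterior_seriesD[OF r]
  have z: "fourier r' k = 0" if "k \<ge> -1" for k
    using that by (cases "k = -1") (auto simp: fourier_derivative[OF r] fourier_exterior_series[OF r])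
  have id: "fourier (\<lambda>w. w) k = (if k = 1 then 1 else 0)" for k
    using fourier_powi[of 1 k] by simp
  have eq': "(fourier r' k - cnj (fourier r' (- k))) / (2 * \<i>)
      = a * ((fourier (\<lambda>w. w) k - cnj (fourier (\<lambda>w. w) (- k))) / (2 * \<i>)) + fourier h k" for k
  proof -
    have "fourier (\<lambda>w. complex_of_real (Im (r' w))) k = fourier (\<lambda>w. a * complex_of_real (Im w) + h w) k"
      by (rule fourier_cong) (rule eq)
    then show ?thesis
      by (simp add: fourier_Im[OF c(1)] fourier_add fourier_cmult fourier_Im continuous_intros h)
  qed
  \<comment> \<open>\<open>r'\<close> has neither the mode 1 nor the mode -1, hence its imaginary
    part lacks the mode 1, and \<open>h\<close> must cancel the contribution of
    \<open>a * Im w\<close>.\<close>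
  have "fourier h 1 = - a / (2 * \<i>)"
    using eq'[of 1] z[of 1] z[of "-1"] by (simp add: id add_eq_0_iff)
  then have "cmod (fourier h 1) = cmod (- a / (2 * \<i>))" by (rule arg_cong)
  then have "cmod (fourier h 1) = \<bar>a\<bar> / 2" by (simp only: norm_divide norm_mult norm_minus_cancel norm_of_real) simp
  then show "\<bar>a\<bar> \<le> 2 * S" using fourier_l2_le_coeff[OF h(2), of 1] by simp
  show "fourier_l2_le r' (2 * S)"
  proof (rule fourier_l2_le_dominated[OF h(2)])
    fix k
    show "cmod (fourier r' k) \<le> 2 * cmod (fourier h k)"
    proof (cases "k \<ge> -1")
      case True
      then show ?thesis by (simp add: z)
    next
      case False
      \<comment> \<open>Here \<open>- k\<close> is at least 2, where \<open>r'\<close> has no mode,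
        and \<open>Im w\<close> has no mode at \<open>k\<close> either.\<close>
      then have "fourier r' k / (2 * \<i>) = fourier h k"
        using eq'[of k] z[of "- k"] by (simp add: id)
      then have "cmod (fourier h k) = cmod (fourier r' k / (2 * \<i>))" by simp
      then have "cmod (fourier h k) = cmod (fourier r' k) / 2" by (simp only: norm_divide norm_mult) simp
      then show ?thesis by simp
    qed
  qed simp
qed

section \<open>Uniform and Hoelder bounds from the square mean of the derivative\<close>

lemma has_sum_norm_le:
  fixes s :: "'b :: real_normed_vector"
  assumes "(f has_sum s) X" "\<And>F. finite F \<Longrightarrow> F \<subseteq> X \<Longrightarrow> norm (sum f F) \<le> M"
  shows "norm s \<le> M"
proof (rule tendsto_upperbound)
  show "((\<lambda>F. norm (sum f F)) \<longlongrightarrow> norm s) (finite_subsets_at_top X)"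
    using assms(1) unfolding has_sum_def by (rule tendsto_norm)
  show "\<forall>\<^sub>F F in finite_subsets_at_top X. norm (sum f F) \<le> M"
    using assms(2) by (auto intro: eventually_finite_subsets_at_top_weakI)
qed simp

text \<open>Cauchy-Schwarz against \<open>n powr (-3/4)\<close>, which is square summable; hence the exponent \<open>1/4\<close>.\<close>

lemma exterior_series_weighted_sum:
  obtains C where "0 \<le> C" "\<And>g g' A S F. exterior_series g g' A \<Longrightarrow> fourier_l2_le g' S \<Longrightarrow>
    finite (F :: nat set) \<Longrightarrow> F \<subseteq> {1..} \<Longrightarrow> (\<Sum>n\<in>F. \<bar>A n\<bar> * real n powr (1/4)) \<le> C * S"
proof
  define C where "C = sqrt (\<Sum>n. real n powr (-3/2))"
  have sm: "summable (\<lambda>n. real n powr (-3/2))" by (subst summable_real_powr_iff) simp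
  show "0 \<le> C" unfolding C_def by (intro real_sqrt_ge_zero suminf_nonneg sm) simp
  fix g g' A S and F :: "nat set"
  assume g: "exterior_series g g' A" and S: "fourier_l2_le g' S" and F: "finite F" "F \<subseteq> {1..}"
  have S0: "0 \<le> S" using order_trans[OF norm_ge_zero fourier_l2_le_coeff[OF S]] .
  have "(\<Sum>n\<in>F. \<bar>A n\<bar> * real n powr (1/4)) = (\<Sum>n\<in>F. \<bar>real n * A n\<bar> * \<bar>real n powr (-3/4)\<bar>)"
  proof (rule sum.cong)
    fix n assume "n \<in> F"
    then have "real n > 0" using F(2) by auto
    then have "real n * real n powr (-3/4) = real n powr (1/4)"
      using powr_add[of "real n" 1 "-3/4"] by simp
    then show "\<bar>A n\<bar> * real n powr (1/4) = \<bar>real n * A n\<bar> * \<bar>real n powr (-3/4)\<bar>"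
      by (simp add: abs_mult algebra_simps)
  qed simp
  also have "\<dots> \<le> L2_set (\<lambda>n. real n * A n) F * L2_set (\<lambda>n. real n powr (-3/4)) F"
    by (rule L2_set_mult_ineq)
  also have "\<dots> \<le> S * C"
  proof (rule mult_mono)
    \<comment> \<open>The mode \<open>- n - 1\<close> of \<open>g'\<close> is
      \<open>- n * A n\<close>, so that the numbers \<open>n * A n\<close> are, up to sign, Fourier
      coefficients of \<open>g'\<close>.\<close>
    define \<pi> where "\<pi> n = - int n - 1" for n
    have "cmod (fourier g' (\<pi> n)) = \<bar>real n * A n\<bar>" if "n \<in> F" for n
      using that F unfolding fourier_derivative[OF g] fourier_exterior_series[OF g] \<pi>_def
      by (auto simp: norm_mult abs_mult)
    then have "L2_set (\<lambda>n. real n * A n) F = L2_set (\<lambda>k. cmod (fourier g' k)) (\<pi> ` F)"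
      unfolding L2_set_def by (subst sum.reindex) (auto simp: inj_on_def \<pi>_def)
    then show "L2_set (\<lambda>n. real n * A n) F \<le> S"
      using S F unfolding fourier_l2_le_def by auto
    have "(\<Sum>n\<in>F. (real n powr (-3/4))\<^sup>2) = (\<Sum>n\<in>F. real n powr (-3/2))"
      by (intro sum.cong) (auto simp: power2_eq_square powr_add[symmetric])
    also have "\<dots> \<le> (\<Sum>n. real n powr (-3/2))"
      by (intro sum_le_suminf sm F) auto
    finally show "L2_set (\<lambda>n. real n powr (-3/4)) F \<le> C"
      unfolding L2_set_def C_def by simp
  qed (auto simp: S0)
  finally show "(\<Sum>n\<in>F. \<bar>A n\<bar> * real n powr (1/4)) \<le> C * S" by (simp add: mult.commute)
qed

text \<open>Interpolation between the Lipschitz bound \<open>n * cmod (z - w)\<close> and the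
  trivial bound 2: up to 1 a number is at most its fourth root, and beyond 1 the fourth root is at
  least 1.\<close>

lemma norm_power_diff_holder:
  fixes z w :: complex
  assumes "cmod z = 1" "cmod w = 1"
  shows "cmod (z ^ n - w ^ n) \<le> 2 * (real n powr (1/4) * cmod (z - w) powr (1/4))"
proof -
  define y where "y = real n * cmod (z - w)"
  have y: "0 \<le> y" unfolding y_def by simp
  have 1: "cmod (z ^ n - w ^ n) \<le> y" unfolding y_def by (rule norm_power_diff) (use assms in auto)
  have 2: "cmod (z ^ n - w ^ n) \<le> 2" using norm_triangle_ineq4[of "z^n" "w^n"] assms by (simp add: norm_power)
  have "cmod (z ^ n - w ^ n) \<le> 2 * y powr (1/4)"
  proof (cases "y \<le> 1")
    case True
    then have "y \<le> y powr (1/4)" using powr_mono'[of "1/4" 1 y] y by simp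
    moreover have "0 \<le> y powr (1/4)" by simp
    ultimately show ?thesis using 1 by linarith
  next
    case False
    then have "1 \<le> y powr (1/4)" by (simp add: ge_one_powr_ge_zero)
    then show ?thesis using 2 by linarith
  qed
  then show ?thesis unfolding y_def by (simp add: powr_mult)
qed

text \<open>\<open>C\<close> is fixed before the series, since the bounds will be applied to
  families depending on the small parameter. They are proved for finite partial sums, each term
  being controlled by \<open>\<bar>A n\<bar> * n powr (1/4)\<close>, and pass to the limit.\<close>

lemma exterior_series_bounds:
  obtains C where "0 \<le> C"
    and "\<And>g g' A S w. exterior_series g g' A \<Longrightarrow> fourier_l2_le g' S \<Longrightarrow> w \<in> unit_circle \<Longrightarrow> cmod (g w) \<le> C * S"
    and "\<And>g g' A S w \<tau>. exterior_series g g' A \<Longrightarrow> fourier_l2_le g' S \<Longrightarrow> w \<in> unit_circle \<Longrightarrow> \<tau> \<in> unit_circle \<Longrightarrow>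
      cmod (g \<tau> - g w) \<le> C * S * cmod (\<tau> - w) powr (1/4)"
proof -
  obtain C where C: "0 \<le> C" "\<And>g g' A S F. exterior_series g g' A \<Longrightarrow> fourier_l2_le g' S \<Longrightarrow>
    finite (F :: nat set) \<Longrightarrow> F \<subseteq> {1..} \<Longrightarrow> (\<Sum>n\<in>F. \<bar>A n\<bar> * real n powr (1/4)) \<le> C * S"
    using exterior_series_weighted_sum by blast
  show ?thesis
  proof
    show "0 \<le> 2 * C" using C by simp
    fix g g' A S w assume g: "exterior_series g g' A" and S: "fourier_l2_le g' S" and w: "w \<in> unit_circle"
    have S0: "0 \<le> C * S" using order_trans[OF norm_ge_zero fourier_l2_le_coeff[OF S]] C(1) by simp
    have "cmod (g w) \<le> C * S"
    proof (rule has_sum_norm_le[OF exterior_seriesD(3)[OF g w]])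
      fix F :: "nat set" assume F: "finite F" "F \<subseteq> {1..}"
      have "cmod (\<Sum>n\<in>F. complex_of_real (A n) * cnj w ^ n) \<le> (\<Sum>n\<in>F. \<bar>A n\<bar> * real n powr (1/4))"
      proof (rule sum_norm_le)
        fix n assume "n \<in> F"
        then have "1 \<le> real n powr (1/4)" using F by (intro ge_one_powr_ge_zero) auto
        then show "cmod (complex_of_real (A n) * cnj w ^ n) \<le> \<bar>A n\<bar> * real n powr (1/4)"
          using w mult_left_mono[of 1 "real n powr (1/4)" "\<bar>A n\<bar>"] by (simp add: norm_mult norm_power)
      qed
      also have "\<dots> \<le> C * S" by (rule C(2)[OF g S F])
      finally show "cmod (\<Sum>n\<in>F. complex_of_real (A n) * cnj w ^ n) \<le> C * S" .
    qed
    then show "cmod (g w) \<le> 2 * C * S" using S0 by linarith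
    fix \<tau> :: complex assume t: "\<tau> \<in> unit_circle"
    have "((\<lambda>n. complex_of_real (A n) * cnj \<tau> ^ n + - (complex_of_real (A n) * cnj w ^ n)) has_sum (g \<tau> + - g w)) {1..}"
      using exterior_seriesD(3)[OF g w] exterior_seriesD(3)[OF g t]
      by (intro has_sum_add has_sum_uminusI)
    then have "cmod (g \<tau> + - g w) \<le> 2 * C * S * cmod (\<tau> - w) powr (1/4)"
    proof (rule has_sum_norm_le)
      fix F :: "nat set" assume F: "finite F" "F \<subseteq> {1..}"
      have "cmod (\<Sum>n\<in>F. complex_of_real (A n) * cnj \<tau> ^ n + - (complex_of_real (A n) * cnj w ^ n))
          \<le> (\<Sum>n\<in>F. 2 * cmod (\<tau> - w) powr (1/4) * (\<bar>A n\<bar> * real n powr (1/4)))"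
      proof (rule sum_norm_le)
        fix n assume "n \<in> F"
        have "cmod (cnj \<tau> ^ n - cnj w ^ n) \<le> 2 * (real n powr (1/4) * cmod (cnj \<tau> - cnj w) powr (1/4))"
          by (rule norm_power_diff_holder) (use w t in auto)
        also have "cmod (cnj \<tau> - cnj w) = cmod (\<tau> - w)" by (simp flip: complex_cnj_diff)
        finally have "\<bar>A n\<bar> * cmod (cnj \<tau> ^ n - cnj w ^ n) \<le> \<bar>A n\<bar> * (2 * (real n powr (1/4) * cmod (\<tau> - w) powr (1/4)))"
          by (intro mult_left_mono) auto
        moreover have "cmod (complex_of_real (A n) * cnj \<tau> ^ n + - (complex_of_real (A n) * cnj w ^ n))
            = \<bar>A n\<bar> * cmod (cnj \<tau> ^ n - cnj w ^ n)"
          by (simp add: right_diff_distrib[symmetric] norm_mult)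
        ultimately show "cmod (complex_of_real (A n) * cnj \<tau> ^ n + - (complex_of_real (A n) * cnj w ^ n))
            \<le> 2 * cmod (\<tau> - w) powr (1/4) * (\<bar>A n\<bar> * real n powr (1/4))" by (simp add: algebra_simps)
      qed
      also have "\<dots> = 2 * cmod (\<tau> - w) powr (1/4) * (\<Sum>n\<in>F. \<bar>A n\<bar> * real n powr (1/4))"
        by (simp add: sum_distrib_left)
      also have "\<dots> \<le> 2 * cmod (\<tau> - w) powr (1/4) * (C * S)"
        by (intro mult_left_mono C(2)[OF g S F]) auto
      finally show "cmod (\<Sum>n\<in>F. complex_of_real (A n) * cnj \<tau> ^ n + - (complex_of_real (A n) * cnj w ^ n))
          \<le> 2 * C * S * cmod (\<tau> - w) powr (1/4)" by (simp add: algebra_simps)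
    qed
    then show "cmod (g \<tau> - g w) \<le> 2 * C * S * cmod (\<tau> - w) powr (1/4)" by simp
  qed
qed

section \<open>Chords, arcs and integrable singularities on the circle\<close>

lemma chord_arc:
  fixes \<theta> :: real
  assumes "\<bar>\<theta>\<bar> \<le> pi"
  shows "\<bar>\<theta>\<bar> \<le> 2 * cmod (cis (a + \<theta>) - cis a)"
proof -
  \<comment> \<open>The chord is \<open>2 * \<bar>sin (\<theta>/2)\<bar>\<close>, and the Taylor
    bound gives \<open>sin x \<ge> x - x^3 / 6 \<ge> x / 2\<close> as long as
    \<open>x * x \<le> 3\<close>, which holds up to \<open>pi / 2\<close>.\<close>
  define x where "x = \<bar>\<theta>\<bar> / 2"
  have x: "0 \<le> x" "x \<le> pi / 2" unfolding x_def using assms by auto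
  have "\<bar>sin x - (\<Sum>m<3. sin_coeff m * x ^ m)\<bar> \<le> inverse (fact 3) * \<bar>x\<bar> ^ 3"
    by (rule Maclaurin_sin_bound)
  then have "\<bar>sin x - x\<bar> \<le> x ^ 3 / 6"
    using x by (simp add: sin_coeff_def eval_nat_numeral fact_numeral)
  moreover have "x ^ 3 / 6 \<le> x / 2"
  proof -
    have "pi * pi \<le> 3.2 * 3.2" using pi_approx by (intro mult_mono) auto
    moreover have "x * x \<le> (pi/2) * (pi/2)" using x by (intro mult_mono) auto
    ultimately have "x * x \<le> 3" by simp
    then have "x * (x * x) \<le> x * 3" using x by (intro mult_left_mono) auto
    then show ?thesis by (simp add: power3_eq_cube)
  qed
  ultimately have s: "x / 2 \<le> sin x" by linarith
  have "cis (a + \<theta>) - cis a = cis (a + \<theta> / 2) * (cis (\<theta>/2) - cis (- (\<theta>/2)))"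
    by (simp add: right_diff_distrib cis_mult add.commute)
  then have "cmod (cis (a + \<theta>) - cis a) = cmod (cis (\<theta>/2) - cis (- (\<theta>/2)))"
    by (simp add: norm_mult)
  also have "cis (\<theta>/2) - cis (- (\<theta>/2)) = 2 * \<i> * complex_of_real (sin (\<theta>/2))"
    by (simp add: complex_eq_iff)
  also have "cmod \<dots> = 2 * \<bar>sin (\<theta>/2)\<bar>" by (simp add: norm_mult)
  also have "\<bar>sin (\<theta>/2)\<bar> = \<bar>sin x\<bar>" unfolding x_def by (cases "\<theta> \<ge> 0") auto
  finally show ?thesis using s x unfolding x_def by linarith
qed

lemma circle_cis_Arg: "w \<in> unit_circle \<Longrightarrow> cis (Arg w) = w"
  using cis_Arg[of w] circle_nonzero[of w] by (simp add: sgn_div_norm)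

text \<open>The circle is not convex, so the mean value inequality is applied in the angle; the
  factor 2 is the price for replacing the arc by the chord.\<close>

lemma circle_lipschitz:
  assumes g: "\<And>w. w \<in> unit_circle \<Longrightarrow> (g has_field_derivative g' w) (at w within unit_circle)"
    and M: "\<And>w. w \<in> unit_circle \<Longrightarrow> cmod (g' w) \<le> M"
    and w: "w \<in> unit_circle" and t: "\<tau> \<in> unit_circle"
  shows "cmod (g \<tau> - g w) \<le> 2 * M * cmod (\<tau> - w)"
proof -
  define a where "a = Arg w"
  define \<theta> where "\<theta> = Arg (\<tau> / w)"
  have M0: "0 \<le> M" using order_trans[OF norm_ge_zero M[OF w]] .
  have 1: "w = cis a" using circle_cis_Arg[OF w] unfolding a_def by simp
  have "\<tau> / w = cis \<theta>" using w t circle_cis_Arg[of "\<tau> / w"] unfolding \<theta>_def by (simp add: norm_divide)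
  then have "\<tau> = cis \<theta> * w" using circle_nonzero[OF w] by (simp add: field_simps)
  then have 2: "\<tau> = cis (a + \<theta>)" unfolding 1 by (simp add: cis_mult add.commute)
  have th: "\<bar>\<theta>\<bar> \<le> pi" unfolding \<theta>_def using Arg_bounded[of "\<tau>/w"] by auto
  have "norm (g (cis (1 * (a + \<theta>))) - g (cis (1 * a))) \<le> M * norm ((a + \<theta>) - a)"
  proof (rule differentiable_bound[where S = UNIV])
    fix t :: real
    have "((\<lambda>t. g (cis (1 * t))) has_vector_derivative (1 * \<i> * cis (1 * t)) * g' (cis (1 * t))) (at t within UNIV)"
      using circle_vector_derivative[OF g[OF cis_in_circle], of 1 t UNIV] by simp
    then show "((\<lambda>t. g (cis (1 * t))) has_derivative (\<lambda>h. h *\<^sub>R (1 * \<i> * cis (1 * t) * g' (cis (1 * t))))) (at t within UNIV)"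
      unfolding has_vector_derivative_def .
    show "onorm (\<lambda>h. h *\<^sub>R (1 * \<i> * cis (1 * t) * g' (cis (1 * t)))) \<le> M"
    proof (rule onorm_bound[OF M0])
      fix h :: real
      show "norm (h *\<^sub>R (1 * \<i> * cis (1 * t) * g' (cis (1 * t)))) \<le> M * norm h"
        using mult_right_mono[OF M[OF cis_in_circle, of t], of "\<bar>h\<bar>"]
        by (simp add: norm_mult mult.commute)
    qed
  qed auto
  then have "cmod (g \<tau> - g w) \<le> M * \<bar>\<theta>\<bar>" using 1 2 by simp
  also have "\<dots> \<le> M * (2 * cmod (\<tau> - w))"
    using chord_arc[OF th, of a] M0 unfolding 1 2 by (rule mult_left_mono)
  finally show ?thesis by simp
qed

text \<open>The primitive \<open>G\<close> is continuous across the singularity, so that the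
  fundamental theorem applies with the exceptional point \<open>c\<close>. As
  \<open>\<bar>t - c\<bar> \<le> 3\<close>, \<open>G\<close> is bounded by 12, which gives 24. The
  point \<open>c\<close> may lie outside the interval, as it will below.\<close>

lemma has_integral_abs_powr:
  fixes c :: real
  assumes "\<bar>c\<bar> \<le> 2"
  obtains I where "((\<lambda>t. \<bar>t - c\<bar> powr (-3/4)) has_integral I) {0..1}" "I \<le> 24"
proof -
  define G where "G t = 4 * (sgn (t - c) * \<bar>t - c\<bar> powr (1/4))" for t :: real
  have "((\<lambda>t. \<bar>t - c\<bar> powr (-3/4)) has_integral (G 1 - G 0)) {0..1}"
  proof (rule fundamental_theorem_of_calculus_interior_strong[of "{c}"])
    fix t assume "t \<in> {0<..<1} - {c}"
    then consider "t > c" | "t < c" by fastforce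
    then show "(G has_vector_derivative \<bar>t - c\<bar> powr (-3/4)) (at t)"
    proof cases
      case 1
      have "((\<lambda>t. 4 * (t - c) powr (1/4)) has_real_derivative (t - c) powr (-3/4)) (at t)"
        using 1 by (auto intro!: derivative_eq_intros)
      then have "(G has_real_derivative (t - c) powr (-3/4)) (at t)"
        by (rule DERIV_cong_ev[THEN iffD1, rotated 3]) 
           (use 1 in \<open>auto simp: G_def eventually_nhds intro!: exI[of _ "{c<..}"]\<close>)
      then show ?thesis using 1 by (simp add: has_real_derivative_iff_has_vector_derivative)
    next
      case 2
      have "((\<lambda>t. - (4 * (c - t) powr (1/4))) has_real_derivative (c - t) powr (-3/4)) (at t)"
        using 2 by (auto intro!: derivative_eq_intros)
      then have "(G has_real_derivative (c - t) powr (-3/4)) (at t)"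
        by (rule DERIV_cong_ev[THEN iffD1, rotated 3]) 
           (use 2 in \<open>auto simp: G_def eventually_nhds intro!: exI[of _ "{..<c}"]\<close>)
      then show ?thesis using 2 by (simp add: has_real_derivative_iff_has_vector_derivative)
    qed
  next
    have "continuous_on {0..1} (\<lambda>t. sgn (t - c) * \<bar>t - c\<bar> powr (1/4))"
      unfolding continuous_on_eq_continuous_within
    proof
      fix t :: real
      have "continuous_on UNIV (\<lambda>t. \<bar>t - c\<bar> powr (1/4))"
        by (rule continuous_on_powr') (auto intro!: continuous_intros)
      then have p: "continuous (at t) (\<lambda>t. \<bar>t - c\<bar> powr (1/4))"
        by (simp add: continuous_on_eq_continuous_at)
      show "continuous (at t within {0..1}) (\<lambda>t. sgn (t - c) * \<bar>t - c\<bar> powr (1/4))"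
      proof (rule continuous_at_imp_continuous_at_within, cases "t = c")
        case True
        have "((\<lambda>t. \<bar>t - c\<bar> powr (1/4)) \<longlongrightarrow> 0) (at c)"
          using p unfolding True isCont_def by simp
        then have "((\<lambda>t. sgn (t - c) * \<bar>t - c\<bar> powr (1/4)) \<longlongrightarrow> 0) (at c)"
          by (rule Lim_null_comparison[rotated]) (auto simp: abs_mult sgn_if intro!: always_eventually)
        then show "continuous (at t) (\<lambda>t. sgn (t - c) * \<bar>t - c\<bar> powr (1/4))"
          unfolding True isCont_def by simp
      next
        case False
        then show "continuous (at t) (\<lambda>t. sgn (t - c) * \<bar>t - c\<bar> powr (1/4))"
          by (intro continuous_mult p continuous_sgn continuous_intros) auto
      qed
    qed
    then show "continuous_on {0..1} G" unfolding G_def by (intro continuous_on_mult_left)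
  qed auto
  moreover have "\<bar>G t\<bar> \<le> 12" if "t \<in> {0..1}" for t
  proof -
    have "\<bar>t - c\<bar> powr (1/4) \<le> 3 powr (1/4)" using that assms by (intro powr_mono2) auto
    also have "\<dots> \<le> 3 powr 1" by (intro powr_mono) auto
    finally have "\<bar>t - c\<bar> powr (1/4) \<le> 3" by simp
    moreover have "\<bar>G t\<bar> \<le> 4 * \<bar>t - c\<bar> powr (1/4)" unfolding G_def by (simp add: abs_mult abs_sgn_eq)
    ultimately show ?thesis by linarith
  qed
  from this[of 0] this[of 1] have "G 1 - G 0 \<le> 24" by auto
  ultimately show ?thesis using that by blast
qed

text \<open>Each parameter in \<open>{0..1}\<close> is within 1/2 of \<open>s\<close> or of
  \<open>s + 1\<close>, which both represent \<open>w\<close>; there \<open>chord_arc\<close> bounds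
  the chord from below by the distance of the parameters. Hence the sum of the two one-dimensional
  singularities is an integrable majorant.\<close>

lemma has_mean_singular_bound:
  assumes h: "has_mean h c" and w: "w \<in> unit_circle" and M: "0 \<le> M"
    and b: "\<And>\<tau>. \<tau> \<in> unit_circle \<Longrightarrow> \<tau> \<noteq> w \<Longrightarrow> cmod (h \<tau>) \<le> M * cmod (\<tau> - w) powr (-3/4)"
  shows "cmod c \<le> 72 * M"
proof -
  \<comment> \<open>The hypothesis does not bound \<open>h\<close> at \<open>w\<close>
    itself.\<close>
  define h0 where "h0 \<tau> = (if \<tau> = w then 0 else h \<tau>)" for \<tau>
  have h0: "has_mean h0 c"
    by (rule has_mean_spike[OF h, of w]) (auto simp: h0_def)
  define s where "s = Arg w / (2 * pi)"
  have ws: "w = cis (2 * pi * s)"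
    using circle_cis_Arg[OF w] unfolding s_def by simp
  have "\<bar>s\<bar> \<le> 1/2" using Arg_bounded[of w] unfolding s_def by (auto simp: abs_le_iff field_simps)
  then have s: "-1/2 \<le> s" "s \<le> 1/2" by linarith+
  obtain I1 where I1: "((\<lambda>t. \<bar>t - s\<bar> powr (-3/4)) has_integral I1) {0..1}" "I1 \<le> 24"
    by (rule has_integral_abs_powr[of s]) (use s in auto)
  obtain I2 where I2: "((\<lambda>t. \<bar>t - (s + 1)\<bar> powr (-3/4)) has_integral I2) {0..1}" "I2 \<le> 24"
    by (rule has_integral_abs_powr[of "s + 1"]) (use s in auto)
  let ?\<phi> = "\<lambda>t. M * (\<bar>t - s\<bar> powr (-3/4) + \<bar>t - (s + 1)\<bar> powr (-3/4))"
  have \<phi>: "(?\<phi> has_integral M * (I1 + I2)) {0..1}"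
    by (intro has_integral_mult_right has_integral_add I1 I2)
  have bd: "norm (h0 (cis (2 * pi * t))) \<le> ?\<phi> t" if t: "t \<in> {0..1}" for t
  proof (cases "cis (2 * pi * t) = w")
    case True
    then show ?thesis using M by (simp add: h0_def)
  next
    case False
    have key: "cmod (cis (2 * pi * t) - w) powr (-3/4) \<le> \<bar>t - u\<bar> powr (-3/4)"
      if u: "cis (2 * pi * u) = w" "\<bar>t - u\<bar> \<le> 1/2" for u
    proof (rule powr_mono2')
      have "\<bar>2 * pi * (t - u)\<bar> \<le> pi" using u(2) by (simp add: abs_mult)
      from chord_arc[OF this, of "2 * pi * u"]
      have "2 * pi * \<bar>t - u\<bar> \<le> 2 * cmod (cis (2 * pi * t) - w)"
        using u(1) by (simp add: abs_mult right_diff_distrib[symmetric] distrib_left[symmetric])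
      moreover have "1 * \<bar>t - u\<bar> \<le> pi * \<bar>t - u\<bar>" using pi_gt3 by (intro mult_right_mono) auto
      ultimately show "\<bar>t - u\<bar> \<le> cmod (cis (2 * pi * t) - w)" by simp
      show "0 < \<bar>t - u\<bar>" using False u(1) by auto
    qed simp
    have "cmod (cis (2 * pi * t) - w) powr (-3/4) \<le> \<bar>t - s\<bar> powr (-3/4) + \<bar>t - (s + 1)\<bar> powr (-3/4)"
    proof (cases "t \<le> s + 1/2")
      case True
      then have "\<bar>t - s\<bar> \<le> 1/2 \<or> t - s < -1/2" by linarith
      then have "\<bar>t - s\<bar> \<le> 1/2" using t s by auto
      then have "cmod (cis (2 * pi * t) - w) powr (-3/4) \<le> \<bar>t - s\<bar> powr (-3/4)"
        using ws by (intro key) auto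
      then show ?thesis by (rule add_increasing2[rotated]) simp
    next
      case False
      then have "\<bar>t - (s + 1)\<bar> \<le> 1/2" using t s unfolding atLeastAtMost_iff by linarith
      moreover have "cis (2 * pi * (s + 1)) = w"
        unfolding ws by (simp add: distrib_left flip: cis_mult)
      ultimately have "cmod (cis (2 * pi * t) - w) powr (-3/4) \<le> \<bar>t - (s + 1)\<bar> powr (-3/4)"
        by (intro key)
      then show ?thesis by (rule add_increasing[rotated]) simp
    qed
    then have "M * cmod (cis (2 * pi * t) - w) powr (-3/4) \<le> ?\<phi> t" using M by (intro mult_left_mono)
    then show ?thesis using b[of "cis (2 * pi * t)"] False by (simp add: h0_def)
  qed
  have h0': "((\<lambda>t. h0 (cis (2 * pi * t))) has_integral c) {0..1}"
    using h0 unfolding has_mean_def .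
  have "norm (integral {0..1} (\<lambda>t. h0 (cis (2 * pi * t)))) \<le> integral {0..1} ?\<phi>"
    using has_integral_integrable[OF h0'] has_integral_integrable[OF \<phi>] bd
    by (rule integral_norm_bound_integral)
  then have "norm c \<le> M * (I1 + I2)"
    unfolding integral_unique[OF h0'] integral_unique[OF \<phi>] .
  also have "\<dots> \<le> M * 72" using I1 I2 M by (intro mult_left_mono) auto
  finally show ?thesis by simp
qed

section \<open>Uniform orders of magnitude\<close>

text \<open>The index \<open>i\<close> is a point of the circle, or a pair of points of which the
  first is the variable of integration. Keeping the order as a natural number lets the rules below
  compute it from the shape of a term.\<close>

definition unif_bigo :: "'i set \<Rightarrow> nat \<Rightarrow> (real \<Rightarrow> 'i \<Rightarrow> complex) \<Rightarrow> bool" where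
  "unif_bigo S k u \<longleftrightarrow> (\<exists>C. \<forall>\<^sub>F e in at 0. \<forall>i\<in>S. cmod (u e i) \<le> C * \<bar>e\<bar> ^ k)"

lemma unif_bigoE:
  assumes "unif_bigo S k u"
  obtains C where "0 \<le> C" "\<forall>\<^sub>F e in at 0. \<forall>i\<in>S. cmod (u e i) \<le> C * \<bar>e\<bar> ^ k"
proof -
  obtain C where C: "\<forall>\<^sub>F e in at 0. \<forall>i\<in>S. cmod (u e i) \<le> C * \<bar>e\<bar> ^ k"
    using assms unfolding unif_bigo_def by blast
  have "\<forall>\<^sub>F e in at 0. \<forall>i\<in>S. cmod (u e i) \<le> max C 0 * \<bar>e\<bar> ^ k"
    using C by eventually_elim (fastforce intro: order_trans[OF _ mult_right_mono])
  then show ?thesis using that[of "max C 0"] by simp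
qed

lemma unif_bigo_cong:
  assumes "unif_bigo S k u" "\<forall>\<^sub>F e in at 0. \<forall>i\<in>S. v e i = u e i"
  shows "unif_bigo S k v"
proof -
  obtain C where C: "\<forall>\<^sub>F e in at 0. \<forall>i\<in>S. cmod (u e i) \<le> C * \<bar>e\<bar> ^ k"
    using assms unfolding unif_bigo_def by blast
  have "\<forall>\<^sub>F e in at 0. \<forall>i\<in>S. cmod (v e i) \<le> C * \<bar>e\<bar> ^ k"
    using C assms(2) by eventually_elim auto
  then show ?thesis unfolding unif_bigo_def by blast
qed

lemma unif_bigo_dominated:
  assumes "unif_bigo S k u" "\<forall>\<^sub>F e in at 0. \<forall>i\<in>S. cmod (v e i) \<le> cmod (u e i)"
  shows "unif_bigo S k v"
proof -
  obtain C where C: "\<forall>\<^sub>F e in at 0. \<forall>i\<in>S. cmod (u e i) \<le> C * \<bar>e\<bar> ^ k"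
    using assms unfolding unif_bigo_def by blast
  have "\<forall>\<^sub>F e in at 0. \<forall>i\<in>S. cmod (v e i) \<le> C * \<bar>e\<bar> ^ k"
    using C assms(2) by eventually_elim (meson order_trans)
  then show ?thesis unfolding unif_bigo_def by blast
qed

lemma eventually_abs_le_1: "\<forall>\<^sub>F e in at (0::real). \<bar>e\<bar> \<le> 1"
  by (auto simp: eventually_at intro!: exI[of _ 1])

lemma unif_bigo_mono:
  assumes "unif_bigo S k u" "l \<le> k"
  shows "unif_bigo S l u"
proof -
  obtain C where C: "0 \<le> C" "\<forall>\<^sub>F e in at 0. \<forall>i\<in>S. cmod (u e i) \<le> C * \<bar>e\<bar> ^ k"
    using unif_bigoE[OF assms(1)] .
  have "\<forall>\<^sub>F e in at 0. \<forall>i\<in>S. cmod (u e i) \<le> C * \<bar>e\<bar> ^ l"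
    using C(2) eventually_abs_le_1
  proof eventually_elim
    case (elim e)
    have "C * \<bar>e\<bar> ^ k \<le> C * \<bar>e\<bar> ^ l"
      using elim(2) by (intro mult_left_mono power_decreasing assms C(1)) auto
    then show ?case using elim(1) order_trans by blast
  qed
  then show ?thesis unfolding unif_bigo_def by blast
qed

lemma unif_bigo_add_same:
  assumes "unif_bigo S k u" "unif_bigo S k v"
  shows "unif_bigo S k (\<lambda>e i. u e i + v e i)"
proof -
  obtain C where C: "0 \<le> C" "\<forall>\<^sub>F e in at 0. \<forall>i\<in>S. cmod (u e i) \<le> C * \<bar>e\<bar> ^ k"
    using unif_bigoE[OF assms(1)] .
  obtain D where D: "0 \<le> D" "\<forall>\<^sub>F e in at 0. \<forall>i\<in>S. cmod (v e i) \<le> D * \<bar>e\<bar> ^ k"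
    using unif_bigoE[OF assms(2)] .
  have "\<forall>\<^sub>F e in at 0. \<forall>i\<in>S. cmod (u e i + v e i) \<le> (C + D) * \<bar>e\<bar> ^ k"
    using C(2) D(2) by eventually_elim (auto simp: distrib_right intro!: norm_triangle_le add_mono)
  then show ?thesis unfolding unif_bigo_def by blast
qed

lemma unif_bigo_add:
  "unif_bigo S k u \<Longrightarrow> unif_bigo S l v \<Longrightarrow> unif_bigo S (min k l) (\<lambda>e i. u e i + v e i)"
  by (rule unif_bigo_add_same) (erule unif_bigo_mono, simp)+

lemma unif_bigo_minus: "unif_bigo S k u \<Longrightarrow> unif_bigo S k (\<lambda>e i. - u e i)"
  by (erule unif_bigo_dominated) simp

lemma unif_bigo_diff:
  "unif_bigo S k u \<Longrightarrow> unif_bigo S l v \<Longrightarrow> unif_bigo S (min k l) (\<lambda>e i. u e i - v e i)"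
  using unif_bigo_add[OF _ unif_bigo_minus] by simp

lemma unif_bigo_mult:
  assumes "unif_bigo S k u" "unif_bigo S l v"
  shows "unif_bigo S (k + l) (\<lambda>e i. u e i * v e i)"
proof -
  obtain C where C: "0 \<le> C" "\<forall>\<^sub>F e in at 0. \<forall>i\<in>S. cmod (u e i) \<le> C * \<bar>e\<bar> ^ k"
    using unif_bigoE[OF assms(1)] .
  obtain D where D: "0 \<le> D" "\<forall>\<^sub>F e in at 0. \<forall>i\<in>S. cmod (v e i) \<le> D * \<bar>e\<bar> ^ l"
    using unif_bigoE[OF assms(2)] .
  have "\<forall>\<^sub>F e in at 0. \<forall>i\<in>S. cmod (u e i * v e i) \<le> (C * D) * \<bar>e\<bar> ^ (k + l)"
    using C(2) D(2)
  proof eventually_elim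
    case (elim e)
    show ?case
    proof
      fix i assume "i \<in> S"
      then have "cmod (u e i) * cmod (v e i) \<le> (C * \<bar>e\<bar> ^ k) * (D * \<bar>e\<bar> ^ l)"
        using elim C(1) by (intro mult_mono) auto
      then show "cmod (u e i * v e i) \<le> (C * D) * \<bar>e\<bar> ^ (k + l)"
        by (simp add: norm_mult power_add mult_ac)
    qed
  qed
  then show ?thesis unfolding unif_bigo_def by blast
qed

lemma unif_bigo_const: "unif_bigo S 0 (\<lambda>e i. c)"
  unfolding unif_bigo_def by (auto intro: exI[of _ "cmod c"])

lemma unif_bigo_power: "unif_bigo S k u \<Longrightarrow> unif_bigo S (n * k) (\<lambda>e i. u e i ^ n)"
proof (induction n)
  case 0
  then show ?case using unif_bigo_const[of S 1] by simp
next
  case (Suc n)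
  then show ?case using unif_bigo_mult[of S k u "n * k"] by simp
qed

lemma unif_bigo_cnj: "unif_bigo S k u \<Longrightarrow> unif_bigo S k (\<lambda>e i. cnj (u e i))"
  by (erule unif_bigo_dominated) simp

lemma unif_bigo_Im: "unif_bigo S k u \<Longrightarrow> unif_bigo S k (\<lambda>e i. of_real (Im (u e i)))"
  by (erule unif_bigo_dominated) (simp add: abs_Im_le_cmod)

lemma unif_bigo_eps: "unif_bigo S 1 (\<lambda>e i. of_real e)"
  unfolding unif_bigo_def by (auto intro: exI[of _ 1])

lemma unif_bigo_scaled_eps: "unif_bigo S 1 (\<lambda>e i. of_real (e * c))"
  using unif_bigo_mult[OF unif_bigo_eps unif_bigo_const, of S "of_real c"] by simp

lemma unif_bigo_bounded:
  assumes "\<And>i. i \<in> S \<Longrightarrow> cmod (u i) \<le> C"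
  shows "unif_bigo S 0 (\<lambda>e. u)"
  unfolding unif_bigo_def using assms by auto

lemma unif_bigo_circle: "unif_bigo unit_circle 0 (\<lambda>e w. w)"
  by (rule unif_bigo_bounded[where C = 1]) simp

lemma unif_bigo_reindex:
  assumes "unif_bigo S k u" "\<And>i. i \<in> T \<Longrightarrow> \<pi> i \<in> S"
  shows "unif_bigo T k (\<lambda>e i. u e (\<pi> i))"
proof -
  obtain C where C: "\<forall>\<^sub>F e in at 0. \<forall>i\<in>S. cmod (u e i) \<le> C * \<bar>e\<bar> ^ k"
    using assms(1) unfolding unif_bigo_def by blast
  have "\<forall>\<^sub>F e in at 0. \<forall>i\<in>T. cmod (u e (\<pi> i)) \<le> C * \<bar>e\<bar> ^ k"
    using C by (rule eventually_mono) (use assms(2) in blast)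
  then show ?thesis unfolding unif_bigo_def by blast
qed

lemma unif_bigo_fst: "unif_bigo unit_circle k u \<Longrightarrow> unif_bigo (unit_circle \<times> S) k (\<lambda>e p. u e (fst p))"
  by (erule unif_bigo_reindex) auto

lemma unif_bigo_snd: "unif_bigo S k u \<Longrightarrow> unif_bigo (unit_circle \<times> S) k (\<lambda>e p. u e (snd p))"
  by (erule unif_bigo_reindex) auto

text \<open>Used after \<open>unif_bigo_mono\<close>, which leaves the order open: the rules then
  compute an order by recursion on the term, and the last goal compares it with the claimed one.
  Cancellation is invisible to them, so error terms below are always rewritten such that each
  summand has the full order by itself.\<close>

lemmas unif_bigo_intros = unif_bigo_const unif_bigo_scaled_eps unif_bigo_eps unif_bigo_circle
  unif_bigo_fst[OF unif_bigo_circle] unif_bigo_snd[OF unif_bigo_circle]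
  unif_bigo_add unif_bigo_diff unif_bigo_minus unif_bigo_mult unif_bigo_power unif_bigo_cnj

lemma unif_bigo_tendsto_0:
  assumes "unif_bigo S (Suc k) u" "0 < \<eta>"
  shows "\<forall>\<^sub>F e in at 0. \<forall>i\<in>S. cmod (u e i) < \<eta>"
proof -
  obtain C where C: "0 \<le> C" "\<forall>\<^sub>F e in at 0. \<forall>i\<in>S. cmod (u e i) \<le> C * \<bar>e\<bar> ^ Suc 0"
    using unif_bigoE[OF unif_bigo_mono[OF assms(1), of "Suc 0"]] by auto
  have "((\<lambda>e. C * \<bar>e\<bar> ^ Suc 0) \<longlongrightarrow> C * \<bar>0\<bar> ^ Suc 0) (at 0)"
    by (intro tendsto_intros)
  then have "\<forall>\<^sub>F e in at 0. C * \<bar>e\<bar> ^ Suc 0 < \<eta>"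
    using assms(2) by (intro order_tendstoD(2)) auto
  with C(2) show ?thesis
    by eventually_elim (meson order_le_less_trans)
qed

text \<open>\<open>Suc k\<close> expresses that the order is positive; once \<open>u\<close> is
  below 1/2, the inverse is at most 2.\<close>

lemma unif_bigo_inverse:
  assumes "unif_bigo S (Suc k) u"
  shows "unif_bigo S 0 (\<lambda>e i. inverse (1 + u e i))"
proof -
  have "\<forall>\<^sub>F e in at 0. \<forall>i\<in>S. cmod (u e i) < 1/2"
    by (rule unif_bigo_tendsto_0[OF assms]) simp
  then have "\<forall>\<^sub>F e in at 0. \<forall>i\<in>S. cmod (inverse (1 + u e i)) \<le> cmod 2"
  proof eventually_elim
    case (elim e)
    show ?case
    proof
      fix i assume "i \<in> S"
      then have "cmod (u e i) < 1/2" using elim by auto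
      then have "1/2 \<le> cmod (1 + u e i)" using norm_diff_ineq[of 1 "u e i"] by simp
      then have "inverse (cmod (1 + u e i)) \<le> inverse (1/2)" by (intro le_imp_inverse_le) auto
      then show "cmod (inverse (1 + u e i)) \<le> cmod 2" by (simp add: norm_inverse)
    qed
  qed
  then show ?thesis by (rule unif_bigo_dominated[OF unif_bigo_const])
qed

lemma unif_bigo_circle_mean:
  assumes "unif_bigo (unit_circle \<times> S) k u"
    and "\<forall>\<^sub>F e in at 0. \<forall>i\<in>S. has_mean (\<lambda>\<tau>. u e (\<tau>, i)) (c e i)"
  shows "unif_bigo S k c"
proof -
  obtain C where C: "\<forall>\<^sub>F e in at 0. \<forall>p\<in>unit_circle \<times> S. cmod (u e p) \<le> C * \<bar>e\<bar> ^ k"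
    using assms(1) unfolding unif_bigo_def by blast
  have "\<forall>\<^sub>F e in at 0. \<forall>i\<in>S. cmod (c e i) \<le> C * \<bar>e\<bar> ^ k"
    using C assms(2)
  proof eventually_elim
    case (elim e)
    show ?case
    proof
      fix i assume i: "i \<in> S"
      show "cmod (c e i) \<le> C * \<bar>e\<bar> ^ k"
        by (rule has_mean_norm_le[OF bspec[OF elim(2) i]]) (use elim(1) i in auto)
    qed
  qed
  then show ?thesis unfolding unif_bigo_def by blast
qed

text \<open>On the diagonal the quotient has its limit as value, which makes it continuous in the
  first variable.\<close>

definition circle_quotient :: "(complex \<Rightarrow> complex) \<Rightarrow> (complex \<Rightarrow> complex) \<Rightarrow> complex \<times> complex \<Rightarrow> complex" where
  "circle_quotient g g' p = (if fst p = snd p then g' (snd p) else (g (fst p) - g (snd p)) / (fst p - snd p))"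

lemma continuous_on_circle_quotient:
  assumes "exterior_series g g' A" "w \<in> unit_circle"
  shows "continuous_on unit_circle (\<lambda>\<tau>. circle_quotient g g' (\<tau>, w))"
  unfolding continuous_on_eq_continuous_within
proof
  fix \<tau> :: complex assume t: "\<tau> \<in> unit_circle"
  show "continuous (at \<tau> within unit_circle) (\<lambda>\<tau>. circle_quotient g g' (\<tau>, w))"
  proof (cases "\<tau> = w")
    case True
    have "((\<lambda>\<tau>. (g \<tau> - g w) / (\<tau> - w)) \<longlongrightarrow> g' w) (at w within unit_circle)"
      using exterior_seriesD(2)[OF assms] by (simp add: has_field_derivative_iff)
    then have "((\<lambda>\<tau>. circle_quotient g g' (\<tau>, w)) \<longlongrightarrow> g' w) (at w within unit_circle)"
      by (rule Lim_transform_eventually) (auto simp: circle_quotient_def eventually_at_filter)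
    then show ?thesis unfolding True continuous_within by (simp add: circle_quotient_def)
  next
    case False
    have "continuous (at \<tau> within unit_circle) g"
      using exterior_seriesD(4)[OF assms(1)] t by (simp add: continuous_on_eq_continuous_within)
    then have "continuous (at \<tau> within unit_circle) (\<lambda>\<tau>. (g \<tau> - g w) / (\<tau> - w))"
      using False by (intro continuous_intros) auto
    moreover have "\<forall>\<^sub>F \<tau>' in at \<tau> within unit_circle. \<tau>' \<noteq> w"
      using tendsto_imp_eventually_ne[OF tendsto_ident_at False] .
    then have "\<forall>\<^sub>F \<tau>' in at \<tau> within unit_circle. (g \<tau>' - g w) / (\<tau>' - w) = circle_quotient g g' (\<tau>', w)"
      by (rule eventually_mono) (simp add: circle_quotient_def)
    ultimately have "((\<lambda>\<tau>. circle_quotient g g' (\<tau>, w)) \<longlongrightarrow> (g \<tau> - g w) / (\<tau> - w)) (at \<tau> within unit_circle)"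
      unfolding continuous_within by (rule Lim_transform_eventually)
    then show ?thesis
      unfolding continuous_within using False by (simp add: circle_quotient_def)
  qed
qed

section \<open>The self-interaction integral\<close>

definition singular_integrand ::
  "complex \<Rightarrow> (complex \<Rightarrow> complex) \<Rightarrow> (complex \<Rightarrow> complex) \<Rightarrow> complex \<times> complex \<Rightarrow> complex" where
  "singular_integrand x g g' p =
     (cnj (circle_quotient g g' p) - circle_quotient g g' p) * (g' (fst p) - circle_quotient g g' p)
       * inverse (1 + x * circle_quotient g g' p)"

definition singular_mean ::
  "complex \<Rightarrow> (complex \<Rightarrow> complex) \<Rightarrow> (complex \<Rightarrow> complex) \<Rightarrow> complex \<Rightarrow> complex" where
  "singular_mean x g g' w = circle_mean (\<lambda>\<tau>. singular_integrand x g g' (\<tau>, w))"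

lemma has_singular_mean:
  assumes g: "exterior_series g g' A" and w: "w \<in> unit_circle"
    and x: "\<And>\<tau>. \<tau> \<in> unit_circle \<Longrightarrow> cmod (x * circle_quotient g g' (\<tau>, w)) < 1"
  shows "has_mean (\<lambda>\<tau>. singular_integrand x g g' (\<tau>, w)) (singular_mean x g g' w)"
  unfolding singular_mean_def
proof (rule has_mean_continuous)
  have "1 + x * circle_quotient g g' (\<tau>, w) \<noteq> 0" if "\<tau> \<in> unit_circle" for \<tau>
    using x[OF that] by (metis add_eq_0_iff norm_minus_cancel norm_one order_less_irrefl)
  then show "continuous_on unit_circle (\<lambda>\<tau>. singular_integrand x g g' (\<tau>, w))"
    unfolding singular_integrand_def fst_conv
    by (intro continuous_intros continuous_on_circle_quotient[OF g w] exterior_seriesD(1)[OF g]) auto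
qed

text \<open>On the circle, \<open>cnj (\<tau> - w) = - (\<tau> - w) / (\<tau> w)\<close>, so that the kernel of the first integral
  becomes a function of the difference quotient.\<close>

lemma mean_circle_singular:
  assumes g: "exterior_series g g' A" and w: "w \<in> unit_circle"
    and x: "\<And>\<tau>. \<tau> \<in> unit_circle \<Longrightarrow> cmod (x * circle_quotient g g' (\<tau>, w)) < 1"
  shows "w * mean_circle (\<lambda>\<tau>. let A = \<tau> - w; B = g \<tau> - g w
           in (A * cnj B - cnj A * B) / (A * (A + x * B)) * (g' \<tau> - B / A)) = - singular_mean x g g' w"
proof -
  have "has_mean (\<lambda>\<tau>. - cnj w * singular_integrand x g g' (\<tau>, w)) (- cnj w * singular_mean x g g' w)"
    by (intro has_mean_cmult has_singular_mean[OF g w] x)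
  then have "has_mean (\<lambda>\<tau>. (let A = \<tau> - w; B = g \<tau> - g w
           in (A * cnj B - cnj A * B) / (A * (A + x * B)) * (g' \<tau> - B / A)) * \<tau>) (- cnj w * singular_mean x g g' w)"
  proof (rule has_mean_spike)
    fix \<tau> :: complex assume t: "\<tau> \<in> unit_circle" and ne: "\<tau> \<noteq> w"
    define a where "a = \<tau> - w"
    define q where "q = circle_quotient g g' (\<tau>, w)"
    have a: "a \<noteq> 0" using ne unfolding a_def by simp
    have B: "g \<tau> - g w = q * a" using ne unfolding q_def a_def circle_quotient_def by simp
    have "1 + x * q \<noteq> 0"
      using x[OF t] unfolding q_def by (metis add_eq_0_iff norm_minus_cancel norm_one order_less_irrefl)
    have ca: "cnj a = - a * cnj \<tau> * cnj w"
      unfolding a_def complex_cnj_diff circle_cnj[OF w] circle_cnj[OF t]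
      using circle_nonzero[OF t] circle_nonzero[OF w] by (simp add: field_simps)
    have num: "(a * cnj (q * a) - cnj a * (q * a)) * \<tau> = - cnj w * (cnj q - q) * (a * a)"
      using circle_mult_cnj[OF t] unfolding complex_cnj_mult ca by algebra
    have den: "a * (a + x * (q * a)) = (a * a) * (1 + x * q)" by algebra
    have "(a * cnj (q * a) - cnj a * (q * a)) / (a * (a + x * (q * a))) * (g' \<tau> - q * a / a) * \<tau>
        = ((a * cnj (q * a) - cnj a * (q * a)) * \<tau>) / (a * (a + x * (q * a))) * (g' \<tau> - q)"
      using a by simp
    also have "\<dots> = - cnj w * (cnj q - q) * (a * a) / ((a * a) * (1 + x * q)) * (g' \<tau> - q)"
      unfolding num den ..
    also have "\<dots> = - cnj w * ((cnj q - q) * (g' \<tau> - q) * inverse (1 + x * q))"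
      using a right_inverse[of "a * a"] by (simp add: divide_inverse mult.assoc)
    finally show "(let A = \<tau> - w; B = g \<tau> - g w
           in (A * cnj B - cnj A * B) / (A * (A + x * B)) * (g' \<tau> - B / A)) * \<tau>
        = - cnj w * singular_integrand x g g' (\<tau>, w)"
      unfolding Let_def a_def[symmetric] B singular_integrand_def q_def[symmetric] fst_conv .
  qed
  then show ?thesis
    using circle_mult_cnj[OF w] by (simp add: mean_circle_eq mult.assoc[symmetric])
qed

text \<open>Off the diagonal this is \<open>circle_lipschitz\<close>, the source of the factor 2; on
  the diagonal it is the bound on \<open>g'\<close>.\<close>

lemma unif_bigo_circle_quotient:
  assumes g: "\<forall>\<^sub>F e in at 0. exterior_series (g e) (g' e) (A e)"
    and g': "unif_bigo unit_circle k g'"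
  shows "unif_bigo (unit_circle \<times> unit_circle) k (\<lambda>e. circle_quotient (g e) (g' e))"
proof -
  obtain C where C: "0 \<le> C" "\<forall>\<^sub>F e in at 0. \<forall>w\<in>unit_circle. cmod (g' e w) \<le> C * \<bar>e\<bar> ^ k"
    using unif_bigoE[OF g'] .
  have "\<forall>\<^sub>F e in at 0. \<forall>p\<in>unit_circle \<times> unit_circle. cmod (circle_quotient (g e) (g' e) p) \<le> (2 * C) * \<bar>e\<bar> ^ k"
    using g C(2)
  proof eventually_elim
    case (elim e)
    show ?case
    proof (safe)
      fix \<tau> w :: complex assume t: "\<tau> \<in> unit_circle" and w: "w \<in> unit_circle"
      show "cmod (circle_quotient (g e) (g' e) (\<tau>, w)) \<le> (2 * C) * \<bar>e\<bar> ^ k"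
      proof (cases "\<tau> = w")
        case True
        have "0 \<le> C * \<bar>e\<bar> ^ k" using C(1) by simp
        then show ?thesis using bspec[OF elim(2) w] True unfolding circle_quotient_def by simp
      next
        case False
        have "cmod (g e \<tau> - g e w) \<le> 2 * (C * \<bar>e\<bar> ^ k) * cmod (\<tau> - w)"
          by (rule circle_lipschitz[OF exterior_seriesD(2)[OF elim(1)] _ w t]) (use elim(2) in auto)
        then show ?thesis
          using False unfolding circle_quotient_def by (simp add: norm_divide divide_le_eq)
      qed
    qed
  qed
  then show ?thesis unfolding unif_bigo_def by blast
qed

text \<open>The integrand is quadratic in the series up to a bounded inverse. The second claim keeps
  the denominators from vanishing.\<close>

lemma unif_bigo_singular_integrand:
  assumes g: "\<forall>\<^sub>F e in at 0. exterior_series (g e) (g' e) (A e)"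
    and g': "unif_bigo unit_circle 1 g'"
  shows "unif_bigo (unit_circle \<times> unit_circle) 2 (\<lambda>e. singular_integrand (of_real (e * b)) (g e) (g' e))"
    and "\<forall>\<^sub>F e in at 0. \<forall>p\<in>unit_circle \<times> unit_circle. cmod (of_real (e * b) * circle_quotient (g e) (g' e) p) < 1"
proof -
  note Q = unif_bigo_circle_quotient[OF assms]
  have xQ: "unif_bigo (unit_circle \<times> unit_circle) (Suc 1) (\<lambda>e p. of_real (e * b) * circle_quotient (g e) (g' e) p)"
    using unif_bigo_mult[OF unif_bigo_scaled_eps Q, of b] by (simp add: numeral_2_eq_2)
  show "\<forall>\<^sub>F e in at 0. \<forall>p\<in>unit_circle \<times> unit_circle. cmod (of_real (e * b) * circle_quotient (g e) (g' e) p) < 1"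
    by (rule unif_bigo_tendsto_0[OF xQ]) simp
  show "unif_bigo (unit_circle \<times> unit_circle) 2 (\<lambda>e. singular_integrand (of_real (e * b)) (g e) (g' e))"
    unfolding singular_integrand_def
    by (rule unif_bigo_mono, (rule unif_bigo_inverse[OF xQ] unif_bigo_intros Q unif_bigo_fst[OF g'])+) simp
qed

lemma singular_mean_bigo:
  assumes "\<forall>\<^sub>F e in at 0. exterior_series (g e) (g' e) (A e)" "unif_bigo unit_circle 1 g'"
  shows "unif_bigo unit_circle 2 (\<lambda>e. singular_mean (of_real (e * b)) (g e) (g' e))"
proof (rule unif_bigo_circle_mean)
  show "unif_bigo (unit_circle \<times> unit_circle) 2 (\<lambda>e. singular_integrand (of_real (e * b)) (g e) (g' e))"
    by (rule unif_bigo_singular_integrand[OF assms])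
  show "\<forall>\<^sub>F e in at 0. \<forall>w\<in>unit_circle. has_mean
      (\<lambda>\<tau>. singular_integrand (of_real (e * b)) (g e) (g' e) (\<tau>, w))
      (singular_mean (of_real (e * b)) (g e) (g' e) w)"
    using assms(1) unif_bigo_singular_integrand(2)[OF assms, of b]
    by eventually_elim (auto intro: has_singular_mean)
qed

lemma has_mean_power_mult_fourier:
  assumes "continuous_on unit_circle h"
  shows "has_mean (\<lambda>\<tau>. \<tau> ^ n * h \<tau>) (fourier h (- int n))"
    and "has_mean (\<lambda>\<tau>. cnj \<tau> ^ n * h \<tau>) (fourier h (int n))"
proof -
  show "has_mean (\<lambda>\<tau>. \<tau> ^ n * h \<tau>) (fourier h (- int n))"
    by (rule has_mean_cong[OF has_fourier[OF assms, of "- int n"]]) (simp add: mult.commute)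
  show "has_mean (\<lambda>\<tau>. cnj \<tau> ^ n * h \<tau>) (fourier h (int n))"
    by (rule has_mean_cong[OF has_fourier[OF assms, of "int n"]])
       (simp add: circle_cnj power_int_minus power_inverse mult.commute)
qed

lemma has_mean_power:
  assumes "n \<noteq> 0"
  shows "has_mean (\<lambda>\<tau>. \<tau> ^ n) 0" "has_mean (\<lambda>\<tau>. cnj \<tau> ^ n) 0"
  using has_mean_power_mult_fourier[of "\<lambda>w. w powi 0" n] assms
  unfolding fourier_powi by (auto simp: continuous_on_const)

lemma has_mean_id: "has_mean (\<lambda>\<tau>. \<tau>) 0" "has_mean (\<lambda>\<tau>. cnj \<tau>) 0"
  using has_mean_power[of 1] by auto

lemma exterior_series_quadratic:
  "exterior_series (\<lambda>w. of_real p1 * cnj w + of_real p2 * cnj w ^ 2)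
     (\<lambda>w. - of_real p1 * cnj w ^ 2 - 2 * of_real p2 * cnj w ^ 3)
     (\<lambda>n. if n = 1 then p1 else if n = 2 then p2 else 0)"
proof -
  have "{1..2::nat} = {1, 2}" by auto
  then have "exterior_series (\<lambda>w. of_real p1 * cnj w + of_real p2 * cnj w ^ 2)
     (\<lambda>w. - of_real p1 * cnj w ^ 2 - 2 * of_real p2 * cnj w ^ 3)
     (\<lambda>n. if n \<in> {1..2} then if n = 1 then p1 else p2 else 0)"
    using exterior_series_poly[where N = 2 and c = "\<lambda>n. if n = 1 then p1 else p2"]
    by (simp add: eval_nat_numeral)
  moreover have "(\<lambda>n::nat. if n \<in> {1..2} then if n = 1 then p1 else p2 else 0) =
      (\<lambda>n. if n = 1 then p1 else if n = 2 then p2 else 0)" by auto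
  ultimately show ?thesis by simp
qed

lemma fourier_l2_unif_bigo:
  assumes "\<forall>\<^sub>F e in at 0. fourier_l2_le (h e) (C * \<bar>e\<bar> ^ n)"
  shows "unif_bigo S n (\<lambda>e i. fourier (h e) k)"
  unfolding unif_bigo_def
  by (rule exI[of _ C], rule eventually_mono[OF assms]) (auto intro: fourier_l2_le_coeff)

lemma circle_quotient_holder:
  assumes "cmod (r \<tau> - r w) \<le> M * cmod (\<tau> - w) powr (1/4)" "\<tau> \<noteq> w"
  shows "cmod (circle_quotient r r' (\<tau>, w)) \<le> M * cmod (\<tau> - w) powr (-3/4)"
proof -
  have "cmod (\<tau> - w) powr (1/4) = cmod (\<tau> - w) powr (-3/4) * cmod (\<tau> - w)"
    using powr_add[of "cmod (\<tau> - w)" "-3/4" 1] assms(2) by simp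
  then show ?thesis
    using assms unfolding circle_quotient_def by (simp add: norm_divide divide_le_eq mult.assoc)
qed

text \<open>Write \<open>g = P + r\<close> with the quadratic polynomial \<open>P\<close> in
  \<open>cnj w\<close>, so that the difference quotient splits into \<open>QP + Qr\<close>. The
  terms without \<open>r\<close> are trigonometric polynomials, whose means are explicit. The terms
  that contain \<open>r'\<close> without \<open>Qr\<close> have polynomial cofactors and yield
  Fourier coefficients of \<open>r'\<close>. In the terms with \<open>Qr\<close> the singularity of
  exponent -3/4 is integrable, and the other factor is uniformly of order one.\<close>

lemma singular_mean_expansion:
  fixes g g' :: "real \<Rightarrow> complex \<Rightarrow> complex" and p1 p2 :: "real \<Rightarrow> real" and b C :: real
  assumes es: "\<forall>\<^sub>F e in at 0. exterior_series (g e) (g' e) (A e)"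
    and g': "unif_bigo unit_circle 1 g'"
    and p1: "\<And>(S :: (complex \<times> complex) set). unif_bigo S 1 (\<lambda>e i. of_real (p1 e))"
      "\<And>(S :: complex set). unif_bigo S 1 (\<lambda>e i. of_real (p1 e))"
    and p2: "\<And>(S :: (complex \<times> complex) set). unif_bigo S 2 (\<lambda>e i. of_real (p2 e))"
      "\<And>(S :: complex set). unif_bigo S 2 (\<lambda>e i. of_real (p2 e))"
    and l2: "\<forall>\<^sub>F e in at 0. fourier_l2_le
      (\<lambda>w. g' e w - (- of_real (p1 e) * cnj w ^ 2 - 2 * of_real (p2 e) * cnj w ^ 3)) (C * \<bar>e\<bar> ^ 3)"
  shows "unif_bigo unit_circle 4 (\<lambda>e w. - singular_mean (of_real (e * b)) (g e) (g' e) w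
    - (of_real (p1 e) ^ 2 + of_real (p1 e) * of_real (p2 e) * cnj w))"
proof -
  define x where "x e = complex_of_real (e * b)" for e
  define P1 where "P1 e = complex_of_real (p1 e)" for e
  define P2 where "P2 e = complex_of_real (p2 e)" for e
  define P where "P e w = P1 e * cnj w + P2 e * cnj w ^ 2" for e w
  define P' where "P' e w = - P1 e * cnj w ^ 2 - 2 * P2 e * cnj w ^ 3" for e w
  define r where "r e w = g e w - P e w" for e w
  define r' where "r' e w = g' e w - P' e w" for e w
  define Q where "Q e = circle_quotient (g e) (g' e)" for e
  define Qr where "Qr e = circle_quotient (r e) (r' e)" for e
  \<comment> \<open>The difference quotient of \<open>P\<close>, obtained from
    \<open>cnj \<tau> - cnj w = - cnj \<tau> * cnj w * (\<tau> - w)\<close>.\<close>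
  define QP where "QP e p = - cnj (fst p) * cnj (snd p) * P1 e
      - cnj (fst p) * cnj (snd p) * (cnj (fst p) + cnj (snd p)) * P2 e" for e p
  define i where "i e p = inverse (1 + x e * Q e p)" for e p
  define SI where "SI e = singular_integrand (x e) (g e) (g' e)" for e
  \<comment> \<open>\<open>t11\<close>, \<open>t12\<close> and \<open>t22\<close> are the
    coefficients of \<open>P1^2\<close>, \<open>P1 * P2\<close> and \<open>P2^2\<close> in
    \<open>- (cnj QP - QP) * (P' - QP)\<close>. The first two are expanded in powers of
    \<open>\<tau>\<close> and \<open>cnj \<tau>\<close> for the sake of their means; the last one is
    multiplied by a factor of order four and needs only a bound.\<close>
  define t11 where "t11 p = (let \<tau> = fst p; w = snd p; c = cnj \<tau>; v = cnj w in
      1 - w * c + v * c ^ 3 - v ^ 2 * c ^ 2)" for p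
  define t12 where "t12 p = (let \<tau> = fst p; w = snd p; c = cnj \<tau>; v = cnj w in
      v + c + \<tau> - w ^ 2 * c - (2 * w) * c ^ 2 + (3 * v) * c ^ 4 - v ^ 2 * c ^ 3 - (2 * v ^ 3) * c ^ 2)" for p
  define t22 where "t22 p = (let \<tau> = fst p; w = snd p; c = cnj \<tau>; v = cnj w in
      (\<tau> * w * (\<tau> + w) - c * v * (c + v)) * (c * v * (c + v) - 2 * c ^ 3))" for p
  define t1 where "t1 e p = P1 e ^ 2 * t11 p + P1 e * P2 e * t12 p" for e p
  define t1' where "t1' e p = P2 e ^ 2 * t22 p" for e p
  \<comment> \<open>The product of \<open>- (cnj QP - QP)\<close> and \<open>r'\<close>.\<close>
  define t2 where "t2 e p = (P1 e * (fst p * snd p - cnj (fst p) * cnj (snd p)) + P2 e *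
      (fst p ^ 2 * snd p + fst p * snd p ^ 2 - cnj (fst p) ^ 2 * cnj (snd p) - cnj (fst p) * cnj (snd p) ^ 2)) * r' e (fst p)" for e p
  \<comment> \<open>From \<open>1 / (1 + x q) = 1 - x q / (1 + x q)\<close>: the correction to the
    denominator 1, with four factors of order one.\<close>
  define t4 where "t4 e p = (cnj (Q e p) - Q e p) * (g' e (fst p) - Q e p) * (x e * Q e p) * i e p" for e p
  define t3 where "t3 e p = - SI e p - t1 e p - t1' e p - t2 e p - t4 e p" for e p
  \<comment> \<open>The terms of \<open>t11\<close> and \<open>t12\<close> that are free of
    \<open>\<tau>\<close>, all others having mean zero.\<close>
  define m1 where "m1 e w = P1 e ^ 2 + P1 e * P2 e * cnj w" for e w
  define c2 where "c2 e w = P1 e * (w * fourier (r' e) (- 1) - cnj w * fourier (r' e) 1) + P2 e *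
      (w * fourier (r' e) (- 2) + w ^ 2 * fourier (r' e) (- 1) - cnj w * fourier (r' e) 2 - cnj w ^ 2 * fourier (r' e) 1)" for e w
  define c1' where "c1' e w = circle_mean (\<lambda>\<tau>. t1' e (\<tau>, w))" for e w
  define c4 where "c4 e w = circle_mean (\<lambda>\<tau>. t4 e (\<tau>, w))" for e w
  define c3 where "c3 e w = - singular_mean (x e) (g e) (g' e) w - m1 e w - c1' e w - c2 e w - c4 e w" for e w
  have es_r: "\<forall>\<^sub>F e in at 0. exterior_series (r e) (r' e) (\<lambda>n. A e n - (if n = 1 then p1 e else if n = 2 then p2 e else 0))"
    using es by eventually_elim
      (unfold r_def r'_def P_def P'_def P1_def P2_def, rule exterior_series_diff[OF _ exterior_series_quadratic])
  have l2': "\<forall>\<^sub>F e in at 0. fourier_l2_le (r' e) (C * \<bar>e\<bar> ^ 3)"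
    using l2 unfolding r'_def P'_def P1_def P2_def .
  have small: "\<forall>\<^sub>F e in at 0. \<forall>p\<in>unit_circle \<times> unit_circle. cmod (x e * Q e p) < 1"
    using unif_bigo_singular_integrand(2)[OF es g'] unfolding x_def Q_def .
  note O = unif_bigo_intros
  have OQ: "unif_bigo (unit_circle \<times> unit_circle) 1 Q"
    using unif_bigo_circle_quotient[OF es g'] unfolding Q_def .
  have Og': "unif_bigo (unit_circle \<times> unit_circle) 1 (\<lambda>e p. g' e (fst p))"
    by (rule unif_bigo_fst[OF g'])
  have Ox: "unif_bigo (unit_circle \<times> unit_circle) 1 (\<lambda>e p. x e)"
    unfolding x_def by (rule unif_bigo_scaled_eps)
  note OP1 = p1[folded P1_def] and OP2 = p2[folded P2_def]
  have Oi: "unif_bigo (unit_circle \<times> unit_circle) 0 i"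
  proof -
    have "unif_bigo (unit_circle \<times> unit_circle) (Suc 1) (\<lambda>e p. x e * Q e p)"
      using unif_bigo_mult[OF Ox OQ] by (simp add: numeral_2_eq_2)
    then show ?thesis unfolding i_def by (rule unif_bigo_inverse)
  qed
  have Ot4: "unif_bigo (unit_circle \<times> unit_circle) 4 t4"
    unfolding t4_def by (rule unif_bigo_mono, (rule O OQ Og' Ox Oi)+) simp
  have Ot1': "unif_bigo (unit_circle \<times> unit_circle) 4 t1'"
    unfolding t1'_def t22_def Let_def by (rule unif_bigo_mono, (rule O OP2)+) simp
  have OQP: "unif_bigo (unit_circle \<times> unit_circle) 1 QP"
    unfolding QP_def by (rule unif_bigo_mono, (rule O OP1 OP2)+) simp
  have F: "unif_bigo unit_circle 3 (\<lambda>e w. fourier (r' e) k)" for k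
    by (rule fourier_l2_unif_bigo[OF l2'])
  have Oc2: "unif_bigo unit_circle 4 c2"
    unfolding c2_def by (rule unif_bigo_mono, (rule O OP1 OP2 F)+) simp
  have i_eq: "i e p * (1 + x e * Q e p) = 1" if "cmod (x e * Q e p) < 1" for e p
  proof -
    have "1 + x e * Q e p \<noteq> 0"
      using that by (metis add_eq_0_iff norm_minus_cancel norm_one order_less_irrefl)
    then show ?thesis unfolding i_def by simp
  qed
  have M1: "has_mean (\<lambda>\<tau>. t1 e (\<tau>, w)) (m1 e w)" for e w
  proof -
    have "has_mean (\<lambda>\<tau>. t11 (\<tau>, w)) (1 - w * 0 + cnj w * 0 - cnj w ^ 2 * 0)"
      unfolding t11_def Let_def fst_conv snd_conv
      by (intro has_mean_add has_mean_diff has_mean_cmult has_mean_const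
          has_mean_power has_mean_id) auto
    moreover have "has_mean (\<lambda>\<tau>. t12 (\<tau>, w)) (cnj w + 0 + 0 - w ^ 2 * 0 - (2 * w) * 0 + (3 * cnj w) * 0
        - cnj w ^ 2 * 0 - (2 * cnj w ^ 3) * 0)"
      unfolding t12_def Let_def fst_conv snd_conv
      by (intro has_mean_add has_mean_diff has_mean_cmult has_mean_const
          has_mean_power has_mean_id) auto
    ultimately have "has_mean (\<lambda>\<tau>. t1 e (\<tau>, w)) (P1 e ^ 2 * 1 + P1 e * P2 e * cnj w)"
      unfolding t1_def by (intro has_mean_add has_mean_cmult) auto
    then show ?thesis unfolding m1_def by simp
  qed
  have M1': "has_mean (\<lambda>\<tau>. t1' e (\<tau>, w)) (c1' e w)" for e w
    unfolding c1'_def t1'_def t22_def Let_def fst_conv snd_conv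
    by (intro has_mean_continuous continuous_intros)
  have M2: "has_mean (\<lambda>\<tau>. t2 e (\<tau>, w)) (c2 e w)"
    if "exterior_series (r e) (r' e) B" for e w B
  proof -
    note m = has_mean_power_mult_fourier[OF exterior_seriesD(1)[OF that]]
    have "has_mean (\<lambda>\<tau>. P1 e * (w * (\<tau> ^ 1 * r' e \<tau>) - cnj w * (cnj \<tau> ^ 1 * r' e \<tau>)) + P2 e *
      (w * (\<tau> ^ 2 * r' e \<tau>) + w ^ 2 * (\<tau> ^ 1 * r' e \<tau>) - cnj w * (cnj \<tau> ^ 2 * r' e \<tau>) - cnj w ^ 2 * (cnj \<tau> ^ 1 * r' e \<tau>)))
      (P1 e * (w * fourier (r' e) (- int 1) - cnj w * fourier (r' e) (int 1)) + P2 e *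
      (w * fourier (r' e) (- int 2) + w ^ 2 * fourier (r' e) (- int 1) - cnj w * fourier (r' e) (int 2) - cnj w ^ 2 * fourier (r' e) (int 1)))"
      (is "has_mean ?h _")
      by (intro has_mean_add has_mean_diff has_mean_cmult m)
    then have "has_mean ?h (c2 e w)"
      unfolding c2_def by simp
    then show ?thesis
      by (rule has_mean_cong) (simp add: t2_def algebra_simps)
  qed
  have M4: "has_mean (\<lambda>\<tau>. t4 e (\<tau>, w)) (c4 e w)"
    if "exterior_series (g e) (g' e) (A e)" "\<forall>p\<in>unit_circle \<times> unit_circle. cmod (x e * Q e p) < 1" "w \<in> unit_circle" for e w
    unfolding c4_def
  proof (rule has_mean_continuous)
    have nz: "1 + x e * Q e (\<tau>, w) \<noteq> 0" if "\<tau> \<in> unit_circle" for \<tau>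
    proof -
      have "cmod (x e * Q e (\<tau>, w)) < 1"
        using bspec[OF \<open>\<forall>p\<in>_. _ < 1\<close>, of "(\<tau>, w)"] that \<open>w \<in> unit_circle\<close> by simp
      from i_eq[OF this] show ?thesis by auto
    qed
    have cQ: "continuous_on unit_circle (\<lambda>\<tau>. Q e (\<tau>, w))"
      unfolding Q_def by (rule continuous_on_circle_quotient[OF that(1) that(3)])
    show "continuous_on unit_circle (\<lambda>\<tau>. t4 e (\<tau>, w))"
      unfolding t4_def i_def fst_conv
      by (intro continuous_intros cQ exterior_seriesD(1)[OF that(1)]) (use nz in auto)
  qed
  have Oc1': "unif_bigo unit_circle 4 c1'"
    by (rule unif_bigo_circle_mean[OF Ot1']) (simp add: M1')
  have Oc4: "unif_bigo unit_circle 4 c4"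
    by (rule unif_bigo_circle_mean[OF Ot4]) (use es small in eventually_elim, auto intro!: M4)
  have t3_eq: "t3 e (\<tau>, w) = (cnj (QP e (\<tau>, w)) - QP e (\<tau>, w)) * Qr e (\<tau>, w)
      - (cnj (Qr e (\<tau>, w)) - Qr e (\<tau>, w)) * (g' e \<tau> - Q e (\<tau>, w))"
    if t: "\<tau> \<in> unit_circle" and w: "w \<in> unit_circle" and ne: "\<tau> \<noteq> w" and s: "cmod (x e * Q e (\<tau>, w)) < 1" for e \<tau> w
  proof -
    define c v where "c = cnj \<tau>" and "v = cnj w"
    have tc: "\<tau> * c = 1" and wv: "w * v = 1"
      using circle_mult_cnj t w unfolding c_def v_def by auto
    define q qp qr where "q = Q e (\<tau>, w)" and "qp = QP e (\<tau>, w)" and "qr = Qr e (\<tau>, w)"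
    have qp: "qp = - c * v * P1 e - c * v * (c + v) * P2 e" unfolding qp_def QP_def c_def v_def by simp
    have cqp: "cnj qp = - \<tau> * w * P1 e - \<tau> * w * (\<tau> + w) * P2 e"
      unfolding qp c_def v_def P1_def P2_def by simp
    have cv: "c - v = - c * v * (\<tau> - w)" using tc wv by algebra
    have "P e \<tau> - P e w = (c - v) * P1 e + (c - v) * (c + v) * P2 e"
      unfolding P_def c_def[symmetric] v_def[symmetric] by algebra
    then have "P e \<tau> - P e w = qp * (\<tau> - w)" unfolding qp cv by algebra
    then have q: "q = qp + qr"
      unfolding q_def qr_def Q_def Qr_def circle_quotient_def r_def using ne
      by (simp add: field_simps)
    have s1: "- SI e (\<tau>, w) - t4 e (\<tau>, w) = - (cnj q - q) * (g' e \<tau> - q)"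
    proof -
      have "i e (\<tau>, w) * (1 + x e * q) = 1" unfolding q_def by (rule i_eq[OF s])
      moreover have "SI e (\<tau>, w) = (cnj q - q) * (g' e \<tau> - q) * i e (\<tau>, w)"
        unfolding SI_def singular_integrand_def i_def q_def Q_def by simp
      moreover have "t4 e (\<tau>, w) = (cnj q - q) * (g' e \<tau> - q) * (x e * q) * i e (\<tau>, w)"
        unfolding t4_def q_def by simp
      ultimately show ?thesis by algebra
    qed
    have s2: "t1 e (\<tau>, w) + t1' e (\<tau>, w) + t2 e (\<tau>, w) = - (cnj qp - qp) * (P' e \<tau> - qp + r' e \<tau>)"
      unfolding t1_def t1'_def t2_def t11_def t12_def t22_def P'_def Let_def fst_conv snd_conv
        c_def[symmetric] v_def[symmetric] cqp unfolding qp using tc wv by algebra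
    have "g' e \<tau> = P' e \<tau> + r' e \<tau>" unfolding r'_def by simp
    moreover have "cnj q = cnj qp + cnj qr" unfolding q by simp
    ultimately show ?thesis
      unfolding t3_def q_def[symmetric] qp_def[symmetric] qr_def[symmetric] using s1 s2 q by algebra
  qed
  have Oc3: "unif_bigo unit_circle 4 c3"
  proof -
    obtain D where D: "0 \<le> D" "\<And>g g' A S w \<tau>. exterior_series g g' A \<Longrightarrow> fourier_l2_le g' S \<Longrightarrow> w \<in> unit_circle \<Longrightarrow> \<tau> \<in> unit_circle \<Longrightarrow>
        cmod (g \<tau> - g w) \<le> D * S * cmod (\<tau> - w) powr (1/4)"
      using exterior_series_bounds by metis
    obtain C1 where C1: "0 \<le> C1" "\<forall>\<^sub>F e in at 0. \<forall>p\<in>unit_circle \<times> unit_circle. cmod (QP e p) \<le> C1 * \<bar>e\<bar> ^ 1"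
      using unif_bigoE[OF OQP] .
    have "unif_bigo (unit_circle \<times> unit_circle) 1 (\<lambda>e p. g' e (fst p) - Q e p)"
      by (rule unif_bigo_mono, (rule O Og' OQ)+) simp
    from unif_bigoE[OF this] obtain C3 where C3: "0 \<le> C3"
      "\<forall>\<^sub>F e in at 0. \<forall>p\<in>unit_circle \<times> unit_circle. cmod (g' e (fst p) - Q e p) \<le> C3 * \<bar>e\<bar> ^ 1" .
    \<comment> \<open>The factor 72 stems from \<open>has_mean_singular_bound\<close> and the factor
      2 from \<open>cmod (cnj z - z) \<le> 2 * cmod z\<close>; \<open>D * \<bar>C\<bar>\<close> is
      the Hoelder constant of \<open>r\<close> up to the cube of the parameter. The absolute value
      is taken because the sign of \<open>C\<close> is not prescribed.\<close>
    have "\<forall>\<^sub>F e in at 0. \<forall>w\<in>unit_circle. cmod (c3 e w) \<le> (72 * (2 * (C1 + C3) * (D * \<bar>C\<bar>))) * \<bar>e\<bar> ^ 4"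
      using C1(2) C3(2) es es_r l2' small
    proof eventually_elim
      case (elim e)
      show ?case
      proof
        fix w :: complex assume w: "w \<in> unit_circle"
        have hc: "has_mean (\<lambda>\<tau>. t3 e (\<tau>, w)) (c3 e w)"
        proof -
          have "has_mean (\<lambda>\<tau>. - SI e (\<tau>, w)) (- singular_mean (x e) (g e) (g' e) w)"
            unfolding SI_def
            by (intro has_mean_neg has_singular_mean[OF elim(3) w]) (use elim(6) w in \<open>auto simp: Q_def\<close>)
          then show ?thesis
            unfolding t3_def c3_def
            by (intro has_mean_diff M1 M1' M2[OF elim(4)] M4[OF elim(3) elim(6) w])
        qed
        have "cmod (c3 e w) \<le> 72 * (2 * (C1 + C3) * (D * \<bar>C\<bar>) * \<bar>e\<bar> ^ 4)"
        proof (rule has_mean_singular_bound[OF hc w])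
          show "0 \<le> 2 * (C1 + C3) * (D * \<bar>C\<bar>) * \<bar>e\<bar> ^ 4" using C1(1) C3(1) D(1) by simp
          fix \<tau> :: complex assume t: "\<tau> \<in> unit_circle" and ne: "\<tau> \<noteq> w"
          define a where "a = cmod (\<tau> - w) powr (-3/4)"
          have a: "0 \<le> a" unfolding a_def by simp
          have pm: "(\<tau>, w) \<in> unit_circle \<times> unit_circle" using t w by simp
          have "cmod (r e \<tau> - r e w) \<le> D * (C * \<bar>e\<bar> ^ 3) * cmod (\<tau> - w) powr (1/4)"
            by (rule D(2)[OF elim(4) elim(5) w t])
          then have "cmod (Qr e (\<tau>, w)) \<le> D * (C * \<bar>e\<bar> ^ 3) * a"
            unfolding Qr_def a_def by (rule circle_quotient_holder[OF _ ne])
          also have "\<dots> \<le> D * (\<bar>C\<bar> * \<bar>e\<bar> ^ 3) * a"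
            using D(1) a by (intro mult_right_mono mult_left_mono) auto
          finally have qr: "cmod (Qr e (\<tau>, w)) \<le> D * (\<bar>C\<bar> * \<bar>e\<bar> ^ 3) * a" .
          have "cmod (t3 e (\<tau>, w)) \<le> (2 * cmod (QP e (\<tau>, w))) * cmod (Qr e (\<tau>, w))
              + (2 * cmod (Qr e (\<tau>, w))) * cmod (g' e \<tau> - Q e (\<tau>, w))"
          proof -
            have n2: "cmod (cnj z - z) \<le> 2 * cmod z" for z
              using norm_triangle_ineq4[of "cnj z" z] by simp
            show ?thesis
              unfolding t3_eq[OF t w ne bspec[OF elim(6) pm]]
              by (rule order_trans[OF norm_triangle_ineq4], unfold norm_mult, intro add_mono mult_right_mono n2) auto
          qed
          also have "\<dots> = 2 * (cmod (QP e (\<tau>, w)) + cmod (g' e \<tau> - Q e (\<tau>, w))) * cmod (Qr e (\<tau>, w))"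
            by (simp add: algebra_simps)
          also have "\<dots> \<le> 2 * (C1 * \<bar>e\<bar> ^ 1 + C3 * \<bar>e\<bar> ^ 1) * (D * (\<bar>C\<bar> * \<bar>e\<bar> ^ 3) * a)"
            using bspec[OF elim(1) pm] bspec[OF elim(2) pm] qr C1(1) C3(1)
            by (intro mult_mono add_mono mult_left_mono) auto
          also have "\<dots> = 2 * (C1 + C3) * (D * \<bar>C\<bar>) * \<bar>e\<bar> ^ 4 * a"
            by algebra
          finally show "cmod (t3 e (\<tau>, w)) \<le> 2 * (C1 + C3) * (D * \<bar>C\<bar>) * \<bar>e\<bar> ^ 4 * cmod (\<tau> - w) powr (-3/4)"
            unfolding a_def .
        qed
        then show "cmod (c3 e w) \<le> (72 * (2 * (C1 + C3) * (D * \<bar>C\<bar>))) * \<bar>e\<bar> ^ 4" by (simp add: mult.assoc)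
      qed
    qed
    then show ?thesis unfolding unif_bigo_def by blast
  qed
  have "unif_bigo unit_circle 4 (\<lambda>e w. c3 e w + c1' e w + c2 e w + c4 e w)"
    by (rule unif_bigo_mono, (rule O Oc3 Oc1' Oc2 Oc4)+) simp
  moreover have "c3 e w + c1' e w + c2 e w + c4 e w = - singular_mean (x e) (g e) (g' e) w - m1 e w" for e w
    unfolding c3_def by algebra
  ultimately show ?thesis unfolding m1_def x_def P1_def P2_def by simp
qed

section \<open>The interaction of the two domains\<close>

text \<open>The kernel is a geometric series in \<open>D * z\<close>. Positive powers of
  \<open>\<tau>\<close> have mean zero, and so have the products of powers of \<open>\<tau>\<close>
  with \<open>cnj (g e \<tau>)\<close>. Hence, of all terms of order below five, there remain only
  those free of \<open>\<tau>\<close>, the area term and one with the coefficient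
  \<open>A e 1\<close>.\<close>

lemma interaction_mean_expansion:
  fixes g g' v :: "real \<Rightarrow> complex \<Rightarrow> complex" and A :: "real \<Rightarrow> nat \<Rightarrow> real" and b d :: real
  defines "D \<equiv> of_real (1 / d)" and "y \<equiv> \<lambda>e. of_real (e * b)"
  assumes d: "d > 0"
    and es: "\<forall>\<^sub>F e in at 0. exterior_series (g e) (g' e) (A e)"
    and g: "unif_bigo unit_circle 1 g" and g': "unif_bigo unit_circle 1 g'" and v: "unif_bigo unit_circle 1 v"
  shows "unif_bigo unit_circle 5 (\<lambda>e w.
      - mean_circle (\<lambda>\<tau>. (cnj \<tau> + y e * cnj (g e \<tau>)) * (1 + y e * g' e \<tau>)
          / (y e * \<tau> + y e ^ 2 * g e \<tau> + v e w - of_real d))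
      - ((1 + y e ^ 2 * circle_mean (\<lambda>\<tau>. \<tau> * cnj (g e \<tau>) * g' e \<tau>)) * D + v e w * D ^ 2
         + (v e w ^ 2 + y e ^ 3 * of_real (A e 1)) * D ^ 3 + v e w ^ 3 * D ^ 4 + v e w ^ 4 * D ^ 5))"
proof -
  \<comment> \<open>Multiplied by \<open>\<tau>\<close>, as \<open>mean_circle_eq\<close> requires,
    the numerator becomes \<open>\<rho> = (1 + s) * (1 + a')\<close>.\<close>
  define s where "s e p = fst p * y e * cnj (g e (fst p))" for e and p :: "complex \<times> complex"
  define a where "a e p = y e * g e (fst p)" for e and p :: "complex \<times> complex"
  define a' where "a' e p = y e * g' e (fst p)" for e and p :: "complex \<times> complex"
  define \<rho> where "\<rho> e p = (1 + s e p) * (1 + a' e p)" for e p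
  define z0 where "z0 e p = y e * fst p + v e (snd p)" for e p
  define z where "z e p = z0 e p + y e * a e p" for e p
  define I where "I e p = inverse (1 + - (D * z e p))" for e p
  define \<mu> where "\<mu> e = circle_mean (\<lambda>\<tau>. \<tau> * cnj (g e \<tau>) * g' e \<tau>)" for e
  define T where "T e p = \<rho> e p * D + (z0 e p + y e * a e p + z0 e p * (s e p + a' e p)) * D ^ 2
    + (z0 e p ^ 2 * (1 + s e p + a' e p) + 2 * y e * a e p * z0 e p) * D ^ 3 + z0 e p ^ 3 * D ^ 4 + z0 e p ^ 4 * D ^ 5" for e p
  define m where "m e w = (1 + y e ^ 2 * \<mu> e) * D + v e w * D ^ 2
         + (v e w ^ 2 + y e ^ 3 * of_real (A e 1)) * D ^ 3 + v e w ^ 3 * D ^ 4 + v e w ^ 4 * D ^ 5" for e w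
  define H where "H e w \<tau> = (cnj \<tau> + y e * cnj (g e \<tau>)) * (1 + y e * g' e \<tau>)
          / (y e * \<tau> + y e ^ 2 * g e \<tau> + v e w - of_real d)" for e w \<tau>
  \<comment> \<open>The difference between the integrand and \<open>T\<close>, factored such that
    every summand has at least order five.\<close>
  define E where "E e p = (z0 e p * (s e p * a' e p) + (y e * a e p) * (s e p + a' e p + s e p * a' e p)) * D ^ 2
    + (z0 e p ^ 2 * (s e p * a' e p) + (2 * z0 e p * (y e * a e p)) * (s e p + a' e p + s e p * a' e p) + (y e * a e p) ^ 2 * \<rho> e p) * D ^ 3
    + (\<rho> e p * (y e * a e p) * (3 * z0 e p ^ 2 + 3 * z0 e p * (y e * a e p) + (y e * a e p) ^ 2)
        + z0 e p ^ 3 * (s e p + a' e p + s e p * a' e p)) * D ^ 4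
    + (\<rho> e p * (y e * a e p) * (4 * z0 e p ^ 3 + 6 * z0 e p ^ 2 * (y e * a e p) + 4 * z0 e p * (y e * a e p) ^ 2 + (y e * a e p) ^ 3)
        + z0 e p ^ 4 * (s e p + a' e p + s e p * a' e p)) * D ^ 5
    + \<rho> e p * z e p ^ 5 * I e p * D ^ 6" for e p
  let ?CC = "unit_circle \<times> unit_circle"
  note O = unif_bigo_intros
  have Oy: "unif_bigo S 1 (\<lambda>e i. y e)" for S :: "(complex \<times> complex) set"
    unfolding y_def by (rule unif_bigo_scaled_eps)
  note Og = unif_bigo_fst[OF g, of unit_circle] and Og' = unif_bigo_fst[OF g', of unit_circle] and Ov = unif_bigo_snd[OF v]
  have Os: "unif_bigo ?CC 2 s"
    unfolding s_def by (rule unif_bigo_mono, (rule O Oy Og)+) simp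
  have Oa: "unif_bigo ?CC 2 a"
    unfolding a_def by (rule unif_bigo_mono, (rule O Oy Og)+) simp
  have Oa': "unif_bigo ?CC 2 a'"
    unfolding a'_def by (rule unif_bigo_mono, (rule O Oy Og')+) simp
  have O\<rho>: "unif_bigo ?CC 0 \<rho>"
    unfolding \<rho>_def by (rule unif_bigo_mono, (rule O Os Oa')+) simp
  have Oz0: "unif_bigo ?CC 1 z0"
    unfolding z0_def by (rule unif_bigo_mono, (rule O Oy Ov)+) simp
  have Oz: "unif_bigo ?CC 1 z"
    unfolding z_def by (rule unif_bigo_mono, (rule O Oz0 Oy Oa)+) simp
  have ODz: "unif_bigo ?CC (Suc 0) (\<lambda>e p. - (D * z e p))"
    by (rule unif_bigo_mono, (rule O Oz)+) simp
  have OI: "unif_bigo ?CC 0 I"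
    unfolding I_def by (rule unif_bigo_inverse[OF ODz])
  have OE: "unif_bigo ?CC 5 E"
    unfolding E_def by (rule unif_bigo_mono, (rule O Os Oa Oa' O\<rho> Oz0 Oz OI Oy)+) simp
  have small: "\<forall>\<^sub>F e in at 0. \<forall>p\<in>?CC. cmod (- (D * z e p)) < 1"
    by (rule unif_bigo_tendsto_0[OF ODz]) simp
  have Dd: "D * of_real d = 1" unfolding D_def using d by simp
  have nz: "1 + - (D * z e p) \<noteq> 0" if "cmod (- (D * z e p)) < 1" for e p
    using that by (metis add_eq_0_iff norm_minus_cancel norm_one order_less_irrefl)
  have H_eq: "- H e w \<tau> * \<tau> = \<rho> e (\<tau>, w) * D * I e (\<tau>, w)"
    if t: "\<tau> \<in> unit_circle" and s: "cmod (- (D * z e (\<tau>, w))) < 1" for e w \<tau>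
  proof -
    define N where "N = 1 + - (D * z e (\<tau>, w))"
    have N: "N \<noteq> 0" unfolding N_def by (rule nz[OF s])
    have den: "y e * \<tau> + y e ^ 2 * g e \<tau> + v e w - of_real d = - of_real d * N"
    proof -
      have "z e (\<tau>, w) = y e * \<tau> + y e ^ 2 * g e \<tau> + v e w"
        unfolding z_def z0_def a_def fst_conv snd_conv by algebra
      then show ?thesis unfolding N_def using Dd by algebra
    qed
    have num: "(cnj \<tau> + y e * cnj (g e \<tau>)) * (1 + y e * g' e \<tau>) * \<tau> = \<rho> e (\<tau>, w)"
      using circle_mult_cnj[OF t] unfolding \<rho>_def s_def a'_def fst_conv by algebra
    have "- H e w \<tau> * \<tau> = ((cnj \<tau> + y e * cnj (g e \<tau>)) * (1 + y e * g' e \<tau>) * \<tau>) / (of_real d * N)"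
      unfolding H_def den by simp
    also have "\<dots> = \<rho> e (\<tau>, w) * D * I e (\<tau>, w)"
      unfolding num I_def N_def[symmetric] by (simp add: D_def divide_inverse)
    finally show ?thesis .
  qed
  have E_eq: "\<rho> e p * D * I e p - T e p = E e p" if "cmod (- (D * z e p)) < 1" for e p
  proof -
    define q where "q = y e * a e p"
    have "I e p * (1 + - (D * z e p)) = 1" unfolding I_def using nz[OF that] by simp
    \<comment> \<open>The finite geometric series with its exact remainder.\<close>
    then have "I e p = 1 + D * z e p + (D * z e p) ^ 2 + (D * z e p) ^ 3 + (D * z e p) ^ 4 + (D * z e p) ^ 5 * I e p"
      by algebra
    then have "\<rho> e p * D * I e p = \<rho> e p * D + \<rho> e p * z e p * D ^ 2 + \<rho> e p * z e p ^ 2 * D ^ 3 + \<rho> e p * z e p ^ 3 * D ^ 4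
        + \<rho> e p * z e p ^ 4 * D ^ 5 + \<rho> e p * z e p ^ 5 * I e p * D ^ 6"
      by algebra
    moreover have "\<rho> e p * z e p = z0 e p + q + z0 e p * (s e p + a' e p) +
        (z0 e p * (s e p * a' e p) + q * (s e p + a' e p + s e p * a' e p))"
      unfolding \<rho>_def z_def q_def[symmetric] by algebra
    moreover have "\<rho> e p * z e p ^ 2 = z0 e p ^ 2 * (1 + s e p + a' e p) + 2 * q * z0 e p +
        (z0 e p ^ 2 * (s e p * a' e p) + (2 * z0 e p * q) * (s e p + a' e p + s e p * a' e p) + q ^ 2 * \<rho> e p)"
      unfolding \<rho>_def z_def q_def[symmetric] by algebra
    moreover have "\<rho> e p * z e p ^ 3 = z0 e p ^ 3 +
        (\<rho> e p * q * (3 * z0 e p ^ 2 + 3 * z0 e p * q + q ^ 2) + z0 e p ^ 3 * (s e p + a' e p + s e p * a' e p))"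
      unfolding \<rho>_def z_def q_def[symmetric] by algebra
    moreover have "\<rho> e p * z e p ^ 4 = z0 e p ^ 4 +
        (\<rho> e p * q * (4 * z0 e p ^ 3 + 6 * z0 e p ^ 2 * q + 4 * z0 e p * q ^ 2 + q ^ 3) + z0 e p ^ 4 * (s e p + a' e p + s e p * a' e p))"
      unfolding \<rho>_def z_def q_def[symmetric] by algebra
    ultimately show ?thesis
      unfolding T_def E_def mult.assoc[of 2 "y e" "a e p"] q_def[symmetric] by (simp only: ring_distribs) (simp add: algebra_simps)
  qed
  have MT: "has_mean (\<lambda>\<tau>. T e (\<tau>, w)) (m e w)" if es: "exterior_series (g e) (g' e) (A e)" for e w
  proof -
    note h = exterior_seriesD[OF es]
    note F = fourier_exterior_series[OF es] fourier_derivative[OF es]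
    have mg: "has_mean (\<lambda>\<tau>. \<tau> ^ n * g e \<tau>) (if n = 0 then 0 else A e n)" for n
      using has_mean_power_mult_fourier(1)[OF h(4), of n] by (auto simp: F split: if_splits)
    have mg': "has_mean (\<lambda>\<tau>. \<tau> ^ n * g' e \<tau>) (if n < 2 then 0 else - (of_nat n - 1) * A e (n - 1))" for n
      using has_mean_power_mult_fourier(1)[OF h(1), of n] by (cases n) (auto simp: F nat_diff_distrib algebra_simps split: if_splits)
    have mc: "has_mean (\<lambda>\<tau>. \<tau> ^ n * cnj (g e \<tau>)) 0" for n
    proof -
      have "has_mean (\<lambda>\<tau>. cnj (cnj \<tau> ^ n * g e \<tau>)) (cnj 0)"
        using has_mean_power_mult_fourier(2)[OF h(4), of n] by (intro has_mean_cnj) (simp add: F)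
      then show ?thesis by simp
    qed
    have m\<mu>: "has_mean (\<lambda>\<tau>. \<tau> * cnj (g e \<tau>) * g' e \<tau>) (\<mu> e)"
      unfolding \<mu>_def by (intro has_mean_continuous continuous_intros h)
    define Y V where "Y = y e" and "V = v e w"
    \<comment> \<open>The monomials of \<open>T\<close>, up to a common factor \<open>D\<close>, and
      then their means in the same arrangement. For \<open>A e 1\<close>, the term with
      \<open>\<tau> * g e \<tau>\<close> contributes 2 and the one with
      \<open>\<tau>^2 * g' e \<tau>\<close> contributes -1.\<close>
    have "has_mean (\<lambda>\<tau>.
        (1 + Y * (\<tau> ^ 1 * cnj (g e \<tau>)) + Y * (\<tau> ^ 0 * g' e \<tau>) + Y ^ 2 * (\<tau> * cnj (g e \<tau>) * g' e \<tau>)) +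
        (D * V + D * Y * \<tau> ^ 1 + D * Y ^ 2 * (\<tau> ^ 0 * g e \<tau>) + D * Y ^ 2 * (\<tau> ^ 2 * cnj (g e \<tau>)) + D * Y ^ 2 * (\<tau> ^ 1 * g' e \<tau>)
          + D * V * Y * (\<tau> ^ 1 * cnj (g e \<tau>)) + D * V * Y * (\<tau> ^ 0 * g' e \<tau>)) +
        (D ^ 2 * V ^ 2 + D ^ 2 * Y ^ 2 * \<tau> ^ 2 + 2 * D ^ 2 * Y * V * \<tau> ^ 1
          + D ^ 2 * Y ^ 3 * (\<tau> ^ 3 * cnj (g e \<tau>)) + D ^ 2 * Y ^ 3 * (\<tau> ^ 2 * g' e \<tau>)
          + 2 * D ^ 2 * Y ^ 2 * V * (\<tau> ^ 2 * cnj (g e \<tau>)) + 2 * D ^ 2 * Y ^ 2 * V * (\<tau> ^ 1 * g' e \<tau>)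
          + D ^ 2 * V ^ 2 * Y * (\<tau> ^ 1 * cnj (g e \<tau>)) + D ^ 2 * V ^ 2 * Y * (\<tau> ^ 0 * g' e \<tau>)
          + 2 * D ^ 2 * Y ^ 3 * (\<tau> ^ 1 * g e \<tau>) + 2 * D ^ 2 * Y ^ 2 * V * (\<tau> ^ 0 * g e \<tau>)) +
        (D ^ 3 * V ^ 3 + D ^ 3 * Y ^ 3 * \<tau> ^ 3 + 3 * D ^ 3 * Y ^ 2 * V * \<tau> ^ 2 + 3 * D ^ 3 * Y * V ^ 2 * \<tau> ^ 1) +
        (D ^ 4 * V ^ 4 + D ^ 4 * Y ^ 4 * \<tau> ^ 4 + 4 * D ^ 4 * Y ^ 3 * V * \<tau> ^ 3 + 6 * D ^ 4 * Y ^ 2 * V ^ 2 * \<tau> ^ 2 + 4 * D ^ 4 * Y * V ^ 3 * \<tau> ^ 1))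
       ((1 + Y * 0 + Y * (if (0::nat) < 2 then 0 else - (of_nat 0 - 1) * A e (0 - 1)) + Y ^ 2 * \<mu> e) +
        (D * V + D * Y * 0 + D * Y ^ 2 * (if (0::nat) = 0 then 0 else A e 0) + D * Y ^ 2 * 0 + D * Y ^ 2 * (if (1::nat) < 2 then 0 else - (of_nat 1 - 1) * A e (1 - 1))
          + D * V * Y * 0 + D * V * Y * (if (0::nat) < 2 then 0 else - (of_nat 0 - 1) * A e (0 - 1))) +
        (D ^ 2 * V ^ 2 + D ^ 2 * Y ^ 2 * 0 + 2 * D ^ 2 * Y * V * 0
          + D ^ 2 * Y ^ 3 * 0 + D ^ 2 * Y ^ 3 * (if (2::nat) < 2 then 0 else - (of_nat 2 - 1) * A e (2 - 1))
          + 2 * D ^ 2 * Y ^ 2 * V * 0 + 2 * D ^ 2 * Y ^ 2 * V * (if (1::nat) < 2 then 0 else - (of_nat 1 - 1) * A e (1 - 1))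
          + D ^ 2 * V ^ 2 * Y * 0 + D ^ 2 * V ^ 2 * Y * (if (0::nat) < 2 then 0 else - (of_nat 0 - 1) * A e (0 - 1))
          + 2 * D ^ 2 * Y ^ 3 * (if (1::nat) = 0 then 0 else A e 1) + 2 * D ^ 2 * Y ^ 2 * V * (if (0::nat) = 0 then 0 else A e 0)) +
        (D ^ 3 * V ^ 3 + D ^ 3 * Y ^ 3 * 0 + 3 * D ^ 3 * Y ^ 2 * V * 0 + 3 * D ^ 3 * Y * V ^ 2 * 0) +
        (D ^ 4 * V ^ 4 + D ^ 4 * Y ^ 4 * 0 + 4 * D ^ 4 * Y ^ 3 * V * 0 + 6 * D ^ 4 * Y ^ 2 * V ^ 2 * 0 + 4 * D ^ 4 * Y * V ^ 3 * 0))"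
      (is "has_mean ?T ?m")
      by (intro has_mean_add has_mean_cmult has_mean_const has_mean_power mg mg' mc m\<mu>) auto
    moreover have "?m = 1 + Y ^ 2 * \<mu> e + D * V + D ^ 2 * (V ^ 2 + Y ^ 3 * A e 1) + D ^ 3 * V ^ 3 + D ^ 4 * V ^ 4"
      by (simp add: algebra_simps)
    ultimately have "has_mean (\<lambda>\<tau>. D * ?T \<tau>) (D * (1 + Y ^ 2 * \<mu> e + D * V + D ^ 2 * (V ^ 2 + Y ^ 3 * A e 1) + D ^ 3 * V ^ 3 + D ^ 4 * V ^ 4))"
      by (intro has_mean_cmult) (simp only:)
    moreover have "D * (1 + Y ^ 2 * \<mu> e + D * V + D ^ 2 * (V ^ 2 + Y ^ 3 * A e 1) + D ^ 3 * V ^ 3 + D ^ 4 * V ^ 4) = m e w"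
      unfolding m_def Y_def[symmetric] V_def[symmetric] by algebra
    moreover have "D * ?T \<tau> = T e (\<tau>, w)" for \<tau>
      unfolding T_def \<rho>_def s_def a_def a'_def z0_def fst_conv snd_conv Y_def[symmetric] V_def[symmetric] by algebra
    ultimately show ?thesis by simp
  qed
  have "unif_bigo unit_circle 5 (\<lambda>e w. - mean_circle (H e w) - m e w)"
  proof (rule unif_bigo_circle_mean[OF OE])
    show "\<forall>\<^sub>F e in at 0. \<forall>w\<in>unit_circle. has_mean (\<lambda>\<tau>. E e (\<tau>, w)) (- mean_circle (H e w) - m e w)"
      using es small
    proof eventually_elim
      case (elim e)
      show ?case
      proof
        fix w :: complex assume w: "w \<in> unit_circle"
        have sm: "cmod (- (D * z e (\<tau>, w))) < 1" if "\<tau> \<in> unit_circle" for \<tau>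
          using bspec[OF elim(2), of "(\<tau>, w)"] that w by simp
        note h = exterior_seriesD[OF elim(1)]
        have "continuous_on unit_circle (\<lambda>\<tau>. \<rho> e (\<tau>, w) * D * I e (\<tau>, w))"
          unfolding I_def \<rho>_def s_def a'_def z_def z0_def a_def fst_conv snd_conv
          by (intro continuous_intros h) (use nz[OF sm] in \<open>auto simp: z_def z0_def a_def\<close>)
        then have hm: "has_mean (\<lambda>\<tau>. \<rho> e (\<tau>, w) * D * I e (\<tau>, w)) (circle_mean (\<lambda>\<tau>. \<rho> e (\<tau>, w) * D * I e (\<tau>, w)))" (is "has_mean _ ?c")
          by (rule has_mean_continuous)
        have "has_mean (\<lambda>\<tau>. H e w \<tau> * \<tau>) (- ?c)"
        proof (rule has_mean_cong[OF has_mean_neg[OF hm]])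
          show "- (\<rho> e (\<tau>, w) * D * I e (\<tau>, w)) = H e w \<tau> * \<tau>" if "\<tau> \<in> unit_circle" for \<tau>
            unfolding H_eq[OF that sm[OF that], symmetric] by simp
        qed
        then have "mean_circle (H e w) = - ?c" by (rule mean_circle_eq)
        then have "has_mean (\<lambda>\<tau>. \<rho> e (\<tau>, w) * D * I e (\<tau>, w) - T e (\<tau>, w)) (- mean_circle (H e w) - m e w)"
          using has_mean_diff[OF hm MT[OF elim(1), of w]] by simp
        then show "has_mean (\<lambda>\<tau>. E e (\<tau>, w)) (- mean_circle (H e w) - m e w)"
          by (rule has_mean_cong) (simp only: E_eq[OF sm])
      qed
    qed
  qed
  then show ?thesis unfolding H_def m_def \<mu>_def .
qed


text \<open>The mean is the signed area \<open>- \<Sum> n A\<^sub>n\<^sup>2\<close>, of which only the first coefficient matters.\<close>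

lemma area_mean_expansion:
  fixes g g' :: "real \<Rightarrow> complex \<Rightarrow> complex" and p1 p2 :: "real \<Rightarrow> real" and A :: "real \<Rightarrow> nat \<Rightarrow> real"
  assumes es: "\<forall>\<^sub>F e in at 0. exterior_series (g e) (g' e) (A e)"
    and g': "unif_bigo unit_circle 1 g'"
    and p1: "\<And>(S :: complex set). unif_bigo S 1 (\<lambda>e i. of_real (p1 e))"
    and p2: "\<And>(S :: complex set). unif_bigo S 2 (\<lambda>e i. of_real (p2 e))"
    and r: "unif_bigo unit_circle 3 (\<lambda>e w. g e w - (of_real (p1 e) * cnj w + of_real (p2 e) * cnj w ^ 2))"
  shows "unif_bigo unit_circle 4 (\<lambda>e w. circle_mean (\<lambda>\<tau>. \<tau> * cnj (g e \<tau>) * g' e \<tau>) + of_real (p1 e) ^ 2)"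
    and "unif_bigo unit_circle 3 (\<lambda>e w. of_real (A e 1) - of_real (p1 e))"
proof -
  define P1 where "P1 e = complex_of_real (p1 e)" for e
  define P2 where "P2 e = complex_of_real (p2 e)" for e
  define r where "r e w = g e w - (P1 e * cnj w + P2 e * cnj w ^ 2)" for e w
  define E where "E e p = fst p * cnj (r e (fst p)) * g' e (fst p)" for e and p :: "complex \<times> complex"
  define cE where "cE e w = circle_mean (\<lambda>\<tau>. E e (\<tau>, w))" for e w
  note O = unif_bigo_intros and OP = p1[folded P1_def] p2[folded P2_def]
  have Or: "unif_bigo unit_circle 3 r" using r unfolding r_def P1_def P2_def .
  have mP: "has_mean (\<lambda>\<tau>. \<tau> ^ 1 * (P1 e * cnj \<tau> + P2 e * cnj \<tau> ^ 2)) (P1 e)"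
    "has_mean (\<lambda>\<tau>. \<tau> ^ 2 * (P1 e * cnj \<tau> + P2 e * cnj \<tau> ^ 2)) (P2 e)" for e
  proof -
    have "has_mean (\<lambda>\<tau>. P1 e + P2 e * cnj \<tau> ^ 1) (P1 e + P2 e * 0)"
      by (intro has_mean_add has_mean_cmult has_mean_const has_mean_power) auto
    moreover have "P1 e + P2 e * cnj \<tau> ^ 1 = \<tau> ^ 1 * (P1 e * cnj \<tau> + P2 e * cnj \<tau> ^ 2)" if "\<tau> \<in> unit_circle" for \<tau>
      using circle_mult_cnj[OF that] by algebra
    ultimately show "has_mean (\<lambda>\<tau>. \<tau> ^ 1 * (P1 e * cnj \<tau> + P2 e * cnj \<tau> ^ 2)) (P1 e)"
      using has_mean_cong by fastforce
    have "has_mean (\<lambda>\<tau>. P1 e * \<tau> ^ 1 + P2 e) (P1 e * 0 + P2 e)"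
      by (intro has_mean_add has_mean_cmult has_mean_const has_mean_power) auto
    moreover have "P1 e * \<tau> ^ 1 + P2 e = \<tau> ^ 2 * (P1 e * cnj \<tau> + P2 e * cnj \<tau> ^ 2)" if "\<tau> \<in> unit_circle" for \<tau>
      using circle_mult_cnj[OF that] by algebra
    ultimately show "has_mean (\<lambda>\<tau>. \<tau> ^ 2 * (P1 e * cnj \<tau> + P2 e * cnj \<tau> ^ 2)) (P2 e)"
      using has_mean_cong by fastforce
  qed
  have mg: "has_mean (\<lambda>\<tau>. \<tau> ^ n * g e \<tau>) (A e n)" if "exterior_series (g e) (g' e) (A e)" "n \<noteq> 0" for e n
    using has_mean_power_mult_fourier(1)[OF exterior_seriesD(4)[OF that(1)], of n] that(2)
    by (auto simp: fourier_exterior_series[OF that(1)])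
  have Or': "unif_bigo (unit_circle \<times> unit_circle) 3 (\<lambda>e p. fst p ^ n * r e (fst p))" for n
    by (rule unif_bigo_mono, (rule O unif_bigo_fst[OF Or])+) simp
  have mr: "has_mean (\<lambda>\<tau>. \<tau> ^ n * r e \<tau>) (of_real (A e n) - c)"
    if "exterior_series (g e) (g' e) (A e)" "n \<noteq> 0" "has_mean (\<lambda>\<tau>. \<tau> ^ n * (P1 e * cnj \<tau> + P2 e * cnj \<tau> ^ 2)) c" for e n and c :: complex
    using has_mean_diff[OF mg[OF that(1,2)] that(3)] unfolding r_def right_diff_distrib .
  have OA1: "unif_bigo unit_circle 3 (\<lambda>e w. of_real (A e 1) - P1 e)"
    by (rule unif_bigo_circle_mean[OF Or'[of 1]], rule eventually_mono[OF es]) (use mr[OF _ _ mP(1)] in auto)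
  have OA2: "unif_bigo unit_circle 3 (\<lambda>e w. of_real (A e 2) - P2 e)"
    by (rule unif_bigo_circle_mean[OF Or'[of 2]], rule eventually_mono[OF es]) (use mr[OF _ _ mP(2)] in auto)
  have OE: "unif_bigo (unit_circle \<times> unit_circle) 4 E"
    unfolding E_def by (rule unif_bigo_mono, (rule O unif_bigo_fst[OF Or] unif_bigo_fst[OF g'])+) simp
  have mE: "has_mean (\<lambda>\<tau>. E e (\<tau>, w)) (cE e w)" if "exterior_series (g e) (g' e) (A e)" for e w
    unfolding cE_def E_def fst_conv r_def
    by (intro has_mean_continuous continuous_intros exterior_seriesD[OF that])
  have OcE: "unif_bigo unit_circle 4 cE"
    by (rule unif_bigo_circle_mean[OF OE], rule eventually_mono[OF es]) (use mE in auto)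
  \<comment> \<open>\<open>A e 2\<close> is split into its deviation from \<open>P2\<close> and
    \<open>P2\<close>, both of order at least two, which makes the last product of order
    four.\<close>
  have "unif_bigo unit_circle 4 (\<lambda>e w. cE e w - P1 e * (of_real (A e 1) - P1 e)
      - 2 * P2 e * ((of_real (A e 2) - P2 e) + P2 e))"
    by (rule unif_bigo_mono, (rule OcE OA1 OA2 OP O)+) simp
  then show "unif_bigo unit_circle 4 (\<lambda>e w. circle_mean (\<lambda>\<tau>. \<tau> * cnj (g e \<tau>) * g' e \<tau>) + of_real (p1 e) ^ 2)"
  proof (rule unif_bigo_cong, intro eventually_mono[OF es] ballI)
    fix e and w :: complex assume e: "exterior_series (g e) (g' e) (A e)"
    note h = has_mean_power_mult_fourier(1)[OF exterior_seriesD(1)[OF e]]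
    have h2: "has_mean (\<lambda>\<tau>. \<tau> ^ 2 * g' e \<tau>) (- A e 1)" "has_mean (\<lambda>\<tau>. \<tau> ^ 3 * g' e \<tau>) (- 2 * A e 2)"
      using h[of 2] h[of 3] by (simp_all add: fourier_exterior_series[OF e] fourier_derivative[OF e])
    have "has_mean (\<lambda>\<tau>. E e (\<tau>, w) + (P1 e * (\<tau> ^ 2 * g' e \<tau>) + P2 e * (\<tau> ^ 3 * g' e \<tau>)))
        (cE e w + (P1 e * (- A e 1) + P2 e * (- 2 * A e 2)))"
      using mE[OF e] h2 by (intro has_mean_add has_mean_cmult) auto
    then have "has_mean (\<lambda>\<tau>. \<tau> * cnj (g e \<tau>) * g' e \<tau>) (cE e w + (P1 e * (- A e 1) + P2 e * (- 2 * A e 2)))"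
    proof (rule has_mean_cong)
      fix \<tau>
      have "cnj (g e \<tau>) = cnj (r e \<tau>) + (P1 e * \<tau> + P2 e * \<tau> ^ 2)"
        unfolding r_def P1_def P2_def by simp
      then show "E e (\<tau>, w) + (P1 e * (\<tau> ^ 2 * g' e \<tau>) + P2 e * (\<tau> ^ 3 * g' e \<tau>)) = \<tau> * cnj (g e \<tau>) * g' e \<tau>"
        unfolding E_def fst_conv by algebra
    qed
    from has_mean_unique[OF this]
    show "circle_mean (\<lambda>\<tau>. \<tau> * cnj (g e \<tau>) * g' e \<tau>) + of_real (p1 e) ^ 2
       = cE e w - P1 e * (of_real (A e 1) - P1 e) - 2 * P2 e * ((of_real (A e 2) - P2 e) + P2 e)"
      unfolding P1_def[symmetric] by (simp add: algebra_simps power2_eq_square)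
  qed
  show "unif_bigo unit_circle 3 (\<lambda>e w. of_real (A e 1) - of_real (p1 e))"
    using OA1 unfolding P1_def .
qed

section \<open>The equation for one domain\<close>

text \<open>The counterpart of \<open>unif_bigo\<close> for the square mean. It is preserved by
  scalars and by powers of \<open>w\<close> only, not by products of functions. Continuity is
  included because the rules for Fourier coefficients ask for it.\<close>

definition l2_bigo :: "nat \<Rightarrow> (real \<Rightarrow> complex \<Rightarrow> complex) \<Rightarrow> bool" where
  "l2_bigo n h \<longleftrightarrow> (\<exists>C. \<forall>\<^sub>F e in at 0. continuous_on unit_circle (h e) \<and> fourier_l2_le (h e) (C * \<bar>e\<bar> ^ n))"

lemma l2_bigo_unif_bigo:
  assumes "unif_bigo unit_circle n h" "\<forall>\<^sub>F e in at 0. continuous_on unit_circle (h e)"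
  shows "l2_bigo n h"
proof -
  obtain C where "\<forall>\<^sub>F e in at 0. \<forall>w\<in>unit_circle. cmod (h e w) \<le> C * \<bar>e\<bar> ^ n"
    using unif_bigoE[OF assms(1)] .
  with assms(2) have "\<forall>\<^sub>F e in at 0. continuous_on unit_circle (h e) \<and> fourier_l2_le (h e) (C * \<bar>e\<bar> ^ n)"
    by eventually_elim (auto intro: fourier_l2_le_sup)
  then show ?thesis unfolding l2_bigo_def by blast
qed

lemma l2_bigo_continuous: "l2_bigo n h \<Longrightarrow> \<forall>\<^sub>F e in at 0. continuous_on unit_circle (h e)"
  unfolding l2_bigo_def by (auto elim: eventually_mono)

lemma l2_bigo_add:
  assumes "l2_bigo n h" "l2_bigo n g"
  shows "l2_bigo n (\<lambda>e w. h e w + g e w)"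
proof -
  obtain C where C: "\<forall>\<^sub>F e in at 0. continuous_on unit_circle (h e) \<and> fourier_l2_le (h e) (C * \<bar>e\<bar> ^ n)"
    using assms(1) unfolding l2_bigo_def by blast
  obtain D where D: "\<forall>\<^sub>F e in at 0. continuous_on unit_circle (g e) \<and> fourier_l2_le (g e) (D * \<bar>e\<bar> ^ n)"
    using assms(2) unfolding l2_bigo_def by blast
  have "\<forall>\<^sub>F e in at 0. continuous_on unit_circle (\<lambda>w. h e w + g e w)
      \<and> fourier_l2_le (\<lambda>w. h e w + g e w) ((C + D) * \<bar>e\<bar> ^ n)"
    using C D unfolding distrib_right
    by eventually_elim (auto intro: fourier_l2_le_add continuous_on_add)
  then show ?thesis unfolding l2_bigo_def by blast
qed

lemma l2_bigo_scalar_mult: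
  assumes "l2_bigo n h" "unif_bigo unit_circle m (\<lambda>e w. s e)"
  shows "l2_bigo (m + n) (\<lambda>e w. s e * h e w)"
proof -
  obtain C where C: "\<forall>\<^sub>F e in at 0. continuous_on unit_circle (h e) \<and> fourier_l2_le (h e) (C * \<bar>e\<bar> ^ n)"
    using assms(1) unfolding l2_bigo_def by blast
  obtain D where D: "0 \<le> D" "\<forall>\<^sub>F e in at 0. \<forall>w\<in>unit_circle. cmod (s e) \<le> D * \<bar>e\<bar> ^ m"
    using unif_bigoE[OF assms(2)] .
  have "\<forall>\<^sub>F e in at 0. continuous_on unit_circle (\<lambda>w. s e * h e w)
      \<and> fourier_l2_le (\<lambda>w. s e * h e w) ((D * C) * \<bar>e\<bar> ^ (m + n))"
    using C D(2)
  proof eventually_elim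
    case (elim e)
    have S: "0 \<le> C * \<bar>e\<bar> ^ n" using order_trans[OF norm_ge_zero fourier_l2_le_coeff[OF elim(1)[THEN conjunct2]]] .
    have "cmod (s e) \<le> D * \<bar>e\<bar> ^ m" using bspec[OF elim(2), of 1] by simp
    then have "cmod (s e) * (C * \<bar>e\<bar> ^ n) \<le> (D * \<bar>e\<bar> ^ m) * (C * \<bar>e\<bar> ^ n)"
      using S by (rule mult_right_mono)
    also have "\<dots> = (D * C) * \<bar>e\<bar> ^ (m + n)" by (simp add: power_add)
    finally have "cmod (s e) * (C * \<bar>e\<bar> ^ n) \<le> (D * C) * \<bar>e\<bar> ^ (m + n)" .
    then show ?case
      using elim(1) by (auto intro: continuous_on_mult_left fourier_l2_le_mono[OF fourier_l2_le_cmult])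
  qed
  then show ?thesis unfolding l2_bigo_def by blast
qed

lemma l2_bigo_power_mult:
  assumes "l2_bigo n h"
  shows "l2_bigo n (\<lambda>e w. w ^ m * h e w)"
proof -
  obtain C where C: "\<forall>\<^sub>F e in at 0. continuous_on unit_circle (h e) \<and> fourier_l2_le (h e) (C * \<bar>e\<bar> ^ n)"
    using assms(1) unfolding l2_bigo_def by blast
  have "\<forall>\<^sub>F e in at 0. continuous_on unit_circle (\<lambda>w. w ^ m * h e w)
      \<and> fourier_l2_le (\<lambda>w. w ^ m * h e w) (C * \<bar>e\<bar> ^ n)"
    using C
  proof eventually_elim
    case (elim e)
    have "continuous_on unit_circle (\<lambda>w. w ^ m * h e w)"
      by (intro continuous_intros conjunct1[OF elim])
    then show ?case using elim fourier_l2_le_shift[of "h e" _ "int m"] by simp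
  qed
  then show ?thesis unfolding l2_bigo_def by blast
qed

lemma l2_bigo_Im:
  assumes "l2_bigo n h"
  shows "l2_bigo n (\<lambda>e w. complex_of_real (Im (h e w)))"
proof -
  obtain C where C: "\<forall>\<^sub>F e in at 0. continuous_on unit_circle (h e) \<and> fourier_l2_le (h e) (C * \<bar>e\<bar> ^ n)"
    using assms(1) unfolding l2_bigo_def by blast
  have "\<forall>\<^sub>F e in at 0. continuous_on unit_circle (\<lambda>w. complex_of_real (Im (h e w)))
      \<and> fourier_l2_le (\<lambda>w. complex_of_real (Im (h e w))) (C * \<bar>e\<bar> ^ n)"
    using C by eventually_elim (auto intro: continuous_on_of_real continuous_on_Im fourier_l2_le_Im)
  then show ?thesis unfolding l2_bigo_def by blast
qed

text \<open>The form in which \<open>exterior_series_inversion\<close> is used in both rounds: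
  integrating once brings \<open>r\<close> back to a uniform bound, while for \<open>r'\<close> the
  square mean is all that remains.\<close>

lemma l2_bigo_inversion:
  fixes a :: "real \<Rightarrow> real"
  assumes r: "\<forall>\<^sub>F e in at 0. exterior_series (r e) (r' e) (B e)" and h: "l2_bigo n h"
    and eq: "\<forall>\<^sub>F e in at 0. \<forall>w\<in>unit_circle. complex_of_real (Im (r' e w)) = a e * complex_of_real (Im w) + h e w"
  shows "unif_bigo unit_circle n (\<lambda>e w. complex_of_real (a e))" "unif_bigo unit_circle n r" "l2_bigo n r'"
proof -
  obtain C where C: "\<forall>\<^sub>F e in at 0. continuous_on unit_circle (h e) \<and> fourier_l2_le (h e) (C * \<bar>e\<bar> ^ n)"
    using h unfolding l2_bigo_def by blast
  obtain D where D: "0 \<le> D" "\<And>g g' A S w. exterior_series g g' A \<Longrightarrow> fourier_l2_le g' S \<Longrightarrow> w \<in> unit_circle \<Longrightarrow> cmod (g w) \<le> D * S"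
    using exterior_series_bounds by metis
  have inv: "\<forall>\<^sub>F e in at 0. \<bar>a e\<bar> \<le> 2 * (C * \<bar>e\<bar> ^ n) \<and> exterior_series (r e) (r' e) (B e) \<and> fourier_l2_le (r' e) (2 * (C * \<bar>e\<bar> ^ n))"
    using r C eq
    by eventually_elim (intro conjI exterior_series_inversion; auto)
  have "\<forall>\<^sub>F e in at 0. \<forall>w\<in>unit_circle. cmod (complex_of_real (a e)) \<le> (2 * C) * \<bar>e\<bar> ^ n"
    using inv by eventually_elim auto
  then show "unif_bigo unit_circle n (\<lambda>e w. complex_of_real (a e))" unfolding unif_bigo_def by blast
  have "\<forall>\<^sub>F e in at 0. \<forall>w\<in>unit_circle. cmod (r e w) \<le> (D * (2 * C)) * \<bar>e\<bar> ^ n"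
    using inv
  proof eventually_elim
    case (elim e)
    then have "cmod (r e w) \<le> D * (2 * (C * \<bar>e\<bar> ^ n))" if "w \<in> unit_circle" for w
      using D(2) that by blast
    then show ?case by (simp add: mult.assoc)
  qed
  then show "unif_bigo unit_circle n r" unfolding unif_bigo_def by blast
  have "\<forall>\<^sub>F e in at 0. continuous_on unit_circle (r' e) \<and> fourier_l2_le (r' e) ((2 * C) * \<bar>e\<bar> ^ n)"
    using inv by eventually_elim (auto simp: mult.assoc intro: exterior_seriesD)
  then show "l2_bigo n r'" unfolding l2_bigo_def by blast
qed

text \<open>The equation for one of the two domains, multiplied by \<open>w\<close>; \<open>c\<close> is \<open>-Z\<close> or \<open>Z - d\<close>.\<close>

locale vortex_side =
  fixes bj bi \<gamma>j \<gamma>i d :: real and \<Omega> c :: "real \<Rightarrow> real"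
    and f f' g g' :: "real \<Rightarrow> complex \<Rightarrow> complex" and A B :: "real \<Rightarrow> nat \<Rightarrow> real"
    and x y :: "real \<Rightarrow> complex" and D :: complex and v W :: "real \<Rightarrow> complex \<Rightarrow> complex"
  defines "x \<equiv> \<lambda>e. complex_of_real (e * bj)" and "y \<equiv> \<lambda>e. complex_of_real (e * bi)"
    and "D \<equiv> complex_of_real (1 / d)"
    and "v \<equiv> \<lambda>e w. x e * w + x e ^ 2 * f e w"
    and "W \<equiv> \<lambda>e w. 2 * complex_of_real (\<Omega> e) * (x e * (1 + x e * w * cnj (f e w)) + complex_of_real (c e) * w)
           - x e * complex_of_real \<gamma>j * singular_mean (x e) (f e) (f' e) w
           + complex_of_real \<gamma>i * w * (- mean_circle (\<lambda>\<tau>. (cnj \<tau> + y e * cnj (g e \<tau>)) * (1 + y e * g' e \<tau>)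
               / (y e * \<tau> + y e ^ 2 * g e \<tau> + v e w - complex_of_real d)))"
  assumes d: "d > 0" and \<gamma>j: "\<gamma>j \<noteq> 0"
    and es_f: "\<forall>\<^sub>F e in at 0. exterior_series (f e) (f' e) (A e)"
    and es_g: "\<forall>\<^sub>F e in at 0. exterior_series (g e) (g' e) (B e)"
    and f: "unif_bigo unit_circle 1 f" and f': "unif_bigo unit_circle 1 f'"
    and g: "unif_bigo unit_circle 1 g" and g': "unif_bigo unit_circle 1 g'"
    and \<Omega>: "unif_bigo unit_circle 0 (\<lambda>e w. complex_of_real (\<Omega> e))"
    and K: "unif_bigo unit_circle 1 (\<lambda>e w. complex_of_real (2 * \<Omega> e * c e + \<gamma>i / d))"
    and eq: "\<forall>\<^sub>F e in at 0. \<forall>w\<in>unit_circle. \<gamma>j * Im (f' e w) = Im (W e w * (1 + x e * f' e w))"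
begin

text \<open>\<open>p1\<close> and \<open>p2\<close> are chosen such that
  \<open>\<gamma>j * Im (P' e w) = Im (T e w)\<close> on the circle, with \<open>T\<close> as
  defined below: \<open>p1\<close> comes from the mode 2 and \<open>p2\<close> from the mode 3,
  where differentiation contributes a factor 2.\<close>

definition p1 :: "real \<Rightarrow> real" where "p1 e = \<gamma>i / \<gamma>j * (e * bj) / d ^ 2"
definition p2 :: "real \<Rightarrow> real" where "p2 e = \<gamma>i / \<gamma>j * (e * bj) ^ 2 / (2 * d ^ 3)"

abbreviation "P e w \<equiv> complex_of_real (p1 e) * cnj w + complex_of_real (p2 e) * cnj w ^ 2"
abbreviation "P' e w \<equiv> - complex_of_real (p1 e) * cnj w ^ 2 - 2 * complex_of_real (p2 e) * cnj w ^ 3"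
abbreviation "\<mu> e \<equiv> circle_mean (\<lambda>\<tau>. \<tau> * cnj (g e \<tau>) * g' e \<tau>)"

lemma p1_eq: "complex_of_real \<gamma>j * complex_of_real (p1 e) = complex_of_real \<gamma>i * x e * D ^ 2"
  and p2_eq: "2 * (complex_of_real \<gamma>j * complex_of_real (p2 e)) = complex_of_real \<gamma>i * x e ^ 2 * D ^ 3"
  unfolding p1_def p2_def x_def D_def using \<gamma>j by (simp_all add: power_divide)

lemma unif_bigo_x: "unif_bigo S 1 (\<lambda>e i. x e)" and unif_bigo_y: "unif_bigo S 1 (\<lambda>e i. y e)"
  unfolding x_def y_def by (rule unif_bigo_scaled_eps)+

lemma unif_bigo_p1: "unif_bigo S 1 (\<lambda>e i. complex_of_real (p1 e))"
proof -
  have "p1 e = e * (\<gamma>i / \<gamma>j * bj / d ^ 2)" for e unfolding p1_def by simp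
  then show ?thesis by (simp only: unif_bigo_scaled_eps)
qed

lemma unif_bigo_p2: "unif_bigo S 2 (\<lambda>e i. complex_of_real (p2 e))"
proof -
  have "complex_of_real (p2 e) = complex_of_real e ^ 2 * complex_of_real (\<gamma>i / \<gamma>j * bj ^ 2 / (2 * d ^ 3))" for e
    unfolding p2_def by (simp add: power_mult_distrib)
  then show ?thesis by (simp only:) (rule unif_bigo_mono, (rule unif_bigo_intros)+, simp)
qed

lemma unif_bigo_v: "unif_bigo unit_circle 1 v"
  unfolding v_def by (rule unif_bigo_mono, (rule unif_bigo_intros unif_bigo_x f)+) simp

lemmas O = unif_bigo_intros unif_bigo_x unif_bigo_y unif_bigo_p1 unif_bigo_p2 f f' \<Omega> unif_bigo_v

definition J :: "real \<Rightarrow> complex \<Rightarrow> complex" where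
  "J e w = - mean_circle (\<lambda>\<tau>. (cnj \<tau> + y e * cnj (g e \<tau>)) * (1 + y e * g' e \<tau>)
               / (y e * \<tau> + y e ^ 2 * g e \<tau> + v e w - complex_of_real d))"

definition J_rem :: "real \<Rightarrow> complex \<Rightarrow> complex" where
  "J_rem e w = J e w - ((1 + y e ^ 2 * \<mu> e) * D + v e w * D ^ 2
         + (v e w ^ 2 + y e ^ 3 * complex_of_real (B e 1)) * D ^ 3 + v e w ^ 3 * D ^ 4 + v e w ^ 4 * D ^ 5)"

lemma unif_bigo_J_rem: "unif_bigo unit_circle 5 J_rem"
  unfolding J_rem_def J_def y_def D_def
  by (rule interaction_mean_expansion[OF d es_g g g' unif_bigo_v])

lemma unif_bigo_\<mu>: "unif_bigo unit_circle 2 (\<lambda>e w. \<mu> e)"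
proof (rule unif_bigo_circle_mean)
  show "unif_bigo (unit_circle \<times> unit_circle) 2 (\<lambda>e p. fst p * cnj (g e (fst p)) * g' e (fst p))"
    by (rule unif_bigo_mono, (rule unif_bigo_intros unif_bigo_fst[OF g] unif_bigo_fst[OF g'])+) simp
  show "\<forall>\<^sub>F e in at 0. \<forall>w\<in>unit_circle. has_mean (\<lambda>\<tau>. fst (\<tau>, w) * cnj (g e (fst (\<tau>, w))) * g' e (fst (\<tau>, w))) (\<mu> e)"
    using es_g unfolding fst_conv
    by eventually_elim (intro ballI has_mean_continuous continuous_intros exterior_seriesD)
qed

lemma unif_bigo_B1: "unif_bigo unit_circle 1 (\<lambda>e w. complex_of_real (B e 1))"
proof (rule unif_bigo_circle_mean)
  show "unif_bigo (unit_circle \<times> unit_circle) 1 (\<lambda>e p. fst p ^ 1 * g e (fst p))"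
    by (rule unif_bigo_mono, (rule unif_bigo_intros unif_bigo_fst[OF g])+) simp
  show "\<forall>\<^sub>F e in at 0. \<forall>w\<in>unit_circle. has_mean (\<lambda>\<tau>. fst (\<tau>, w) ^ 1 * g e (fst (\<tau>, w))) (complex_of_real (B e 1))"
    using es_g
  proof eventually_elim
    case (elim e)
    show ?case
      using has_mean_power_mult_fourier(1)[OF exterior_seriesD(4)[OF elim], of 1]
      unfolding fourier_exterior_series[OF elim] by simp
  qed
qed

text \<open>The terms of \<open>W\<close> of order at most two, where \<open>2 \<Omega> c + \<gamma>i / d\<close> will turn out to be of order three.\<close>

definition T :: "real \<Rightarrow> complex \<Rightarrow> complex" where
  "T e w = 2 * complex_of_real (\<Omega> e) * x e + complex_of_real \<gamma>i * x e * w ^ 2 * D ^ 2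
     + complex_of_real \<gamma>i * x e ^ 2 * w ^ 3 * D ^ 3"

text \<open>An exact identity, used in both rounds. Every term in the outer bracket has order at
  least three.\<close>

lemma W_expansion:
  "W e w = complex_of_real (2 * \<Omega> e * c e + \<gamma>i / d) * w + T e w
     + (2 * complex_of_real (\<Omega> e) * x e ^ 2 * w * cnj (f e w)
        - x e * complex_of_real \<gamma>j * singular_mean (x e) (f e) (f' e) w
        + complex_of_real \<gamma>i * w * (y e ^ 2 * \<mu> e * D + x e ^ 2 * f e w * D ^ 2
            + (2 * x e ^ 3 * w * f e w + x e ^ 4 * f e w ^ 2 + y e ^ 3 * complex_of_real (B e 1)) * D ^ 3
            + v e w ^ 3 * D ^ 4 + v e w ^ 4 * D ^ 5 + J_rem e w))"
proof -
  have W: "W e w = 2 * complex_of_real (\<Omega> e) * (x e * (1 + x e * w * cnj (f e w)) + complex_of_real (c e) * w)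
           - x e * complex_of_real \<gamma>j * singular_mean (x e) (f e) (f' e) w
           + complex_of_real \<gamma>i * w * J e w"
    unfolding W_def J_def ..
  have J: "J e w = (1 + y e ^ 2 * \<mu> e) * D + v e w * D ^ 2
         + (v e w ^ 2 + y e ^ 3 * complex_of_real (B e 1)) * D ^ 3 + v e w ^ 3 * D ^ 4 + v e w ^ 4 * D ^ 5 + J_rem e w"
    unfolding J_rem_def by simp
  have K: "complex_of_real (2 * \<Omega> e * c e + \<gamma>i / d) = 2 * complex_of_real (\<Omega> e) * complex_of_real (c e) + complex_of_real \<gamma>i * D"
    unfolding D_def by simp
  have v: "v e w = x e * w + x e ^ 2 * f e w" unfolding v_def ..
  have v2: "v e w ^ 2 = x e ^ 2 * w ^ 2 + 2 * x e ^ 3 * w * f e w + x e ^ 4 * f e w ^ 2" unfolding v by algebra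
  show ?thesis unfolding W J K T_def v2 unfolding v by algebra
qed

lemma unif_bigo_singular_mean: "unif_bigo unit_circle 2 (\<lambda>e w. singular_mean (x e) (f e) (f' e) w)"
  unfolding x_def by (rule singular_mean_bigo[OF es_f f'])

lemma W_first_order:
  "unif_bigo unit_circle 3 (\<lambda>e w. W e w - complex_of_real (2 * \<Omega> e * c e + \<gamma>i / d) * w - T e w)"
proof -
  have "W e w - complex_of_real (2 * \<Omega> e * c e + \<gamma>i / d) * w - T e w
    = 2 * complex_of_real (\<Omega> e) * x e ^ 2 * w * cnj (f e w)
        - x e * complex_of_real \<gamma>j * singular_mean (x e) (f e) (f' e) w
        + complex_of_real \<gamma>i * w * (y e ^ 2 * \<mu> e * D + x e ^ 2 * f e w * D ^ 2
            + (2 * x e ^ 3 * w * f e w + x e ^ 4 * f e w ^ 2 + y e ^ 3 * complex_of_real (B e 1)) * D ^ 3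
            + v e w ^ 3 * D ^ 4 + v e w ^ 4 * D ^ 5 + J_rem e w)" for e w
    unfolding W_expansion by simp
  then show ?thesis
    by (simp only:) (rule unif_bigo_mono, (rule O unif_bigo_singular_mean unif_bigo_\<mu> unif_bigo_B1 unif_bigo_J_rem)+, simp)
qed

lemma unif_bigo_T: "unif_bigo unit_circle 1 T"
  unfolding T_def by (rule unif_bigo_mono, (rule O)+) simp

lemma unif_bigo_W: "unif_bigo unit_circle 1 W"
proof -
  have "unif_bigo unit_circle 1 (\<lambda>e w. (W e w - complex_of_real (2 * \<Omega> e * c e + \<gamma>i / d) * w - T e w)
      + complex_of_real (2 * \<Omega> e * c e + \<gamma>i / d) * w + T e w)"
    by (rule unif_bigo_mono, (rule W_first_order K unif_bigo_T O)+) simp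
  then show ?thesis by simp
qed

abbreviation "r e w \<equiv> f e w - P e w"
abbreviation "r' e w \<equiv> f' e w - P' e w"

lemma es_r: "\<forall>\<^sub>F e in at 0. exterior_series (r e) (r' e) (\<lambda>n. A e n - (if n = 1 then p1 e else if n = 2 then p2 e else 0))"
  using es_f by eventually_elim (rule exterior_series_diff[OF _ exterior_series_quadratic])

lemma Im_cnj_power: "Im (cnj w ^ n) = - Im (w ^ n)"
  by (metis complex_cnj_power cnj.sel(2))

lemma Im_of_real_mult: "Im (complex_of_real a * z) = a * Im z"
  by simp

text \<open>The first round. The constant term of \<open>T\<close> is real, and the others are
  compensated by \<open>P'\<close>; what is left is of order three, in \<open>W\<close> by
  \<open>W_first_order\<close> and in \<open>x f' W\<close> because each factor has order
  one.\<close>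

lemma first_order:
  "unif_bigo unit_circle 3 (\<lambda>e w. complex_of_real (2 * \<Omega> e * c e + \<gamma>i / d))"
  "unif_bigo unit_circle 3 r" "l2_bigo 3 r'"
proof -
  define K where "K e = 2 * \<Omega> e * c e + \<gamma>i / d" for e
  define h where "h e w = complex_of_real (Im (r' e w)) - (K e / \<gamma>j) * complex_of_real (Im w)" for e w
  \<comment> \<open>What \<open>W * (1 + x f')\<close> contains besides \<open>K w + T\<close>,
    divided by \<open>\<gamma>j\<close>; by the equation its imaginary part is
    \<open>h\<close>.\<close>
  define H where "H e w = complex_of_real (1 / \<gamma>j) * ((W e w - complex_of_real (K e) * w - T e w) + W e w * (x e * f' e w))" for e w
  have "unif_bigo unit_circle 3 H"
    unfolding H_def K_def by (rule unif_bigo_mono, (rule W_first_order unif_bigo_W O)+) simp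
  then have "unif_bigo unit_circle 3 (\<lambda>e w. complex_of_real (Im (H e w)))" by (rule unif_bigo_Im)
  then have Oh: "unif_bigo unit_circle 3 h"
  proof (rule unif_bigo_cong, intro eventually_mono[OF eq] ballI)
    fix e w assume e: "\<forall>w\<in>unit_circle. \<gamma>j * Im (f' e w) = Im (W e w * (1 + x e * f' e w))" and w: "w \<in> unit_circle"
    have ImT: "Im (T e w) = \<gamma>j * p1 e * Im (w ^ 2) + \<gamma>j * (2 * p2 e) * Im (w ^ 3)"
    proof -
      have "T e w = complex_of_real (2 * \<Omega> e * (e * bj)) + complex_of_real (\<gamma>j * p1 e) * w ^ 2 + complex_of_real (\<gamma>j * (2 * p2 e)) * w ^ 3"
        unfolding T_def using p1_eq[of e] p2_eq[of e] by (simp add: x_def algebra_simps)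
      then show ?thesis by simp
    qed
    have ImP': "Im (P' e w) = p1 e * Im (w ^ 2) + 2 * p2 e * Im (w ^ 3)"
    proof -
      have "P' e w = complex_of_real (- p1 e) * cnj w ^ 2 + complex_of_real (- (2 * p2 e)) * cnj w ^ 3" by simp
      then show ?thesis by (simp only: plus_complex.sel Im_of_real_mult Im_cnj_power)
    qed
    have "Im (H e w) = 1 / \<gamma>j * (Im (W e w * (1 + x e * f' e w)) - K e * Im w - Im (T e w))"
      unfolding H_def Im_of_real_mult by (simp add: algebra_simps)
    also have "Im (W e w * (1 + x e * f' e w)) = \<gamma>j * Im (f' e w)" using e w by simp
    finally have "Im (H e w) = Im (f' e w) - K e / \<gamma>j * Im w - Im (P' e w)"
      unfolding ImT ImP' using \<gamma>j by (simp add: field_simps)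
    then show "h e w = complex_of_real (Im (H e w))" unfolding h_def by simp
  qed
  have h: "l2_bigo 3 h"
  proof (rule l2_bigo_unif_bigo[OF Oh], rule eventually_mono[OF es_r])
    fix e assume "exterior_series (r e) (r' e) (\<lambda>n. A e n - (if n = 1 then p1 e else if n = 2 then p2 e else 0))"
    then have "continuous_on unit_circle (\<lambda>w. complex_of_real (Im (r' e w)))"
      by (intro continuous_on_of_real continuous_on_Im exterior_seriesD(1))
    then show "continuous_on unit_circle (h e)"
      unfolding h_def by (rule continuous_on_diff) (intro continuous_intros)
  qed
  have "\<forall>\<^sub>F e in at 0. \<forall>w\<in>unit_circle. complex_of_real (Im (r' e w)) = (K e / \<gamma>j) * complex_of_real (Im w) + h e w"
    unfolding h_def by simp
  note inv = l2_bigo_inversion[OF es_r h this]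
  show "unif_bigo unit_circle 3 r" "l2_bigo 3 r'" by (rule inv)+
  have "unif_bigo unit_circle 3 (\<lambda>e w. complex_of_real \<gamma>j * complex_of_real (K e / \<gamma>j))"
    by (rule unif_bigo_mono, (rule O inv(1))+) simp
  then show "unif_bigo unit_circle 3 (\<lambda>e w. complex_of_real (2 * \<Omega> e * c e + \<gamma>i / d))"
    using \<gamma>j unfolding K_def by simp
qed

end

section \<open>The second round for one domain\<close>

context vortex_side
begin

definition \<Omega>0 :: real where "\<Omega>0 = (\<gamma>j + \<gamma>i) / (2 * d ^ 2)"

text \<open>The next coefficients of \<open>f\<close>, and the contribution of the known terms to the mode \<open>1\<close>, as read off
  from the computation in \<open>Im_main_terms\<close> below.\<close>

definition s1 :: "real \<Rightarrow> real" where "s1 e = 4 * \<Omega>0 * (e * bj) ^ 2 * p1 e / \<gamma>j"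
definition s2 :: "real \<Rightarrow> real" where "s2 e = 3 * \<Omega>0 * (e * bj) ^ 2 * p2 e / \<gamma>j"
definition s3 :: "real \<Rightarrow> real" where "s3 e = \<gamma>i / \<gamma>j * (e * bj) ^ 3 / (3 * d ^ 4)"
definition s4 :: "real \<Rightarrow> real" where "s4 e = \<gamma>i / \<gamma>j * (e * bj) ^ 4 / (4 * d ^ 5)"
definition k1 :: "real \<Rightarrow> real" where "k1 e = \<gamma>i * (\<gamma>i / \<gamma>j) * (e * bj) ^ 4 / d ^ 5"

text \<open>The list adapts the four coefficients to \<open>exterior_series_poly\<close>; list
  positions start at 0, the modes at 1.\<close>

abbreviation "R e w \<equiv> (\<Sum>n=1..4. of_real ([s1 e, s2 e, s3 e, s4 e] ! (n - 1)) * cnj w ^ n)"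
abbreviation "R' e w \<equiv> (\<Sum>n=1..4. - (of_nat n * of_real ([s1 e, s2 e, s3 e, s4 e] ! (n - 1))) * cnj w ^ Suc n)"

lemma sum_1_4: "(\<Sum>n=1..4. h n) = h 1 + h 2 + h 3 + h 4" for h :: "nat \<Rightarrow> complex"
  by (simp add: eval_nat_numeral)

lemma R_eq: "R e w = of_real (s1 e) * cnj w + of_real (s2 e) * cnj w ^ 2
     + of_real (s3 e) * cnj w ^ 3 + of_real (s4 e) * cnj w ^ 4"
  unfolding sum_1_4 by simp

lemma Im_R': "Im (R' e w) = s1 e * Im (w ^ 2) + 2 * s2 e * Im (w ^ 3) + 3 * s3 e * Im (w ^ 4) + 4 * s4 e * Im (w ^ 5)"
proof -
  have "R' e w = of_real (- s1 e) * cnj w ^ 2 + of_real (- (2 * s2 e)) * cnj w ^ 3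
      + of_real (- (3 * s3 e)) * cnj w ^ 4 + of_real (- (4 * s4 e)) * cnj w ^ 5"
    unfolding sum_1_4 by (simp add: eval_nat_numeral)
  then show ?thesis by (simp only: plus_complex.sel Im_of_real_mult Im_cnj_power)
qed

lemma Im_P': "Im (P' e w) = p1 e * Im (w ^ 2) + 2 * p2 e * Im (w ^ 3)"
proof -
  have "P' e w = of_real (- p1 e) * cnj w ^ 2 + of_real (- (2 * p2 e)) * cnj w ^ 3" by simp
  then show ?thesis by (simp only: plus_complex.sel Im_of_real_mult Im_cnj_power)
qed

text \<open>The part of \<open>W\<close> known after the first round, apart from the multiple of
  \<open>w\<close>: \<open>f\<close> is replaced by \<open>P\<close>, the singular mean by its
  expansion and \<open>\<Omega>\<close> by \<open>\<Omega>0\<close>. Only the first summand keeps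
  \<open>\<Omega>\<close>, as it is real and disappears from the imaginary part.\<close>

definition N :: "real \<Rightarrow> complex \<Rightarrow> complex" where
  "N e w = 2 * of_real (\<Omega> e) * x e
     + 2 * of_real \<Omega>0 * x e ^ 2 * w * (of_real (p1 e) * w + of_real (p2 e) * w ^ 2)
     + x e * of_real \<gamma>j * (of_real (p1 e) ^ 2 + of_real (p1 e) * of_real (p2 e) * cnj w)
     + of_real \<gamma>i * w * ((x e * w + x e ^ 2 * P e w) * D ^ 2
         + (x e ^ 2 * w ^ 2 + 2 * x e ^ 3 * w * P e w) * D ^ 3 + x e ^ 3 * w ^ 3 * D ^ 4 + x e ^ 4 * w ^ 4 * D ^ 5)"

definition T0 :: "real \<Rightarrow> complex \<Rightarrow> complex" where
  "T0 e w = 2 * of_real \<Omega>0 * x e + of_real \<gamma>i * x e * w ^ 2 * D ^ 2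
     + of_real \<gamma>i * x e ^ 2 * w ^ 3 * D ^ 3"

text \<open>After reduction by \<open>w * cnj w = 1\<close> the left side is a trigonometric
  polynomial with real coefficients. Since \<open>Im (cnj w ^ n) = - Im (w ^ n)\<close>, opposite
  modes combine, for example to \<open>4 * \<Omega>0\<close> in the mode 2 and to
  \<open>6 * \<Omega>0\<close> in the mode 3.\<close>

lemma Im_main_terms:
  assumes "w \<in> unit_circle"
  shows "Im (N e w + x e * P' e w * T0 e w) = k1 e * Im w + \<gamma>j * Im (P' e w) + \<gamma>j * Im (R' e w)"
proof -
  define X Dr where "X = e * bj" and "Dr = 1 / d"
  have x: "x e = of_real X" unfolding x_def X_def ..
  have D: "D = of_real Dr" unfolding D_def Dr_def ..
  have wc: "w * cnj w = 1" by (rule circle_mult_cnj[OF assms])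
  have "N e w + x e * P' e w * T0 e w =
      of_real (2 * \<Omega> e * X + X * \<gamma>j * p1 e ^ 2)
    + of_real (\<gamma>i * X ^ 3 * p1 e * Dr ^ 3) * w
    + of_real (X * \<gamma>j * p1 e * p2 e - \<gamma>i * X ^ 2 * p2 e * Dr ^ 2) * cnj w ^ 1
    + of_real (2 * \<Omega>0 * X ^ 2 * p1 e + \<gamma>i * X * Dr ^ 2) * w ^ 2
    + of_real (- 2 * \<Omega>0 * X ^ 2 * p1 e) * cnj w ^ 2
    + of_real (2 * \<Omega>0 * X ^ 2 * p2 e + \<gamma>i * X ^ 2 * Dr ^ 3) * w ^ 3
    + of_real (- 4 * \<Omega>0 * X ^ 2 * p2 e) * cnj w ^ 3
    + of_real (\<gamma>i * X ^ 3 * Dr ^ 4) * w ^ 4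
    + of_real (\<gamma>i * X ^ 4 * Dr ^ 5) * w ^ 5"
    unfolding N_def T0_def x D of_real_add of_real_mult of_real_power of_real_diff of_real_minus of_real_numeral
    using wc by algebra
  then have "Im (N e w + x e * P' e w * T0 e w) =
      (\<gamma>i * X ^ 3 * p1 e * Dr ^ 3) * Im w
    - (X * \<gamma>j * p1 e * p2 e - \<gamma>i * X ^ 2 * p2 e * Dr ^ 2) * Im w
    + (4 * \<Omega>0 * X ^ 2 * p1 e + \<gamma>i * X * Dr ^ 2) * Im (w ^ 2)
    + (6 * \<Omega>0 * X ^ 2 * p2 e + \<gamma>i * X ^ 2 * Dr ^ 3) * Im (w ^ 3)
    + (\<gamma>i * X ^ 3 * Dr ^ 4) * Im (w ^ 4)
    + (\<gamma>i * X ^ 4 * Dr ^ 5) * Im (w ^ 5)"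
    by (simp only: plus_complex.sel Im_of_real_mult Im_cnj_power Im_complex_of_real power_one_right) (simp add: algebra_simps)
  \<comment> \<open>Comparison of coefficients for the modes 2 to 5; this is where the values of
    \<open>s1\<close> to \<open>s4\<close> come from, and the mode 1 below gives
    \<open>k1\<close>.\<close>
  moreover have "\<gamma>i * X * Dr ^ 2 = \<gamma>j * p1 e" "\<gamma>i * X ^ 2 * Dr ^ 3 = \<gamma>j * (2 * p2 e)"
    "4 * \<Omega>0 * X ^ 2 * p1 e = \<gamma>j * s1 e" "6 * \<Omega>0 * X ^ 2 * p2 e = \<gamma>j * (2 * s2 e)"
    "\<gamma>i * X ^ 3 * Dr ^ 4 = \<gamma>j * (3 * s3 e)" "\<gamma>i * X ^ 4 * Dr ^ 5 = \<gamma>j * (4 * s4 e)"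
    unfolding p1_def p2_def s1_def s2_def s3_def s4_def X_def[symmetric] Dr_def using \<gamma>j d
    by (simp_all add: power_divide)
  moreover have "\<gamma>i * X ^ 3 * p1 e * Dr ^ 3 - (X * \<gamma>j * p1 e * p2 e - \<gamma>i * X ^ 2 * p2 e * Dr ^ 2) = k1 e"
    unfolding p1_def p2_def k1_def X_def[symmetric] Dr_def using \<gamma>j d
    by (simp add: power_divide field_simps eval_nat_numeral)
  ultimately show ?thesis
    unfolding Im_P' Im_R' by algebra
qed

text \<open>\<open>q1\<close> and \<open>q2\<close> describe the first round of the other domain,
  which enters only through its area and its first coefficient. Both of these contribute multiples
  of \<open>w\<close>, so that they change the mode 1 alone.\<close>

lemma W_second_order:
  assumes \<Omega>': "unif_bigo unit_circle 3 (\<lambda>e w. of_real (\<Omega> e) - of_real \<Omega>0)"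
    and q1: "\<And>(S :: complex set). unif_bigo S 1 (\<lambda>e i. of_real (q1 e))"
    and q2: "\<And>(S :: complex set). unif_bigo S 2 (\<lambda>e i. of_real (q2 e))"
    and q: "unif_bigo unit_circle 3 (\<lambda>e w. g e w - (of_real (q1 e) * cnj w + of_real (q2 e) * cnj w ^ 2))"
  shows "unif_bigo unit_circle 5 (\<lambda>e w. W e w
      - of_real (2 * \<Omega> e * c e + \<gamma>i / d * (1 - (e * bi) ^ 2 * q1 e ^ 2) + \<gamma>i * (e * bi) ^ 3 * q1 e / d ^ 3) * w - N e w)"
    (is "unif_bigo _ _ ?L")
proof -
  define O0 P1 P2 Q1 G H where "O0 = complex_of_real \<Omega>0" and "P1 e = complex_of_real (p1 e)"
    and "P2 e = complex_of_real (p2 e)" and "Q1 e = complex_of_real (q1 e)"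
    and "G = complex_of_real \<gamma>j" and "H = complex_of_real \<gamma>i" for e
  define rr where "rr e w = f e w - (P1 e * cnj w + P2 e * cnj w ^ 2)" for e w
  define ss where "ss e w = - singular_mean (x e) (f e) (f' e) w - (P1 e ^ 2 + P1 e * P2 e * cnj w)" for e w
  have Orr: "unif_bigo unit_circle 3 rr" using first_order(2) unfolding rr_def P1_def P2_def .
  obtain C where C: "\<forall>\<^sub>F e in at 0. continuous_on unit_circle (r' e) \<and> fourier_l2_le (r' e) (C * \<bar>e\<bar> ^ 3)"
    using first_order(3) unfolding l2_bigo_def by blast
  have Oss: "unif_bigo unit_circle 4 ss"
    unfolding ss_def x_def P1_def P2_def
    by (rule singular_mean_expansion[OF es_f f' unif_bigo_p1 unif_bigo_p1 unif_bigo_p2 unif_bigo_p2, where C = C])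
       (use C in \<open>auto elim: eventually_mono\<close>)
  note OQ = q1[folded Q1_def] and OP = unif_bigo_p1[folded P1_def] unif_bigo_p2[folded P2_def]
  note area = area_mean_expansion[OF es_g g' q1 q2 q, folded Q1_def]
  \<comment> \<open>The list of everything discarded. The powers \<open>v ^ 3\<close> and
    \<open>v ^ 4\<close> lose their leading monomials in \<open>w\<close>, and the factors that
    remain bring each term to order five.\<close>
  have "unif_bigo unit_circle 5 (\<lambda>e w. 2 * (of_real (\<Omega> e) - O0) * x e ^ 2 * w * cnj (f e w)
      + 2 * O0 * x e ^ 2 * w * cnj (rr e w) + x e * G * ss e w
      + H * w * (y e ^ 2 * (\<mu> e + Q1 e ^ 2) * D + x e ^ 2 * rr e w * D ^ 2
         + (2 * x e ^ 3 * w * rr e w + x e ^ 4 * f e w ^ 2 + y e ^ 3 * (of_real (B e 1) - Q1 e)) * D ^ 3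
         + (x e ^ 2 * f e w) * (3 * x e ^ 2 * w ^ 2 + 3 * x e ^ 3 * w * f e w + x e ^ 4 * f e w ^ 2) * D ^ 4
         + (x e ^ 2 * f e w) * (4 * x e ^ 3 * w ^ 3 + 6 * x e ^ 4 * w ^ 2 * f e w + 4 * x e ^ 5 * w * f e w ^ 2 + x e ^ 6 * f e w ^ 3) * D ^ 5
         + J_rem e w))"
    (is "unif_bigo _ _ ?E")
    by (rule unif_bigo_mono, (rule \<Omega>'[folded O0_def] Orr Oss OQ OP area O unif_bigo_J_rem)+) simp
  then show ?thesis
  proof (rule unif_bigo_cong, intro always_eventually allI ballI)
    fix e and w :: complex assume w: "w \<in> unit_circle"
    have K: "of_real (2 * \<Omega> e * c e + \<gamma>i / d * (1 - (e * bi) ^ 2 * q1 e ^ 2) + \<gamma>i * (e * bi) ^ 3 * q1 e / d ^ 3)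
      = of_real (2 * \<Omega> e * c e + \<gamma>i / d) - H * D * y e ^ 2 * Q1 e ^ 2 + H * y e ^ 3 * Q1 e * D ^ 3"
      unfolding H_def D_def y_def Q1_def by (simp add: power_divide right_diff_distrib)
    have cf: "cnj (f e w) = P1 e * w + P2 e * w ^ 2 + cnj (rr e w)"
      unfolding rr_def P1_def P2_def by simp
    have v: "v e w = x e * w + x e ^ 2 * f e w" unfolding v_def ..
    have v3: "v e w ^ 3 = x e ^ 3 * w ^ 3 + (x e ^ 2 * f e w) * (3 * x e ^ 2 * w ^ 2 + 3 * x e ^ 3 * w * f e w + x e ^ 4 * f e w ^ 2)"
      unfolding v by algebra
    have v4: "v e w ^ 4 = x e ^ 4 * w ^ 4 + (x e ^ 2 * f e w) * (4 * x e ^ 3 * w ^ 3 + 6 * x e ^ 4 * w ^ 2 * f e w + 4 * x e ^ 5 * w * f e w ^ 2 + x e ^ 6 * f e w ^ 3)"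
      unfolding v by algebra
    \<comment> \<open>Names for the nonlinear expressions, which turn the identity into one between
      polynomials in few unknowns.\<close>
    define V3 V4 F2 CF SM where "V3 = (x e ^ 2 * f e w) * (3 * x e ^ 2 * w ^ 2 + 3 * x e ^ 3 * w * f e w + x e ^ 4 * f e w ^ 2)"
      and "V4 = (x e ^ 2 * f e w) * (4 * x e ^ 3 * w ^ 3 + 6 * x e ^ 4 * w ^ 2 * f e w + 4 * x e ^ 5 * w * f e w ^ 2 + x e ^ 6 * f e w ^ 3)"
      and "F2 = f e w ^ 2" and "CF = cnj (f e w)" and "SM = singular_mean (x e) (f e) (f' e) w"
    have ss: "ss e w = - SM - (P1 e ^ 2 + P1 e * P2 e * cnj w)" unfolding ss_def SM_def ..
    have "cnj (rr e w) = CF - P1 e * w - P2 e * w ^ 2" unfolding CF_def cf by simp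
    moreover have "rr e w = f e w - P1 e * cnj w - P2 e * cnj w ^ 2" unfolding rr_def by simp
    ultimately show "?L e w = ?E e w"
      unfolding W_expansion K N_def T_def v3 v4 V3_def[symmetric] V4_def[symmetric] ss
        O0_def[symmetric] P1_def[symmetric] P2_def[symmetric] G_def[symmetric] H_def[symmetric]
        F2_def[symmetric] CF_def[symmetric] SM_def[symmetric]
      by algebra
  qed
qed

text \<open>The errors are of two kinds: \<open>E\<close> is small uniformly, whereas
  \<open>L\<close>, the product of \<open>x\<close>, \<open>r'\<close> and \<open>T\<close>, is
  small only in the square mean. Their sum can still be inverted mode by mode.\<close>

lemma second_order:
  assumes \<Omega>': "unif_bigo unit_circle 3 (\<lambda>e w. of_real (\<Omega> e) - of_real \<Omega>0)"
    and q1: "\<And>(S :: complex set). unif_bigo S 1 (\<lambda>e i. of_real (q1 e))"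
    and q2: "\<And>(S :: complex set). unif_bigo S 2 (\<lambda>e i. of_real (q2 e))"
    and q: "unif_bigo unit_circle 3 (\<lambda>e w. g e w - (of_real (q1 e) * cnj w + of_real (q2 e) * cnj w ^ 2))"
  shows "unif_bigo unit_circle 5 (\<lambda>e w. of_real (2 * \<Omega> e * c e
      + \<gamma>i / d * (1 - (e * bi) ^ 2 * q1 e ^ 2) + \<gamma>i * (e * bi) ^ 3 * q1 e / d ^ 3 + k1 e))"
    and "unif_bigo unit_circle 5 (\<lambda>e w. r e w - R e w)"
proof -
  define K0 where "K0 e = 2 * \<Omega> e * c e + \<gamma>i / d" for e
  define K2 where "K2 e = 2 * \<Omega> e * c e + \<gamma>i / d * (1 - (e * bi) ^ 2 * q1 e ^ 2) + \<gamma>i * (e * bi) ^ 3 * q1 e / d ^ 3" for e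
  define a where "a e = (K2 e + k1 e) / \<gamma>j" for e
  define h where "h e w = complex_of_real (Im (r' e w - R' e w)) - a e * complex_of_real (Im w)" for e w
  \<comment> \<open>\<open>x * r' * T\<close>, with \<open>T\<close> multiplied out into scalars
    times powers of \<open>w\<close>, as the rules for \<open>l2_bigo\<close> demand.\<close>
  define L where "L e w = (2 * complex_of_real (\<Omega> e) * x e ^ 2) * r' e w + (complex_of_real \<gamma>i * x e ^ 2 * D ^ 2) * (w ^ 2 * r' e w)
      + (of_real \<gamma>i * x e ^ 3 * D ^ 3) * (w ^ 3 * r' e w)" for e w
  define hL where "hL e w = complex_of_real (Im (complex_of_real (1 / \<gamma>j) * L e w))" for e w
  \<comment> \<open>Three uniform errors: that of \<open>W_second_order\<close>, that of replacing
    \<open>T\<close> by \<open>T0\<close> next to \<open>P'\<close>, and \<open>x f'\<close> times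
    \<open>W - T\<close>, which has order three by the first round.\<close>
  define E where "E e w = complex_of_real (1 / \<gamma>j) * ((W e w - complex_of_real (K2 e) * w - N e w)
      + x e * P' e w * (2 * (of_real (\<Omega> e) - of_real \<Omega>0) * x e)
      + x e * f' e w * ((W e w - of_real (K0 e) * w - T e w) + of_real (K0 e) * w))" for e w
  have es_rr: "\<forall>\<^sub>F e in at 0. exterior_series (\<lambda>w. r e w - R e w) (\<lambda>w. r' e w - R' e w)
      (\<lambda>n. A e n - (if n = 1 then p1 e else if n = 2 then p2 e else 0) - (if n \<in> {1..4} then [s1 e, s2 e, s3 e, s4 e] ! (n - 1) else 0))"
    using es_r by eventually_elim (rule exterior_series_diff[OF _ exterior_series_poly])
  have l2L: "l2_bigo 5 L"
  proof -
    have "l2_bigo (2 + 3) L"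
      unfolding L_def
    proof (intro l2_bigo_add l2_bigo_scalar_mult l2_bigo_power_mult first_order(3))
      show "unif_bigo unit_circle 2 (\<lambda>e w. 2 * of_real (\<Omega> e) * x e ^ 2)"
        "unif_bigo unit_circle 2 (\<lambda>e w. of_real \<gamma>i * x e ^ 2 * D ^ 2)"
        "unif_bigo unit_circle 2 (\<lambda>e w. of_real \<gamma>i * x e ^ 3 * D ^ 3)"
        by (rule unif_bigo_mono, (rule O)+, simp)+
    qed
    then show ?thesis by simp
  qed
  have l2hL: "l2_bigo 5 hL"
  proof -
    have "l2_bigo (0 + 5) (\<lambda>e w. of_real (1 / \<gamma>j) * L e w)"
      by (rule l2_bigo_scalar_mult[OF l2L unif_bigo_const])
    then show ?thesis unfolding hL_def by (intro l2_bigo_Im) simp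
  qed
  have "unif_bigo unit_circle 5 E"
    unfolding E_def K0_def K2_def
    by (rule unif_bigo_mono, (rule W_second_order[OF assms] W_first_order first_order(1) \<Omega>' O)+) simp
  then have "unif_bigo unit_circle 5 (\<lambda>e w. of_real (Im (E e w)))" by (rule unif_bigo_Im)
  then have Oe: "unif_bigo unit_circle 5 (\<lambda>e w. h e w - hL e w)"
  proof (rule unif_bigo_cong, intro eventually_mono[OF eq] ballI)
    fix e w assume e: "\<forall>w\<in>unit_circle. \<gamma>j * Im (f' e w) = Im (W e w * (1 + x e * f' e w))" and w: "w \<in> unit_circle"
    define F' PP' rr' where "F' = f' e w" and "PP' = P' e w" and "rr' = r' e w"
    have F': "F' = PP' + rr'" unfolding F'_def PP'_def rr'_def by simp
    have "of_real \<gamma>j * E e w = (W e w - of_real (K2 e) * w - N e w)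
      + x e * PP' * (2 * (of_real (\<Omega> e) - of_real \<Omega>0) * x e) + x e * F' * (W e w - T e w)"
      unfolding E_def F'_def PP'_def using \<gamma>j by simp
    moreover have "T e w - T0 e w = 2 * (of_real (\<Omega> e) - of_real \<Omega>0) * x e"
      unfolding T_def T0_def by algebra
    moreover have "L e w = x e * rr' * T e w"
      unfolding L_def T_def rr'_def[symmetric] by algebra
    ultimately have "W e w * (1 + x e * F') = of_real \<gamma>j * E e w + of_real (K2 e) * w
        + (N e w + x e * PP' * T0 e w) + L e w"
      using F' by algebra
    then have "Im (W e w * (1 + x e * F')) = \<gamma>j * Im (E e w) + K2 e * Im w + Im (N e w + x e * PP' * T0 e w) + Im (L e w)"
      by (simp only: plus_complex.sel Im_of_real_mult)
    then have "\<gamma>j * Im (f' e w) = \<gamma>j * Im (E e w) + K2 e * Im w + (k1 e * Im w + \<gamma>j * Im (P' e w) + \<gamma>j * Im (R' e w)) + Im (L e w)"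
      using e w unfolding F'_def PP'_def Im_main_terms[OF w] by simp
    then have "\<gamma>j * (Im (f' e w) - Im (P' e w) - Im (R' e w)) - (K2 e + k1 e) * Im w - Im (L e w) = \<gamma>j * Im (E e w)"
      by (simp add: algebra_simps)
    then have "Im (E e w) = (\<gamma>j * (Im (f' e w) - Im (P' e w) - Im (R' e w)) - (K2 e + k1 e) * Im w - Im (L e w)) / \<gamma>j"
      using \<gamma>j by simp
    then have "Im (E e w) = Im (r' e w - R' e w) - a e * Im w - 1 / \<gamma>j * Im (L e w)"
      unfolding a_def minus_complex.sel using \<gamma>j by (simp add: diff_divide_distrib)
    then show "h e w - hL e w = of_real (Im (E e w))"
      unfolding h_def hL_def Im_of_real_mult by simp
  qed
  have "l2_bigo 5 (\<lambda>e w. (h e w - hL e w) + hL e w)"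
  proof (rule l2_bigo_add[OF l2_bigo_unif_bigo[OF Oe] l2hL], use es_rr l2_bigo_continuous[OF l2hL] in eventually_elim)
    case (elim e)
    from exterior_seriesD(1)[OF elim(1)]
    have "continuous_on unit_circle (\<lambda>w. complex_of_real (Im (r' e w - R' e w)))"
      by (intro continuous_on_of_real continuous_on_Im)
    then have "continuous_on unit_circle (h e)"
      unfolding h_def by (rule continuous_on_diff) (intro continuous_intros)
    then show ?case using elim(2) by (rule continuous_on_diff)
  qed
  then have h: "l2_bigo 5 h" by simp
  have "\<forall>\<^sub>F e in at 0. \<forall>w\<in>unit_circle. complex_of_real (Im (r' e w - R' e w)) = a e * complex_of_real (Im w) + h e w"
    unfolding h_def by simp
  note inv = l2_bigo_inversion[OF es_rr h this]
  show "unif_bigo unit_circle 5 (\<lambda>e w. r e w - R e w)" by (rule inv)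
  have "unif_bigo unit_circle 5 (\<lambda>e w. of_real \<gamma>j * of_real (a e))"
    by (rule unif_bigo_mono, (rule O inv(1))+) simp
  then show "unif_bigo unit_circle 5 (\<lambda>e w. of_real (2 * \<Omega> e * c e
      + \<gamma>i / d * (1 - (e * bi) ^ 2 * q1 e ^ 2) + \<gamma>i * (e * bi) ^ 3 * q1 e / d ^ 3 + k1 e))"
    using \<gamma>j unfolding a_def K2_def by (simp flip: of_real_mult)
qed

end

section \<open>Curves in the Hoelder space\<close>

text \<open>No point of the circle is isolated in it, so that derivatives along the circle are
  unique and the description in \<open>circle_deriv\<close> is proper.\<close>

lemma circle_within_nontrivial:
  assumes "w \<in> unit_circle"
  shows "at w within unit_circle \<noteq> bot"
proof -
  have "w islimpt unit_circle"
  proof (rule connected_imp_perfect)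
    show "connected unit_circle" by (rule connected_sphere) simp
    have "1 \<in> unit_circle" "-1 \<in> unit_circle" "(1::complex) \<noteq> -1" by auto
    then show "unit_circle \<noteq> {x}" for x :: complex by (metis singletonD)
  qed (rule assms)
  then show ?thesis by (simp add: trivial_limit_within)
qed

lemma circle_deriv_eqI:
  assumes "(f has_field_derivative D) (at w within unit_circle)" "w \<in> unit_circle"
  shows "circle_deriv f w = D"
  unfolding circle_deriv_def
proof (rule the_equality)
  show "(f has_field_derivative D) (at w within unit_circle)" by fact
  show "E = D" if "(f has_field_derivative E) (at w within unit_circle)" for E
    using that assms(1) tendsto_unique[OF circle_within_nontrivial[OF assms(2)]]
    unfolding has_field_derivative_iff by blast
qed

lemma C1_holder_deriv:
  assumes "f \<in> C1_holder \<alpha>" "w \<in> unit_circle"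
  shows "(f has_field_derivative circle_deriv f w) (at w within unit_circle)"
proof -
  obtain D where "(f has_field_derivative D) (at w within unit_circle)"
    using assms unfolding C1_holder_def by blast
  with circle_deriv_eqI[OF this assms(2)] show ?thesis by simp
qed

lemma C1_holder_lincomb:
  assumes f: "f \<in> C1_holder \<alpha>" and g: "g \<in> C1_holder \<alpha>"
  shows "(\<lambda>w. a * f w + b * g w) \<in> C1_holder \<alpha>"
    and "w \<in> unit_circle \<Longrightarrow> circle_deriv (\<lambda>w. a * f w + b * g w) w = a * circle_deriv f w + b * circle_deriv g w"
proof -
  have D: "((\<lambda>w. a * f w + b * g w) has_field_derivative a * circle_deriv f w + b * circle_deriv g w) (at w within unit_circle)"
    if "w \<in> unit_circle" for w
    by (intro DERIV_add DERIV_cmult C1_holder_deriv[OF f that] C1_holder_deriv[OF g that])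
  then show E: "circle_deriv (\<lambda>w. a * f w + b * g w) w = a * circle_deriv f w + b * circle_deriv g w"
    if "w \<in> unit_circle" for w
    using circle_deriv_eqI that by blast
  obtain C where C: "\<And>x y. x \<in> unit_circle \<Longrightarrow> y \<in> unit_circle \<Longrightarrow>
      cmod (circle_deriv f x - circle_deriv f y) \<le> C * cmod (x - y) powr \<alpha>"
    using f unfolding C1_holder_def by blast
  obtain C' where C': "\<And>x y. x \<in> unit_circle \<Longrightarrow> y \<in> unit_circle \<Longrightarrow>
      cmod (circle_deriv g x - circle_deriv g y) \<le> C' * cmod (x - y) powr \<alpha>"
    using g unfolding C1_holder_def by blast
  have "cmod (circle_deriv (\<lambda>w. a * f w + b * g w) x - circle_deriv (\<lambda>w. a * f w + b * g w) y)
      \<le> (cmod a * C + cmod b * C') * cmod (x - y) powr \<alpha>" if x: "x \<in> unit_circle" and y: "y \<in> unit_circle" for x y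
  proof -
    have "circle_deriv (\<lambda>w. a * f w + b * g w) x - circle_deriv (\<lambda>w. a * f w + b * g w) y
        = a * (circle_deriv f x - circle_deriv f y) + b * (circle_deriv g x - circle_deriv g y)"
      unfolding E[OF x] E[OF y] by algebra
    also have "cmod \<dots> \<le> cmod a * cmod (circle_deriv f x - circle_deriv f y) + cmod b * cmod (circle_deriv g x - circle_deriv g y)"
      by (rule order_trans[OF norm_triangle_ineq]) (simp add: norm_mult)
    also have "\<dots> \<le> cmod a * (C * cmod (x - y) powr \<alpha>) + cmod b * (C' * cmod (x - y) powr \<alpha>)"
      by (intro add_mono mult_left_mono C C' x y) auto
    finally show ?thesis by (simp add: algebra_simps)
  qed
  then show "(\<lambda>w. a * f w + b * g w) \<in> C1_holder \<alpha>"
    using D unfolding C1_holder_def by blast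
qed

lemma C1_holder_continuous:
  assumes "f \<in> C1_holder \<alpha>" "0 < \<alpha>"
  shows "continuous_on unit_circle f" "continuous_on unit_circle (circle_deriv f)"
proof -
  show "continuous_on unit_circle f"
    by (rule DERIV_continuous_on[OF C1_holder_deriv[OF assms(1)]])
  obtain C where C: "\<And>x y. x \<in> unit_circle \<Longrightarrow> y \<in> unit_circle \<Longrightarrow>
      cmod (circle_deriv f x - circle_deriv f y) \<le> C * cmod (x - y) powr \<alpha>"
    using assms unfolding C1_holder_def by blast
  show "continuous_on unit_circle (circle_deriv f)"
    unfolding continuous_on_def
  proof
    fix x :: complex assume x: "x \<in> unit_circle"
    have "((\<lambda>y. cmod (y - x)) \<longlongrightarrow> cmod (x - x)) (at x within unit_circle)"
      by (intro tendsto_intros)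
    then have "((\<lambda>y. cmod (y - x) powr \<alpha>) \<longlongrightarrow> 0) (at x within unit_circle)"
      using assms(2) by (intro tendsto_zero_powrI[where b = \<alpha>] tendsto_const) auto
    then have "((\<lambda>y. C * cmod (y - x) powr \<alpha>) \<longlongrightarrow> 0) (at x within unit_circle)"
      using tendsto_mult_left[of _ 0 _ C] by simp
    then have "((\<lambda>y. circle_deriv f y - circle_deriv f x) \<longlongrightarrow> 0) (at x within unit_circle)"
      by (rule Lim_null_comparison[rotated]) (use C x in \<open>auto simp: eventually_at_filter\<close>)
    then show "(circle_deriv f \<longlongrightarrow> circle_deriv f x) (at x within unit_circle)"
      by (simp add: Lim_null[of "circle_deriv f"])
  qed
qed

lemma circle_SUP_upper:
  assumes "continuous_on unit_circle h" "w \<in> unit_circle"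
  shows "cmod (h w) \<le> (SUP w \<in> unit_circle. cmod (h w))"
proof (rule cSUP_upper[OF assms(2)])
  have "compact ((\<lambda>w. cmod (h w)) ` unit_circle)"
    by (intro compact_continuous_image continuous_intros assms compact_sphere)
  then show "bdd_above ((\<lambda>w. cmod (h w)) ` unit_circle)"
    by (intro bounded_imp_bdd_above compact_imp_bounded)
qed

text \<open>The suprema are those of bounded sets, by compactness of the circle and by the Hoelder
  condition, and all summands of the norm are nonnegative.\<close>

lemma C1_holder_norm_upper:
  assumes f: "f \<in> C1_holder \<alpha>" and \<alpha>: "0 < \<alpha>" and w: "w \<in> unit_circle"
  shows "cmod (f w) \<le> C1_holder_norm \<alpha> f" "cmod (circle_deriv f w) \<le> C1_holder_norm \<alpha> f"
proof -
  let ?S = "{(x, y). x \<in> unit_circle \<and> y \<in> unit_circle \<and> x \<noteq> y}"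
  let ?q = "\<lambda>(x, y). cmod (circle_deriv f x - circle_deriv f y) / cmod (x - y) powr \<alpha>"
  obtain C where C: "\<And>x y. x \<in> unit_circle \<Longrightarrow> y \<in> unit_circle \<Longrightarrow>
      cmod (circle_deriv f x - circle_deriv f y) \<le> C * cmod (x - y) powr \<alpha>"
    using f unfolding C1_holder_def by blast
  have "bdd_above (?q ` ?S)"
    by (rule bdd_aboveI[of _ C]) (auto simp: divide_le_eq intro!: C)
  \<comment> \<open>A single quotient shows that their supremum is nonnegative.\<close>
  moreover have "(1, -1) \<in> ?S" by simp
  ultimately have "?q (1, -1) \<le> (SUP p\<in>?S. ?q p)" by (intro cSUP_upper) auto
  moreover have "0 \<le> ?q (1, -1)" by simp
  ultimately have semi: "0 \<le> holder_seminorm \<alpha> (circle_deriv f)"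
    unfolding holder_seminorm_def by linarith
  note c = circle_SUP_upper[OF C1_holder_continuous(1)[OF f \<alpha>] w] circle_SUP_upper[OF C1_holder_continuous(2)[OF f \<alpha>] w]
  have n: "0 \<le> cmod (f w)" "0 \<le> cmod (circle_deriv f w)" by auto
  show "cmod (f w) \<le> C1_holder_norm \<alpha> f"
    using semi c n unfolding C1_holder_norm_def holder_norm_def by linarith
  show "cmod (circle_deriv f w) \<le> C1_holder_norm \<alpha> f"
    using semi c n unfolding C1_holder_norm_def holder_norm_def by linarith
qed

lemma X_space_exterior_series:
  assumes "f \<in> X_space \<alpha>" "0 < \<alpha>" "j \<in> {1, 2}"
  shows "\<exists>A. exterior_series (f j) (circle_deriv (f j)) A"
proof -
  have f: "f j \<in> C1_holder \<alpha>" using assms unfolding X_space_def by blast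
  obtain A :: "nat \<Rightarrow> real" where "\<And>w. w \<in> unit_circle \<Longrightarrow> ((\<lambda>n. of_real (A n) * cnj w ^ n) has_sum f j w) {1..}"
    using assms unfolding X_space_def by blast
  then show ?thesis
    using C1_holder_deriv[OF f] C1_holder_continuous(2)[OF f assms(2)] unfolding exterior_series_def by blast
qed

lemma at_0_within_symmetric:
  assumes "0 < \<epsilon>0"
  shows "at 0 within {-\<epsilon>0..\<epsilon>0} = at (0::real)"
  by (rule at_within_interior) (use assms in simp)

text \<open>Since the curve vanishes on the circle at the parameter 0, it is \<open>t\<close> times
  its difference quotient, whose distance from the derivative \<open>G\<close> is eventually below 1
  in norm.\<close>

lemma C1_X_curve_bigo:
  assumes \<alpha>: "0 < \<alpha>" and \<epsilon>0: "0 < \<epsilon>0" and curve: "C1_X_curve \<alpha> {-\<epsilon>0..\<epsilon>0} f"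
    and f0: "\<And>w. w \<in> unit_circle \<Longrightarrow> f 0 j w = 0" and j: "j \<in> {1, 2}"
  shows "unif_bigo unit_circle 1 (\<lambda>e. f e j)" "unif_bigo unit_circle 1 (\<lambda>e. circle_deriv (f e j))"
proof -
  have "0 \<in> {-\<epsilon>0..\<epsilon>0}" using \<epsilon>0 by simp
  then obtain G where G: "G \<in> X_space \<alpha>"
    and lim: "((\<lambda>t. X_norm \<alpha> (\<lambda>j w. (f t j w - f 0 j w) / of_real (t - 0) - G j w)) \<longlongrightarrow> 0) (at 0 within {-\<epsilon>0..\<epsilon>0})"
    using curve unfolding C1_X_curve_def by blast
  define h where "h t j w = (f t j w - f 0 j w) / complex_of_real (t - 0) - G j w" for t j w
  have "\<forall>\<^sub>F t in at 0. X_norm \<alpha> (h t) < 1"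
    using order_tendstoD(2)[OF lim, of 1] unfolding h_def at_0_within_symmetric[OF \<epsilon>0] by simp
  moreover have "\<forall>\<^sub>F t in at 0. t \<in> {-\<epsilon>0..\<epsilon>0}"
    using \<epsilon>0 by (auto simp: eventually_at intro!: exI[of _ \<epsilon>0])
  moreover have "\<forall>\<^sub>F t in at 0. t \<noteq> (0::real)" by (simp add: eventually_at_filter)
  ultimately have ev: "\<forall>\<^sub>F t in at 0. X_norm \<alpha> (h t) < 1 \<and> t \<in> {-\<epsilon>0..\<epsilon>0} \<and> t \<noteq> 0"
    by eventually_elim auto
  have X: "f t j \<in> C1_holder \<alpha>" if "t \<in> {-\<epsilon>0..\<epsilon>0}" for t
    using curve that j unfolding C1_X_curve_def X_space_def by blast
  have Gj: "G j \<in> C1_holder \<alpha>" using G j unfolding X_space_def by blast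
  have F0: "f 0 j \<in> C1_holder \<alpha>" using X \<epsilon>0 by simp
  have d0: "circle_deriv (f 0 j) w = 0" if "w \<in> unit_circle" for w
  proof (rule circle_deriv_eqI[OF _ that])
    show "(f 0 j has_field_derivative 0) (at w within unit_circle)"
      by (rule has_field_derivative_transform_within[OF DERIV_const[of 0], where d = 1]) (use f0 that in auto)
  qed
  define M where "M = 1 + C1_holder_norm \<alpha> (G j)"
  have b: "cmod (f t j w) \<le> M * \<bar>t\<bar> ^ 1 \<and> cmod (circle_deriv (f t j) w) \<le> M * \<bar>t\<bar> ^ 1"
    if t: "X_norm \<alpha> (h t) < 1 \<and> t \<in> {-\<epsilon>0..\<epsilon>0} \<and> t \<noteq> 0" and w: "w \<in> unit_circle" for t w
  proof -
    define s where "s = 1 / complex_of_real t"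
    have s: "of_real t * s = 1" unfolding s_def using t by simp
    \<comment> \<open>\<open>f 0 j\<close> is kept in the combination: it vanishes on the circle,
      but its values elsewhere are arbitrary, and this is an equality of total functions.\<close>
    have hj: "h t j = (\<lambda>w. s * f t j w + 1 * ((- s) * f 0 j w + (- 1) * G j w))"
      unfolding h_def s_def by (auto simp: fun_eq_iff diff_divide_distrib)
    note lc = C1_holder_lincomb[OF F0 Gj, where a = "- s" and b = "- 1"]
    have hC: "h t j \<in> C1_holder \<alpha>"
      unfolding hj by (intro C1_holder_lincomb(1) X lc(1)) (use t in auto)
    have hd: "circle_deriv (h t j) w = s * circle_deriv (f t j) w - circle_deriv (G j) w"
      unfolding hj using C1_holder_lincomb(2)[OF X lc(1), where w = w and a = s and b = 1] t w lc(2)[OF w] d0[OF w] by simp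
    have "C1_holder_norm \<alpha> (h t j) < 1"
      using t j unfolding X_norm_def by auto
    then have h1: "cmod (h t j w) \<le> 1" "cmod (circle_deriv (h t j) w) \<le> 1"
      using C1_holder_norm_upper[OF hC \<alpha> w] by linarith+
    note G1 = C1_holder_norm_upper[OF Gj \<alpha> w]
    have "f t j w = of_real t * (h t j w + G j w)"
      unfolding hj using s f0[OF w] by algebra
    moreover have "cmod (h t j w + G j w) \<le> M"
      unfolding M_def by (rule norm_triangle_le) (use h1 G1 in linarith)
    ultimately have 1: "cmod (f t j w) \<le> M * \<bar>t\<bar> ^ 1"
      by (simp add: norm_mult mult.commute[of M] mult_left_mono)
    have "circle_deriv (f t j) w = of_real t * (circle_deriv (h t j) w + circle_deriv (G j) w)"
      unfolding hd using s by algebra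
    moreover have "cmod (circle_deriv (h t j) w + circle_deriv (G j) w) \<le> M"
      unfolding M_def by (rule norm_triangle_le) (use h1 G1 in linarith)
    ultimately have "cmod (circle_deriv (f t j) w) \<le> M * \<bar>t\<bar> ^ 1"
      by (simp add: norm_mult mult.commute[of M] mult_left_mono)
    with 1 show ?thesis by blast
  qed
  show "unif_bigo unit_circle 1 (\<lambda>e. f e j)"
    unfolding unif_bigo_def by (rule exI[of _ M], rule eventually_mono[OF ev]) (use b in blast)
  show "unif_bigo unit_circle 1 (\<lambda>e. circle_deriv (f e j))"
    unfolding unif_bigo_def by (rule exI[of _ M], rule eventually_mono[OF ev]) (use b in blast)
qed

lemma C1_real_curve_bigo:
  assumes "0 < \<epsilon>0" "C1_real_curve {-\<epsilon>0..\<epsilon>0} u"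
  shows "unif_bigo S 1 (\<lambda>e i. of_real (u e - u 0))"
proof -
  have "0 \<in> {-\<epsilon>0..\<epsilon>0}" using assms by simp
  then obtain D where "(u has_real_derivative D) (at 0 within {-\<epsilon>0..\<epsilon>0})"
    using assms(2) unfolding C1_real_curve_def by blast
  then have "((\<lambda>e. (u e - u 0) / e) \<longlongrightarrow> D) (at 0)"
    unfolding at_0_within_symmetric[OF assms(1)] by (simp add: has_field_derivative_iff)
  then have "((\<lambda>e. \<bar>(u e - u 0) / e\<bar>) \<longlongrightarrow> \<bar>D\<bar>) (at 0)" by (rule tendsto_rabs)
  then have "\<forall>\<^sub>F e in at 0. \<bar>(u e - u 0) / e\<bar> < \<bar>D\<bar> + 1" by (rule order_tendstoD) simp
  moreover have "\<forall>\<^sub>F e in at 0. e \<noteq> (0::real)" by (simp add: eventually_at_filter)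
  ultimately have "\<forall>\<^sub>F e in at 0. \<forall>i\<in>S. cmod (of_real (u e - u 0)) \<le> (\<bar>D\<bar> + 1) * \<bar>e\<bar> ^ 1"
  proof eventually_elim
    case (elim e)
    then have "\<bar>u e - u 0\<bar> \<le> (\<bar>D\<bar> + 1) * \<bar>e\<bar> ^ 1" by (simp add: field_simps)
    then show ?case by (simp only: norm_of_real) simp
  qed
  then show ?thesis unfolding unif_bigo_def by blast
qed

lemma unif_bigo_imp_smallo:
  assumes "unif_bigo unit_circle (Suc n) (\<lambda>e w. of_real (u e))"
  shows "u \<in> o[at 0](\<lambda>e. e ^ n)"
proof (rule landau_o.smallI)
  fix c :: real assume "0 < c"
  obtain C where C: "\<forall>\<^sub>F e in at 0. \<forall>w\<in>unit_circle. cmod (of_real (u e)) \<le> C * \<bar>e\<bar> ^ Suc n"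
    using unif_bigoE[OF assms] .
  have "((\<lambda>e. C * \<bar>e\<bar>) \<longlongrightarrow> C * \<bar>0\<bar>) (at 0)" by (intro tendsto_intros)
  then have "\<forall>\<^sub>F e in at 0. C * \<bar>e\<bar> < c" using \<open>0 < c\<close> by (intro order_tendstoD(2)) auto
  with C show "\<forall>\<^sub>F e in at 0. norm (u e) \<le> c * norm (e ^ n)"
  proof eventually_elim
    case (elim e)
    have "\<bar>u e\<bar> \<le> C * \<bar>e\<bar> ^ Suc n" using bspec[OF elim(1), of 1] by simp
    also have "\<dots> = (C * \<bar>e\<bar>) * \<bar>e\<bar> ^ n" by simp
    also have "\<dots> \<le> c * \<bar>e\<bar> ^ n" using elim(2) by (intro mult_right_mono) auto
    finally show ?case by (simp add: power_abs)
  qed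
qed

lemma unif_bigo_imp_uniform_limit:
  assumes "unif_bigo S (Suc n) u"
  shows "uniform_limit S (\<lambda>e w. u e w / of_real (e ^ n)) (\<lambda>_. 0) (at 0)"
  unfolding uniform_limit_iff
proof (intro allI impI)
  fix c :: real assume "0 < c"
  obtain C where C: "\<forall>\<^sub>F e in at 0. \<forall>w\<in>S. cmod (u e w) \<le> C * \<bar>e\<bar> ^ Suc n"
    using unif_bigoE[OF assms] .
  have "((\<lambda>e. C * \<bar>e\<bar>) \<longlongrightarrow> C * \<bar>0\<bar>) (at 0)" by (intro tendsto_intros)
  then have "\<forall>\<^sub>F e in at 0. C * \<bar>e\<bar> < c" using \<open>0 < c\<close> by (intro order_tendstoD(2)) auto
  moreover have "\<forall>\<^sub>F e in at 0. e \<noteq> (0::real)" by (simp add: eventually_at_filter)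
  ultimately show "\<forall>\<^sub>F e in at 0. \<forall>w\<in>S. dist (u e w / of_real (e ^ n)) 0 < c"
    using C
  proof eventually_elim
    case (elim e)
    show ?case
    proof
      fix w assume "w \<in> S"
      then have "cmod (u e w) \<le> (C * \<bar>e\<bar>) * \<bar>e\<bar> ^ n" using elim(3) by (simp add: mult.assoc)
      then have "cmod (u e w) / \<bar>e\<bar> ^ n \<le> C * \<bar>e\<bar>"
        using elim(2) by (simp add: divide_le_eq)
      also have "\<dots> < c" by (rule elim)
      finally show "dist (u e w / of_real (e ^ n)) 0 < c"
        by (simp add: norm_divide norm_power)
    qed
  qed
qed

section \<open>From the functional to the equations of the two domains\<close>

lemma F_pair_vortex_side:
  fixes f :: "real \<Rightarrow> nat \<Rightarrow> complex \<Rightarrow> complex" and A :: "real \<Rightarrow> nat \<Rightarrow> nat \<Rightarrow> real"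
  assumes d: "d > 0" and \<gamma>: "\<gamma> 1 \<noteq> 0" "\<gamma> 2 \<noteq> 0" "\<gamma> 1 + \<gamma> 2 \<noteq> 0"
    and \<Omega>: "unif_bigo unit_circle 1 (\<lambda>e w. of_real (\<Omega> e - (\<gamma> 1 + \<gamma> 2) / (2 * d\<^sup>2)))"
    and Z: "unif_bigo unit_circle 1 (\<lambda>e w. of_real (Z e - d * \<gamma> 2 / (\<gamma> 1 + \<gamma> 2)))"
    and es: "\<And>j. j \<in> {1, 2} \<Longrightarrow> \<forall>\<^sub>F e in at 0. exterior_series (f e j) (circle_deriv (f e j)) (A e j)"
    and f: "\<And>j. j \<in> {1, 2} \<Longrightarrow> unif_bigo unit_circle 1 (\<lambda>e. f e j)"
      "\<And>j. j \<in> {1, 2} \<Longrightarrow> unif_bigo unit_circle 1 (\<lambda>e. circle_deriv (f e j))"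
    and F: "\<And>j. j \<in> {1, 2} \<Longrightarrow> \<forall>\<^sub>F e in at 0. \<forall>w\<in>unit_circle. F_pair b \<gamma> d j e (\<Omega> e) (Z e) (f e) w = 0"
    and ji: "j = 1 \<and> i = 2 \<or> j = 2 \<and> i = 1"
  shows "vortex_side (b j) (b i) (\<gamma> j) (\<gamma> i) d \<Omega> (\<lambda>e. (-1) ^ j * Z e - (real j - 1) * d)
    (\<lambda>e. f e j) (\<lambda>e. circle_deriv (f e j)) (\<lambda>e. f e i) (\<lambda>e. circle_deriv (f e i)) (\<lambda>e. A e j) (\<lambda>e. A e i)"
proof -
  have j: "j \<in> {1, 2}" and i: "i \<in> {1, 2}" and i3: "3 - j = i" using ji by auto
  define \<Omega>0 Z0 where "\<Omega>0 = (\<gamma> 1 + \<gamma> 2) / (2 * d\<^sup>2)" and "Z0 = d * \<gamma> 2 / (\<gamma> 1 + \<gamma> 2)"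
  define c where "c e = (-1) ^ j * Z e - (real j - 1) * d" for e
  define c0 where "c0 = (-1) ^ j * Z0 - (real j - 1) * d"
  define s :: real where "s = (-1) ^ j"
  \<comment> \<open>The relation for two point vortices at 0 and \<open>d\<close> that rotate about
    \<open>Z0\<close> with angular velocity \<open>\<Omega>0\<close>. It is why
    \<open>2 * \<Omega> * c + \<gamma> i / d\<close> has order one, as the locale requires.\<close>
  have K0: "2 * \<Omega>0 * c0 + \<gamma> i / d = 0"
  proof -
    have "d\<^sup>2 * (\<gamma> 1 + \<gamma> 2) \<noteq> 0" using d \<gamma> by simp
    then show ?thesis
      using ji d \<gamma>(3) unfolding \<Omega>0_def c0_def Z0_def
      by (elim disjE) (simp_all add: field_simps power2_eq_square)
  qed
  have O\<Omega>: "unif_bigo unit_circle 0 (\<lambda>e w. of_real (\<Omega> e))"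
  proof -
    have "unif_bigo unit_circle 0 (\<lambda>e w. of_real (\<Omega> e - \<Omega>0) + of_real \<Omega>0)"
      by (rule unif_bigo_mono, (rule \<Omega>[folded \<Omega>0_def] unif_bigo_add unif_bigo_const)+) simp
    then show ?thesis by simp
  qed
  have OK: "unif_bigo unit_circle 1 (\<lambda>e w. of_real (2 * \<Omega> e * c e + \<gamma> i / d))"
  proof -
    have "unif_bigo unit_circle 1 (\<lambda>e w. 2 * of_real (\<Omega> e - \<Omega>0) * (of_real s * of_real (Z e - Z0))
      + 2 * of_real (\<Omega> e - \<Omega>0) * of_real c0 + 2 * of_real \<Omega>0 * (of_real s * of_real (Z e - Z0)))"
      by (rule unif_bigo_mono, (rule \<Omega>[folded \<Omega>0_def] Z[folded Z0_def] unif_bigo_add unif_bigo_mult unif_bigo_const)+) simp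
    moreover have "complex_of_real (2 * \<Omega> e * c e + \<gamma> i / d) = 2 * of_real (\<Omega> e - \<Omega>0) * (of_real s * of_real (Z e - Z0))
      + 2 * of_real (\<Omega> e - \<Omega>0) * of_real c0 + 2 * of_real \<Omega>0 * (of_real s * of_real (Z e - Z0))" for e
    proof -
      have "c e = c0 + s * (Z e - Z0)" unfolding c_def c0_def s_def by (simp add: algebra_simps)
      then have "2 * \<Omega> e * c e + \<gamma> i / d = 2 * (\<Omega> e - \<Omega>0) * (s * (Z e - Z0)) + 2 * (\<Omega> e - \<Omega>0) * c0 + 2 * \<Omega>0 * (s * (Z e - Z0))"
        using K0 by algebra
      then show ?thesis by (simp only: of_real_add of_real_mult of_real_numeral)
    qed
    ultimately show ?thesis by simp
  qed
  have eq: "\<forall>\<^sub>F e in at 0. \<forall>w\<in>unit_circle. \<gamma> j * Im (circle_deriv (f e j) w) =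
      Im ((2 * of_real (\<Omega> e) * (of_real (e * b j) * (1 + of_real (e * b j) * w * cnj (f e j w)) + of_real (c e) * w)
           - of_real (e * b j) * of_real (\<gamma> j) * singular_mean (of_real (e * b j)) (f e j) (circle_deriv (f e j)) w
           + of_real (\<gamma> i) * w * (- mean_circle (\<lambda>\<tau>. (cnj \<tau> + of_real (e * b i) * cnj (f e i \<tau>)) * (1 + of_real (e * b i) * circle_deriv (f e i) \<tau>)
               / (of_real (e * b i) * \<tau> + (of_real (e * b i))\<^sup>2 * f e i \<tau> + (of_real (e * b j) * w + (of_real (e * b j))\<^sup>2 * f e j w) - of_real d))))
          * (1 + of_real (e * b j) * circle_deriv (f e j) w))"
    (is "\<forall>\<^sub>F e in at 0. \<forall>w\<in>unit_circle. ?eq e w")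
    using F[OF j] es[OF j] unif_bigo_singular_integrand(2)[OF es[OF j] f(2)[OF j], of "b j"]
  proof eventually_elim
    case (elim e)
    show ?case
    proof
      fix w :: complex assume w: "w \<in> unit_circle"
      define X Y D' where "X = complex_of_real (e * b j)" and "Y = complex_of_real (e * b i)" and "D' = circle_deriv (f e j) w"
      define MS where "MS = mean_circle (\<lambda>\<tau>. let A = \<tau> - w; B = f e j \<tau> - f e j w
           in (A * cnj B - cnj A * B) / (A * (A + X * B)) * (circle_deriv (f e j) \<tau> - B / A))"
      define MJ where "MJ = mean_circle (\<lambda>\<tau>. (cnj \<tau> + Y * cnj (f e i \<tau>)) * (1 + Y * circle_deriv (f e i) \<tau>)
               / (Y * \<tau> + Y\<^sup>2 * f e i \<tau> + (X * w + X\<^sup>2 * f e j w) - of_real d))"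
      have MS: "w * MS = - singular_mean X (f e j) (circle_deriv (f e j)) w"
        unfolding MS_def using mean_circle_singular[OF elim(2) w, of X] elim(3) w unfolding X_def by simp
      have XY: "of_real e * of_real (b j) = X" "of_real e * of_real (b i) = Y"
        unfolding X_def Y_def by simp_all
      have den: "of_real e * (of_real (b i) * \<tau> + of_real (b j) * w)
          + (of_real e)\<^sup>2 * ((of_real (b i))\<^sup>2 * f e i \<tau> + (of_real (b j))\<^sup>2 * f e j w)
          = Y * \<tau> + Y\<^sup>2 * f e i \<tau> + (X * w + X\<^sup>2 * f e j w)" for \<tau>
        unfolding XY[symmetric] by algebra
      have "0 = F_pair b \<gamma> d j e (\<Omega> e) (Z e) (f e) w" using elim(1) w by simp
      also have "\<dots> = Im (2 * of_real (\<Omega> e) * (X * (cnj w + X * cnj (f e j w)) + (-1) ^ j * of_real (Z e) - (of_nat j - 1) * of_real d)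
               * w * (1 + X * D') - of_real (\<gamma> j) * D' + X * of_real (\<gamma> j) * w * (1 + X * D') * MS
             - of_real (\<gamma> i) * w * (1 + X * D') * MJ)"
        unfolding F_pair_def Let_def i3 XY den MS_def MJ_def D'_def ..
      also have "X * (cnj w + X * cnj (f e j w)) + (-1) ^ j * of_real (Z e) - (of_nat j - 1) * of_real d
          = X * (cnj w + X * cnj (f e j w)) + of_real (c e)"
        unfolding c_def by simp
      \<comment> \<open>The factor \<open>w\<close> is drawn inside, where it turns
        \<open>cnj w\<close> into 1 and the self-interaction into
        \<open>- singular_mean\<close>.\<close>
      also have "2 * of_real (\<Omega> e) * (X * (cnj w + X * cnj (f e j w)) + of_real (c e))
               * w * (1 + X * D') - of_real (\<gamma> j) * D' + X * of_real (\<gamma> j) * w * (1 + X * D') * MS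
             - of_real (\<gamma> i) * w * (1 + X * D') * MJ
          = (2 * of_real (\<Omega> e) * (X * (1 + X * w * cnj (f e j w)) + of_real (c e) * w)
             - X * of_real (\<gamma> j) * singular_mean X (f e j) (circle_deriv (f e j)) w
             + of_real (\<gamma> i) * w * (- MJ)) * (1 + X * D') - of_real (\<gamma> j) * D'"
        using circle_mult_cnj[OF w] MS by algebra
      finally show "?eq e w"
        unfolding MJ_def X_def[symmetric] Y_def[symmetric] D'_def[symmetric] by simp
    qed
  qed
  have \<gamma>j: "\<gamma> j \<noteq> 0" using ji \<gamma> by auto
  show ?thesis
    by unfold_locales (rule d \<gamma>j es[OF j] es[OF i] f(1)[OF j] f(2)[OF j] f(1)[OF i] f(2)[OF i] O\<Omega> OK[unfolded c_def] eq[unfolded c_def])+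
qed

text \<open>The factor \<open>x\<close> in front of \<open>f\<close> raises the error of order five
  in \<open>second_order\<close> to order six.\<close>

lemma (in vortex_side) boundary_expansion:
  assumes \<Omega>': "unif_bigo unit_circle 3 (\<lambda>e w. of_real (\<Omega> e) - of_real \<Omega>0)"
    and q1: "\<And>(S :: complex set). unif_bigo S 1 (\<lambda>e i. of_real (q1 e))"
    and q2: "\<And>(S :: complex set). unif_bigo S 2 (\<lambda>e i. of_real (q2 e))"
    and q: "unif_bigo unit_circle 3 (\<lambda>e w. g e w - (of_real (q1 e) * cnj w + of_real (q2 e) * cnj w ^ 2))"
    and \<delta>: "\<delta> = \<gamma>i / \<gamma>j"
  shows "unif_bigo unit_circle 6 (\<lambda>e w. w + of_real (e * bj) * f e w
                 - (w + of_real (\<delta> * (e * bj / d) ^ 2) * cnj w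
                      + of_real (\<delta> / 2 * (e * bj / d) ^ 3) * cnj w ^ 2
                      + of_real (\<delta> / 3 * (e * bj / d) ^ 4)
                          * (cnj w ^ 3 + of_real (6 * (1 + \<delta>)) * cnj w)
                      + of_real (\<delta> / 4 * (e * bj / d) ^ 5)
                          * (cnj w ^ 4 + of_real (3 * (1 + \<delta>)) * cnj w ^ 2)))"
proof -
  have "unif_bigo unit_circle 6 (\<lambda>e w. x e * (r e w - R e w))"
    by (rule unif_bigo_mono, (rule second_order(2)[OF \<Omega>' q1 q2 q] unif_bigo_mult unif_bigo_x)+) simp
  then show ?thesis
  proof (rule unif_bigo_cong, intro always_eventually allI ballI)
    fix e and w :: complex
    have eqs: "\<delta> * (e * bj / d) ^ 2 = e * bj * p1 e" "\<delta> / 2 * (e * bj / d) ^ 3 = e * bj * p2 e"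
      "\<delta> / 3 * (e * bj / d) ^ 4 = e * bj * s3 e" "\<delta> / 4 * (e * bj / d) ^ 5 = e * bj * s4 e"
      unfolding p1_def p2_def s3_def s4_def \<delta> by (simp_all add: power_divide eval_nat_numeral mult_ac)
    \<comment> \<open>As \<open>2 * \<Omega>0 / \<gamma>j = (1 + \<delta>) / d^2\<close>, the
      coefficients \<open>s1\<close> and \<open>s2\<close> become multiples of \<open>s3\<close> and
      \<open>s4\<close>, which is how they are grouped in the claim.\<close>
    have eq1: "e * bj * s3 e * (6 * (1 + \<delta>)) = e * bj * s1 e"
      unfolding s1_def s3_def p1_def \<Omega>0_def \<delta> using \<gamma>j d by (simp add: field_simps eval_nat_numeral)
    have eq2: "e * bj * s4 e * (3 * (1 + \<delta>)) = e * bj * s2 e"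
      unfolding s2_def s4_def p2_def \<Omega>0_def \<delta> using \<gamma>j d by (simp add: field_simps eval_nat_numeral)
    define U V where "U = complex_of_real (6 * (1 + \<delta>))" and "V = complex_of_real (3 * (1 + \<delta>))"
    have eq1': "complex_of_real (e * bj * s3 e) * complex_of_real (6 * (1 + \<delta>)) = complex_of_real (e * bj * s1 e)"
      and eq2': "complex_of_real (e * bj * s4 e) * complex_of_real (3 * (1 + \<delta>)) = complex_of_real (e * bj * s2 e)"
      using eq1 eq2 by (simp_all only: of_real_mult[symmetric])
    show "w + of_real (e * bj) * f e w
                 - (w + of_real (\<delta> * (e * bj / d) ^ 2) * cnj w
                      + of_real (\<delta> / 2 * (e * bj / d) ^ 3) * cnj w ^ 2
                      + of_real (\<delta> / 3 * (e * bj / d) ^ 4)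
                          * (cnj w ^ 3 + of_real (6 * (1 + \<delta>)) * cnj w)
                      + of_real (\<delta> / 4 * (e * bj / d) ^ 5)
                          * (cnj w ^ 4 + of_real (3 * (1 + \<delta>)) * cnj w ^ 2)) = x e * (r e w - R e w)"
      using eq1'[folded U_def] eq2'[folded V_def]
      unfolding U_def[symmetric] V_def[symmetric] eqs R_eq x_def
      unfolding of_real_mult by algebra
  qed
qed

theorem proposition5p1:
  fixes \<alpha> d \<epsilon>0 :: real
    and b \<gamma> \<delta> :: "nat \<Rightarrow> real"
    and \<Omega> Z :: "real \<Rightarrow> real"
    and f :: "real \<Rightarrow> nat \<Rightarrow> complex \<Rightarrow> complex"
    and \<phi> :: "nat \<Rightarrow> real \<Rightarrow> complex \<Rightarrow> complex"
  assumes "0 < \<alpha>" "\<alpha> < 1"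
    and "0 < b 1" "0 < b 2" "d > 2 * (b 1 + b 2)"
    and "\<gamma> 1 \<noteq> 0" "\<gamma> 2 \<noteq> 0" "\<gamma> 1 + \<gamma> 2 \<noteq> 0"
    and "0 < \<epsilon>0"
    and "C1_real_curve {-\<epsilon>0..\<epsilon>0} \<Omega>" "C1_real_curve {-\<epsilon>0..\<epsilon>0} Z"
    and "C1_X_curve \<alpha> {-\<epsilon>0..\<epsilon>0} f"
    and "\<And>\<epsilon>. \<epsilon> \<in> {-\<epsilon>0..\<epsilon>0} \<Longrightarrow> f \<epsilon> \<in> X_unit_ball \<alpha>"
    and "\<And>\<epsilon> j w. \<epsilon> \<in> {-\<epsilon>0..\<epsilon>0} \<Longrightarrow> j \<in> {1, 2} \<Longrightarrow> w \<in> unit_circle \<Longrightarrow>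
           F_pair b \<gamma> d j \<epsilon> (\<Omega> \<epsilon>) (Z \<epsilon>) (f \<epsilon>) w = 0"
    and "\<Omega> 0 = (\<gamma> 1 + \<gamma> 2) / (2 * d\<^sup>2)"
    and "Z 0 = d * \<gamma> 2 / (\<gamma> 1 + \<gamma> 2)"
    and "\<And>j w. j \<in> {1, 2} \<Longrightarrow> w \<in> unit_circle \<Longrightarrow> f 0 j w = 0"
    and "\<delta> = (\<lambda>j. \<gamma> (3 - j) / \<gamma> j)"
    and "\<phi> = boundary_param b f"
  shows "(\<forall>j\<in>{1, 2}.
            uniform_limit unit_circle
              (\<lambda>\<epsilon> w. (\<phi> j \<epsilon> w
                 - (w + of_real (\<delta> j * (\<epsilon> * b j / d) ^ 2) * cnj w
                      + of_real (\<delta> j / 2 * (\<epsilon> * b j / d) ^ 3) * cnj w ^ 2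
                      + of_real (\<delta> j / 3 * (\<epsilon> * b j / d) ^ 4)
                          * (cnj w ^ 3 + of_real (6 * (1 + \<delta> j)) * cnj w)
                      + of_real (\<delta> j / 4 * (\<epsilon> * b j / d) ^ 5)
                          * (cnj w ^ 4 + of_real (3 * (1 + \<delta> j)) * cnj w ^ 2)))
                 / of_real (\<epsilon> ^ 5))
              (\<lambda>_. 0) (at 0))
       \<and> (\<lambda>\<epsilon>. \<Omega> \<epsilon> - ((\<gamma> 1 + \<gamma> 2) / (2 * d\<^sup>2)
                        + \<epsilon> ^ 4 / (2 * d ^ 6) * (\<gamma> 1 * b 2 ^ 4 + \<gamma> 2 * b 1 ^ 4)))
           \<in> o[at 0](\<lambda>\<epsilon>. \<epsilon> ^ 4)
       \<and> (\<lambda>\<epsilon>. Z \<epsilon> - (\<gamma> 2 * d / (\<gamma> 1 + \<gamma> 2)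
                        + \<epsilon> ^ 4 / (d ^ 3 * (\<gamma> 1 + \<gamma> 2)\<^sup>2)
                            * (\<gamma> 2 ^ 3 / \<gamma> 1 * b 1 ^ 4 - \<gamma> 1 ^ 3 / \<gamma> 2 * b 2 ^ 4)))
           \<in> o[at 0](\<lambda>\<epsilon>. \<epsilon> ^ 4)"
proof -
  have "0 < 2 * (b 1 + b 2)" using assms(3,4) by simp
  then have d: "d > 0" using assms(5) by (rule less_trans)
  note \<gamma>0 = \<open>\<gamma> 1 \<noteq> 0\<close> \<open>\<gamma> 2 \<noteq> 0\<close> \<open>\<gamma> 1 + \<gamma> 2 \<noteq> 0\<close>
  \<comment> \<open>\<open>X_space\<close> provides real coefficients for each parameter; one choice
    is fixed for both domains.\<close>
  define a where "a e j = (SOME a. exterior_series (f e j) (circle_deriv (f e j)) a)" for e j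
  define \<Omega>\<^sub>0 Z\<^sub>0 where "\<Omega>\<^sub>0 = (\<gamma> 1 + \<gamma> 2) / (2 * d\<^sup>2)" and "Z\<^sub>0 = d * \<gamma> 2 / (\<gamma> 1 + \<gamma> 2)"
  have \<Omega>\<^sub>0: "\<Omega>\<^sub>0 \<noteq> 0" unfolding \<Omega>\<^sub>0_def using d \<gamma>0 by simp
  have near: "\<forall>\<^sub>F e in at 0. e \<in> {-\<epsilon>0..\<epsilon>0}"
    using \<open>0 < \<epsilon>0\<close> by (auto simp: eventually_at intro!: exI[of _ \<epsilon>0])
  have es: "\<forall>\<^sub>F e in at 0. exterior_series (f e j) (circle_deriv (f e j)) (a e j)" if j: "j \<in> {1, 2}" for j
    using near
  proof eventually_elim
    case (elim e)
    then have "f e \<in> X_space \<alpha>" using assms(13) unfolding X_unit_ball_def by blast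
    from someI_ex[OF X_space_exterior_series[OF this \<open>0 < \<alpha>\<close> j]] show ?case unfolding a_def .
  qed
  have O\<Omega>: "unif_bigo unit_circle 1 (\<lambda>e w. of_real (\<Omega> e - \<Omega>\<^sub>0))"
    using C1_real_curve_bigo[OF \<open>0 < \<epsilon>0\<close> \<open>C1_real_curve {-\<epsilon>0..\<epsilon>0} \<Omega>\<close>] assms(15) unfolding \<Omega>\<^sub>0_def by simp
  have OZ: "unif_bigo unit_circle 1 (\<lambda>e w. of_real (Z e - Z\<^sub>0))"
    using C1_real_curve_bigo[OF \<open>0 < \<epsilon>0\<close> \<open>C1_real_curve {-\<epsilon>0..\<epsilon>0} Z\<close>] assms(16) unfolding Z\<^sub>0_def by simp
  have side: "vortex_side (b j) (b i) (\<gamma> j) (\<gamma> i) d \<Omega> (\<lambda>e. (-1) ^ j * Z e - (real j - 1) * d)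
    (\<lambda>e. f e j) (\<lambda>e. circle_deriv (f e j)) (\<lambda>e. f e i) (\<lambda>e. circle_deriv (f e i)) (\<lambda>e. a e j) (\<lambda>e. a e i)"
    if "j = 1 \<and> i = 2 \<or> j = 2 \<and> i = 1" for j i
  proof (rule F_pair_vortex_side[OF d \<gamma>0 O\<Omega>[unfolded \<Omega>\<^sub>0_def] OZ[unfolded Z\<^sub>0_def] es _ _ _ that])
    fix k :: nat assume k: "k \<in> {1, 2}"
    show "unif_bigo unit_circle 1 (\<lambda>e. f e k)" "unif_bigo unit_circle 1 (\<lambda>e. circle_deriv (f e k))"
      using C1_X_curve_bigo[OF \<open>0 < \<alpha>\<close> \<open>0 < \<epsilon>0\<close> assms(12) assms(17)[OF k] k] by auto
    show "\<forall>\<^sub>F e in at 0. \<forall>w\<in>unit_circle. F_pair b \<gamma> d k e (\<Omega> e) (Z e) (f e) w = 0"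
      using near by eventually_elim (use assms(14)[OF _ k] in blast)
  qed
  have side1: "vortex_side (b 1) (b 2) (\<gamma> 1) (\<gamma> 2) d \<Omega> (\<lambda>e. - Z e)
    (\<lambda>e. f e 1) (\<lambda>e. circle_deriv (f e 1)) (\<lambda>e. f e 2) (\<lambda>e. circle_deriv (f e 2)) (\<lambda>e. a e 1) (\<lambda>e. a e 2)"
    using side[of 1 2] by simp
  have side2: "vortex_side (b 2) (b 1) (\<gamma> 2) (\<gamma> 1) d \<Omega> (\<lambda>e. Z e - d)
    (\<lambda>e. f e 2) (\<lambda>e. circle_deriv (f e 2)) (\<lambda>e. f e 1) (\<lambda>e. circle_deriv (f e 1)) (\<lambda>e. a e 2) (\<lambda>e. a e 1)"
    using side[of 2 1] by simp
  \<comment> \<open>In the sum of the two relations for the mode 1 the terms with \<open>Z\<close>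
    cancel and \<open>- 2 * d * \<Omega>\<close> is left.\<close>
  have \<Omega>3: "unif_bigo unit_circle 3 (\<lambda>e w. of_real (\<Omega> e) - of_real \<Omega>\<^sub>0)"
  proof -
    have "unif_bigo unit_circle 3 (\<lambda>e w. of_real (- 1 / (2 * d)) * (of_real (2 * \<Omega> e * - Z e + \<gamma> 2 / d)
        + of_real (2 * \<Omega> e * (Z e - d) + \<gamma> 1 / d)))"
      by (rule unif_bigo_mono, (rule vortex_side.first_order(1)[OF side1] vortex_side.first_order(1)[OF side2] unif_bigo_add unif_bigo_mult unif_bigo_const)+) simp
    moreover have "- 1 / (2 * d) * ((2 * \<Omega> e * - Z e + \<gamma> 2 / d) + (2 * \<Omega> e * (Z e - d) + \<gamma> 1 / d)) = \<Omega> e - \<Omega>\<^sub>0" for e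
      unfolding \<Omega>\<^sub>0_def using d by (simp add: field_simps power2_eq_square)
    ultimately show ?thesis by (simp only: of_real_add[symmetric] of_real_mult[symmetric] of_real_diff)
  qed
  have \<Omega>\<^sub>0s: "vortex_side.\<Omega>0 (\<gamma> 1) (\<gamma> 2) d = \<Omega>\<^sub>0" "vortex_side.\<Omega>0 (\<gamma> 2) (\<gamma> 1) d = \<Omega>\<^sub>0"
    unfolding vortex_side.\<Omega>0_def[OF side1] vortex_side.\<Omega>0_def[OF side2] \<Omega>\<^sub>0_def by simp_all
  \<comment> \<open>Each domain takes the first-round coefficients of the other one for
    \<open>q1\<close> and \<open>q2\<close>.\<close>
  note hyp1 = \<Omega>3[folded \<Omega>\<^sub>0s(1)] vortex_side.unif_bigo_p1[OF side2] vortex_side.unif_bigo_p2[OF side2] vortex_side.first_order(2)[OF side2]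
  note hyp2 = \<Omega>3[folded \<Omega>\<^sub>0s(2)] vortex_side.unif_bigo_p1[OF side1] vortex_side.unif_bigo_p2[OF side1] vortex_side.first_order(2)[OF side1]
  have boundary: "unif_bigo unit_circle 6 (\<lambda>e w. \<phi> j e w
                 - (w + of_real (\<delta> j * (e * b j / d) ^ 2) * cnj w
                      + of_real (\<delta> j / 2 * (e * b j / d) ^ 3) * cnj w ^ 2
                      + of_real (\<delta> j / 3 * (e * b j / d) ^ 4)
                          * (cnj w ^ 3 + of_real (6 * (1 + \<delta> j)) * cnj w)
                      + of_real (\<delta> j / 4 * (e * b j / d) ^ 5)
                          * (cnj w ^ 4 + of_real (3 * (1 + \<delta> j)) * cnj w ^ 2)))" if "j \<in> {1, 2}" for j
  proof -
    have "\<delta> 1 = \<gamma> 2 / \<gamma> 1" "\<delta> 2 = \<gamma> 1 / \<gamma> 2" using assms(18) by (simp_all add: numeral_2_eq_2 numeral_3_eq_3)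
    then show ?thesis
      using that vortex_side.boundary_expansion[OF side1, OF hyp1] vortex_side.boundary_expansion[OF side2, OF hyp2]
      unfolding assms(19) boundary_param_def by auto
  qed
  \<comment> \<open>By the second round \<open>- 2 * \<Omega> * Z + M1\<close> and
    \<open>2 * \<Omega> * (Z - d) + M2\<close> are of order five. The claims on
    \<open>\<Omega>\<close> and \<open>Z\<close> are obtained by solving this system.\<close>
  define M1 where "M1 e = \<gamma> 2 / d * (1 - (e * b 2) ^ 2 * vortex_side.p1 (b 2) (\<gamma> 2) (\<gamma> 1) d e ^ 2) + \<gamma> 2 * (e * b 2) ^ 3 * vortex_side.p1 (b 2) (\<gamma> 2) (\<gamma> 1) d e / d ^ 3 + vortex_side.k1 (b 1) (\<gamma> 1) (\<gamma> 2) d e" for e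
  define M2 where "M2 e = \<gamma> 1 / d * (1 - (e * b 1) ^ 2 * vortex_side.p1 (b 1) (\<gamma> 1) (\<gamma> 2) d e ^ 2) + \<gamma> 1 * (e * b 1) ^ 3 * vortex_side.p1 (b 1) (\<gamma> 1) (\<gamma> 2) d e / d ^ 3 + vortex_side.k1 (b 2) (\<gamma> 2) (\<gamma> 1) d e" for e
  have L1: "unif_bigo unit_circle 5 (\<lambda>e w. of_real (2 * \<Omega> e * - Z e + M1 e))"
    using vortex_side.second_order(1)[OF side1, OF hyp1] unfolding M1_def by (simp only: add.assoc)
  have L2: "unif_bigo unit_circle 5 (\<lambda>e w. of_real (2 * \<Omega> e * (Z e - d) + M2 e))"
    using vortex_side.second_order(1)[OF side2, OF hyp2] unfolding M2_def by (simp only: add.assoc)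
  define \<Omega>t where "\<Omega>t e = (\<gamma> 1 + \<gamma> 2) / (2 * d\<^sup>2) + e ^ 4 / (2 * d ^ 6) * (\<gamma> 1 * b 2 ^ 4 + \<gamma> 2 * b 1 ^ 4)" for e
  define z4 where "z4 = (\<gamma> 2 ^ 3 / \<gamma> 1 * b 1 ^ 4 - \<gamma> 1 ^ 3 / \<gamma> 2 * b 2 ^ 4) / (d ^ 3 * (\<gamma> 1 + \<gamma> 2)\<^sup>2)"
  define Zt where "Zt e = Z\<^sub>0 + e ^ 4 * z4" for e
  \<comment> \<open>The product of the two corrections of order four in
    \<open>2 * \<Omega>t * Zt\<close>, the only term that \<open>M1\<close> does not match.\<close>
  define c8 where "c8 = - ((\<gamma> 1 * b 2 ^ 4 + \<gamma> 2 * b 1 ^ 4) / d ^ 6 * z4)"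
  have M12: "M1 e + M2 e = 2 * d * \<Omega>t e" for e
    unfolding M1_def M2_def \<Omega>t_def vortex_side.p1_def[OF side1] vortex_side.p1_def[OF side2] vortex_side.k1_def[OF side1] vortex_side.k1_def[OF side2] using d \<gamma>0
    by (simp add: field_simps eval_nat_numeral)
  have M1Z: "M1 e - 2 * \<Omega>t e * Zt e = c8 * e ^ 8" for e
  proof -
    define m4 \<omega>4 where "m4 = (b 2 ^ 4 * (\<gamma> 1 - \<gamma> 1 ^ 2 / \<gamma> 2) + b 1 ^ 4 * (\<gamma> 2 ^ 2 / \<gamma> 1)) / d ^ 5"
      and "\<omega>4 = (\<gamma> 1 * b 2 ^ 4 + \<gamma> 2 * b 1 ^ 4) / d ^ 6"
    have "M1 e = \<gamma> 2 / d + m4 * e ^ 4"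
      unfolding M1_def m4_def vortex_side.p1_def[OF side2] vortex_side.k1_def[OF side1] using d \<gamma>0
      by (simp add: field_simps eval_nat_numeral)
    moreover have "2 * \<Omega>t e = 2 * \<Omega>\<^sub>0 + e ^ 4 * \<omega>4"
      unfolding \<Omega>t_def \<Omega>\<^sub>0_def \<omega>4_def using d by (simp add: field_simps)
    moreover have "2 * \<Omega>\<^sub>0 * Z\<^sub>0 = \<gamma> 2 / d"
    proof -
      define \<sigma> where "\<sigma> = \<gamma> 1 + \<gamma> 2"
      have "\<sigma> \<noteq> 0" using \<gamma>0 unfolding \<sigma>_def by simp
      then show ?thesis
        unfolding \<Omega>\<^sub>0_def Z\<^sub>0_def \<sigma>_def[symmetric] using d by (simp add: field_simps power2_eq_square)
    qed
    \<comment> \<open>Comparison of the coefficients of \<open>e ^ 4\<close> in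
      \<open>M1 = 2 * \<Omega>t * Zt\<close>; it determines \<open>z4\<close>.\<close>
    moreover have "2 * \<Omega>\<^sub>0 * z4 + \<omega>4 * Z\<^sub>0 = m4"
    proof -
      define \<sigma> where "\<sigma> = \<gamma> 1 + \<gamma> 2"
      have \<sigma>: "\<sigma> \<noteq> 0" using \<gamma>0 unfolding \<sigma>_def by simp
      have "2 * \<Omega>\<^sub>0 * z4 + \<omega>4 * Z\<^sub>0 =
        ((\<gamma> 2 ^ 3 / \<gamma> 1 + \<gamma> 2 ^ 2) * b 1 ^ 4 + (\<gamma> 1 * \<gamma> 2 - \<gamma> 1 ^ 3 / \<gamma> 2) * b 2 ^ 4) / (\<sigma> * d ^ 5)"
        unfolding \<Omega>\<^sub>0_def z4_def \<omega>4_def Z\<^sub>0_def \<sigma>_def[symmetric] using d \<sigma> \<gamma>0(1,2)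
        by (simp add: field_simps eval_nat_numeral)
      also have "\<gamma> 2 ^ 3 / \<gamma> 1 + \<gamma> 2 ^ 2 = \<sigma> * (\<gamma> 2 ^ 2 / \<gamma> 1)"
        unfolding \<sigma>_def using \<gamma>0(1) by (simp add: field_simps eval_nat_numeral)
      also have "\<gamma> 1 * \<gamma> 2 - \<gamma> 1 ^ 3 / \<gamma> 2 = \<sigma> * (\<gamma> 1 - \<gamma> 1 ^ 2 / \<gamma> 2)"
        unfolding \<sigma>_def using \<gamma>0(2) by (simp add: field_simps eval_nat_numeral)
      also have "(\<sigma> * (\<gamma> 2 ^ 2 / \<gamma> 1) * b 1 ^ 4 + \<sigma> * (\<gamma> 1 - \<gamma> 1 ^ 2 / \<gamma> 2) * b 2 ^ 4) / (\<sigma> * d ^ 5)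
        = (\<sigma> * (b 2 ^ 4 * (\<gamma> 1 - \<gamma> 1 ^ 2 / \<gamma> 2) + b 1 ^ 4 * (\<gamma> 2 ^ 2 / \<gamma> 1))) / (\<sigma> * d ^ 5)"
        by (simp add: algebra_simps)
      also have "\<dots> = m4" unfolding m4_def using \<sigma> by simp
      finally show ?thesis .
    qed
    moreover have "c8 = - (\<omega>4 * z4)" unfolding c8_def \<omega>4_def ..
    ultimately show ?thesis unfolding Zt_def by algebra
  qed
  have \<Omega>5: "unif_bigo unit_circle 5 (\<lambda>e w. of_real (\<Omega> e - \<Omega>t e))"
  proof -
    have "unif_bigo unit_circle 5 (\<lambda>e w. of_real (- 1 / (2 * d)) * (of_real (2 * \<Omega> e * - Z e + M1 e)
        + of_real (2 * \<Omega> e * (Z e - d) + M2 e)))"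
      by (rule unif_bigo_mono, (rule L1 L2 unif_bigo_add unif_bigo_mult unif_bigo_const)+) simp
    moreover have "- 1 / (2 * d) * ((2 * \<Omega> e * - Z e + M1 e) + (2 * \<Omega> e * (Z e - d) + M2 e)) = \<Omega> e - \<Omega>t e" for e
    proof -
      have "(2 * \<Omega> e * - Z e + M1 e) + (2 * \<Omega> e * (Z e - d) + M2 e) = - (2 * d) * (\<Omega> e - \<Omega>t e)"
        using M12[of e] by (simp add: algebra_simps)
      then show ?thesis using d by simp
    qed
    ultimately show ?thesis by (simp only: of_real_add[symmetric] of_real_mult[symmetric])
  qed
  have Z5: "unif_bigo unit_circle 5 (\<lambda>e w. of_real (Z e - Zt e))"
  proof -
    \<comment> \<open>\<open>\<Omega> e = \<Omega>\<^sub>0 * (1 + u e)\<close> with \<open>u\<close>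
      small, so that the relation \<open>2 * \<Omega> * (Z - Zt) = ...\<close> can be divided by
      \<open>\<Omega>\<close> without loss of order.\<close>
    define u where "u e = complex_of_real (1 / \<Omega>\<^sub>0) * (complex_of_real (\<Omega> e) - complex_of_real \<Omega>\<^sub>0)" for e
    have Ou: "unif_bigo unit_circle (Suc 2) (\<lambda>e w. u e)"
      unfolding u_def by (rule unif_bigo_mono, (rule \<Omega>3 unif_bigo_mult unif_bigo_const)+) simp
    have Oe8: "unif_bigo unit_circle 8 (\<lambda>e w. of_real (e ^ 8))"
      unfolding of_real_power by (rule unif_bigo_mono, (rule unif_bigo_power unif_bigo_eps)+) simp
    have Oe4: "unif_bigo unit_circle 0 (\<lambda>e w. of_real (Zt e))"
      unfolding Zt_def of_real_add of_real_mult of_real_power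
      by (rule unif_bigo_mono, (rule unif_bigo_const unif_bigo_add unif_bigo_mult unif_bigo_power unif_bigo_eps)+) simp
    have "unif_bigo unit_circle 5 (\<lambda>e w. (of_real c8 * of_real (e ^ 8) - of_real (2 * \<Omega> e * - Z e + M1 e)
        - 2 * of_real (\<Omega> e - \<Omega>t e) * of_real (Zt e)) * inverse (1 + u e) * of_real (1 / (2 * \<Omega>\<^sub>0)))"
      by (rule unif_bigo_mono, (rule L1 \<Omega>5 Oe8 Oe4 unif_bigo_inverse[OF Ou] unif_bigo_diff unif_bigo_mult unif_bigo_const)+) simp
    then show ?thesis
    proof (rule unif_bigo_cong)
      have "\<forall>\<^sub>F e in at 0. \<forall>w\<in>unit_circle. cmod (u e) < 1"
        by (rule unif_bigo_tendsto_0[OF Ou]) simp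
      then show "\<forall>\<^sub>F e in at 0. \<forall>w\<in>unit_circle. of_real (Z e - Zt e) =
          (of_real c8 * of_real (e ^ 8) - of_real (2 * \<Omega> e * - Z e + M1 e)
        - 2 * of_real (\<Omega> e - \<Omega>t e) * of_real (Zt e)) * inverse (1 + u e) * of_real (1 / (2 * \<Omega>\<^sub>0))"
      proof eventually_elim
        case (elim e)
        show ?case
        proof
          fix w :: complex assume "w \<in> unit_circle"
          then have "1 + u e \<noteq> 0"
            using elim by (metis add_eq_0_iff norm_minus_cancel norm_one order_less_irrefl)
          moreover have u: "1 + u e = of_real (\<Omega> e / \<Omega>\<^sub>0)" unfolding u_def using \<Omega>\<^sub>0 by (simp add: field_simps)
          ultimately have \<Omega>e: "\<Omega> e \<noteq> 0" by auto
          have "c8 * e ^ 8 - (2 * \<Omega> e * - Z e + M1 e) - 2 * (\<Omega> e - \<Omega>t e) * Zt e = 2 * \<Omega> e * (Z e - Zt e)"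
            unfolding M1Z[of e, symmetric] by (simp add: algebra_simps)
          then have "(c8 * e ^ 8 - (2 * \<Omega> e * - Z e + M1 e) - 2 * (\<Omega> e - \<Omega>t e) * Zt e) * inverse (\<Omega> e / \<Omega>\<^sub>0) * (1 / (2 * \<Omega>\<^sub>0)) = Z e - Zt e"
            using \<Omega>\<^sub>0 \<Omega>e by simp
          then show "of_real (Z e - Zt e) = (of_real c8 * of_real (e ^ 8) - of_real (2 * \<Omega> e * - Z e + M1 e)
            - 2 * of_real (\<Omega> e - \<Omega>t e) * of_real (Zt e)) * inverse (1 + u e) * of_real (1 / (2 * \<Omega>\<^sub>0))"
            unfolding u by (metis of_real_diff of_real_inverse of_real_mult of_real_numeral)
        qed
      qed
    qed
  qed
  have Zt: "Zt e = \<gamma> 2 * d / (\<gamma> 1 + \<gamma> 2) + e ^ 4 / (d ^ 3 * (\<gamma> 1 + \<gamma> 2)\<^sup>2)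
       * (\<gamma> 2 ^ 3 / \<gamma> 1 * b 1 ^ 4 - \<gamma> 1 ^ 3 / \<gamma> 2 * b 2 ^ 4)" for e
    unfolding Zt_def Z\<^sub>0_def z4_def by (simp add: mult.commute)
  show ?thesis
    using boundary \<Omega>5 Z5 unfolding \<Omega>t_def Zt
    by (intro conjI ballI unif_bigo_imp_uniform_limit unif_bigo_imp_smallo) simp_all
qed

end
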